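(* Let $I=[0,b]$ with $b\in A$, $b>0$, let $G$ be a subgroup of $G(I;A,P)$ containing $B(I;A,P)$, and let $\psi\colon G\to P$ be the homomorphism $g\mapsto\sigma_\ell(g)\cdot\sigma_r(g)$. Then $\psi\circ\alpha=\psi$ for every automorphism $\alpha$ of $G$, except possibly when $G$ satisfies all three of the following conditions: (a) the image of $\sigma_\ell\colon G\to P$ is cyclic; (b) $G$ admits a decreasing automorphism; (c) $G$ does not admit a decreasing automorphism induced by an auto-homeomorphism $\vartheta\colon I\to I$ that is differentiable in both end points with non-zero derivatives there.
   Context: $P$ is a non-trivial subgroup of $\mathbb{R}^\times_{>0}$ and $A$ is a non-zero additive subgroup of $\mathbb{R}$ stable under multiplication by $P$. $\mathrm{PL}_o(\mathbb{R})$ is the group of orientation preserving piecewise linear homeomorphisms of $\mathbb{R}$ with finitely many break points (points where left and right derivative differ). $G(I;A,P)$ is the subgroup of all $g\in\mathrm{PL}_o(\mathbb{R})$ whose support $\{t\mid g(t)\ne t\}$ is contained in $I$, whose slopes lie in $P$, whose break points lie in $A$, and with $g(A)=A$. $B(I;A,P)$ is the subgroup of those $g\in G(I;A,P)$ that are the identity near both end points of $I$. $\sigma_\ell(g)$ is the right derivative of $g$ at $0$ and $\sigma_r(g)$ is the left derivative of $g$ at $b$. It is known that every automorphism $\alpha$ of a group $G$ with $B(I;A,P)\subseteq G\subseteq G(I;A,P)$ is induced by conjugation by a unique homeomorphism $\varphi_\alpha$ of the interior $\mathrm{Int}(I)$, i.e. $\alpha(g)|_{\mathrm{Int}(I)}=\varphi_\alpha\circ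 g|_{\mathrm{Int}(I)}\circ\varphi_\alpha^{-1}$ for all $g\in G$; as $I$ is compact, $\varphi_\alpha$ extends uniquely to a homeomorphism of $I$, which is also said to induce $\alpha$. The automorphism $\alpha$ is called increasing (decreasing) if $\varphi_\alpha$ is increasing (decreasing). *)

theory Defs
  imports "HOL-Analysis.Analysis" "HOL-Algebra.Elementary_Groups"
begin

definition pos_real_group :: "real monoid" where
  "pos_real_group = \<lparr>carrier = {0<..}, mult = (*), one = 1\<rparr>"

definition add_real_group :: "real monoid" where
  "add_real_group = \<lparr>carrier = UNIV, mult = (+), one = 0\<rparr>"

definition affine_on :: "real set \<Rightarrow> (real \<Rightarrow> real) \<Rightarrow> bool" where
  "affine_on J f \<longleftrightarrow> (\<exists>m c. \<forall>x\<in>J. f x = m * x + c)"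

text \<open>Orientation preserving homeomorphisms of the real line that are affine on every open interval
  avoiding some finite set; such a function has only finitely many break points, and it is affine on
  every open interval that contains no break point.\<close>

definition PL_o :: "(real \<Rightarrow> real) set" where
  "PL_o = {f. (\<exists>f'. homeomorphism UNIV UNIV f f') \<and> strict_mono f \<and>
              (\<exists>S. finite S \<and> (\<forall>u v. {u<..<v} \<inter> S = {} \<longrightarrow> affine_on {u<..<v} f))}"

definition break_points :: "(real \<Rightarrow> real) \<Rightarrow> real set" where
  "break_points f = {t. \<exists>d e. (f has_real_derivative d) (at_left t) \<and>
                              (f has_real_derivative e) (at_right t) \<and> d \<noteq> e}"

text \<open>For \<open>f \<in> PL_o\<close> the two-sided derivatives are exactly the slopes of the affine pieces,
  because every piece has interior points.\<close>

definition slopes :: "(real \<Rightarrow> real) \<Rightarrow> real set" where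
  "slopes f = {d. \<exists>t. (f has_real_derivative d) (at t)}"

definition support :: "(real \<Rightarrow> real) \<Rightarrow> real set" where
  "support f = {t. f t \<noteq> t}"

definition PL_G :: "real set \<Rightarrow> real set \<Rightarrow> real set \<Rightarrow> (real \<Rightarrow> real) set" where
  "PL_G I A P = {g \<in> PL_o. support g \<subseteq> I \<and> slopes g \<subseteq> P \<and> break_points g \<subseteq> A \<and> g ` A = A}"

text \<open>Elements of \<open>PL_G {l..u} A P\<close> are the identity outside \<open>{l..u}\<close>, so neighbourhoods of the end
  points in the real line may be used instead of neighbourhoods in \<open>{l..u}\<close>.\<close>

definition PL_B :: "real \<Rightarrow> real \<Rightarrow> real set \<Rightarrow> real set \<Rightarrow> (real \<Rightarrow> real) set" where
  "PL_B l u A P = {g \<in> PL_G {l..u} A P.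
     (\<forall>\<^sub>F t in nhds l. g t = t) \<and> (\<forall>\<^sub>F t in nhds u. g t = t)}"

definition comp_group :: "(real \<Rightarrow> real) set \<Rightarrow> (real \<Rightarrow> real) monoid" where
  "comp_group H = \<lparr>carrier = H, mult = (\<circ>), one = id\<rparr>"

abbreviation aut :: "(real \<Rightarrow> real) set \<Rightarrow> ((real \<Rightarrow> real) \<Rightarrow> (real \<Rightarrow> real)) set" where
  "aut G \<equiv> iso (comp_group G) (comp_group G)"

definition sigma_l :: "(real \<Rightarrow> real) \<Rightarrow> real" where
  "sigma_l g = vector_derivative g (at_right 0)"

definition sigma_r :: "real \<Rightarrow> (real \<Rightarrow> real) \<Rightarrow> real" where
  "sigma_r b g = vector_derivative g (at_left b)"

definition psi :: "real \<Rightarrow> (real \<Rightarrow> real) \<Rightarrow> real" where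
  "psi b g = sigma_l g * sigma_r b g"

definition conj_on :: "real set \<Rightarrow> (real \<Rightarrow> real) \<Rightarrow> (real \<Rightarrow> real) set
    \<Rightarrow> ((real \<Rightarrow> real) \<Rightarrow> (real \<Rightarrow> real)) \<Rightarrow> bool" where
  "conj_on S \<phi> G \<alpha> \<longleftrightarrow> (\<forall>g\<in>G. \<forall>t\<in>S. \<alpha> g t = \<phi> (g (inv_into S \<phi> t)))"

text \<open>\<open>\<phi>\<close> is a homeomorphism of the open interval \<open>interior I\<close>, and conjugation by it is \<open>\<alpha>\<close>. For the
  groups \<open>G\<close> considered here such a \<open>\<phi>\<close> exists and is unique on \<open>interior I\<close>; the existential
  quantifier in \<open>decreasing_aut\<close> picks it.\<close>

definition induces_int :: "real set \<Rightarrow> (real \<Rightarrow> real) \<Rightarrow> (real \<Rightarrow> real) set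
    \<Rightarrow> ((real \<Rightarrow> real) \<Rightarrow> (real \<Rightarrow> real)) \<Rightarrow> bool" where
  "induces_int I \<phi> G \<alpha> \<longleftrightarrow>
     (\<exists>\<phi>'. homeomorphism (interior I) (interior I) \<phi> \<phi>') \<and> conj_on (interior I) \<phi> G \<alpha>"

definition decreasing_aut :: "real set \<Rightarrow> (real \<Rightarrow> real) set
    \<Rightarrow> ((real \<Rightarrow> real) \<Rightarrow> (real \<Rightarrow> real)) \<Rightarrow> bool" where
  "decreasing_aut I G \<alpha> \<longleftrightarrow>
     \<alpha> \<in> aut G \<and> (\<exists>\<phi>. induces_int I \<phi> G \<alpha> \<and> strict_antimono_on (interior I) \<phi>)"

text \<open>\<open>\<theta>\<close> is an auto-homeomorphism of \<open>I\<close> extending the homeomorphism of \<open>interior I\<close>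
  that induces \<open>\<alpha>\<close>.\<close>

definition induces :: "real set \<Rightarrow> (real \<Rightarrow> real) \<Rightarrow> (real \<Rightarrow> real) set
    \<Rightarrow> ((real \<Rightarrow> real) \<Rightarrow> (real \<Rightarrow> real)) \<Rightarrow> bool" where
  "induces I \<theta> G \<alpha> \<longleftrightarrow> (\<exists>\<theta>'. homeomorphism I I \<theta> \<theta>') \<and> induces_int I \<theta> G \<alpha>"

definition diff_at_ends :: "real \<Rightarrow> real \<Rightarrow> (real \<Rightarrow> real) \<Rightarrow> bool" where
  "diff_at_ends l u \<theta> \<longleftrightarrow>
     (\<exists>d. d \<noteq> 0 \<and> (\<theta> has_real_derivative d) (at l within {l..u})) \<and>
     (\<exists>d. d \<noteq> 0 \<and> (\<theta> has_real_derivative d) (at u within {l..u}))"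

end

theory Submission
  imports Defs
begin

text \<open>An automorphism \<open>\<alpha>\<close> of \<open>G\<close> is conjugation by a monotone bijection \<open>\<phi>\<close> of the open interval, and
  everything depends on how \<open>\<phi>\<close> acts on germs at the end points. Near \<open>0\<close> an element \<open>g\<close> is multiplication
  by its slope \<open>\<sigma>\<^sub>\<ell> g\<close>. If \<open>\<phi>\<close> is increasing, then comparing elements near \<open>0\<close> shows that
  \<open>\<sigma>\<^sub>\<ell> g \<mapsto> \<sigma>\<^sub>\<ell> (\<alpha> g)\<close> is an order preserving isomorphism of groups of slopes, hence a power
  \<open>p \<mapsto> p powr s\<close> with \<open>s > 0\<close> (\<open>sigma_l_alpha_powr\<close>). If the slopes are dense in the positive reals, the
  relation \<open>\<phi> (p * t) = p powr s * \<phi> t\<close> forces \<open>\<phi>\<close> to be a multiple of \<open>t powr s\<close> near \<open>0\<close>, and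
  since \<open>G\<close> contains elements that are affine but not linear on small intervals close to \<open>0\<close>, conjugation
  by such a power function leaves the piecewise linear world unless \<open>s = 1\<close> (\<open>exponent_eq_1\<close>). If
  the slopes are not dense, they form a cyclic group, and then \<open>s = 1\<close> follows as soon as the
  groups of slopes before and after conjugation coincide (\<open>sigma_l_alpha_same_image\<close>).

  For an increasing automorphism these groups do coincide, so both slopes are preserved, at the right end
  point by reflection. A decreasing automorphism relates the slopes at \<open>0\<close> with those at \<open>b\<close>; viewed as an
  increasing conjugation between \<open>G\<close> and its mirror image, it exchanges \<open>\<sigma>\<^sub>\<ell>\<close> and \<open>\<sigma>\<^sub>r\<close>, and therefore
  preserves their product, if the slopes at \<open>0\<close> are dense or the two groups of slopes agree. The latter
  holds whenever some decreasing automorphism is induced by a map that has non-zero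
  derivatives at the end points, by the chain rule. What remains is exactly the exceptional case.

  That every automorphism is a conjugation is proved by recovering the interval from the group. Disjointness of
  supports has a characterization by commutators (\<open>algebraically_disjoint_iff\<close>), so automorphisms respect it. A
  point \<open>x\<close> is encoded by the subgroups of elements supported to the left and to the right of \<open>x\<close>; these pairs
  are characterized in terms of disjointness and conjugation alone (\<open>cut_pair_rigid\<close>,
  \<open>cut_pairE\<close>), so automorphisms permute them, and inclusion of left parts recovers the order up to reversal
  (\<open>automorphism_spatial\<close>).\<close>


section \<open>Locally moving groups of homeomorphisms of an interval\<close>

abbreviation fun_inv :: "(real \<Rightarrow> real) \<Rightarrow> real \<Rightarrow> real" where
  "fun_inv \<equiv> inv_into UNIV"

text \<open>These properties of a group between \<open>PL_B 0 b A P\<close> and \<open>PL_G {0..b} A P\<close> are all that the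
  reconstruction of the interval from the abstract group uses. The last one supplies, at every point
  and in every neighbourhood of it, an element that moves the point and is the identity outside the
  neighbourhood.\<close>

locale moving_group =
  fixes b :: real and G :: "(real \<Rightarrow> real) set"
  assumes id_mem: "id \<in> G"
    and comp_mem: "g \<in> G \<Longrightarrow> h \<in> G \<Longrightarrow> g \<circ> h \<in> G"
    and inv_mem: "g \<in> G \<Longrightarrow> fun_inv g \<in> G"
    and bij: "g \<in> G \<Longrightarrow> bij g"
    and increasing: "g \<in> G \<Longrightarrow> strict_mono g"
    and fixes_outside: "g \<in> G \<Longrightarrow> t \<notin> {0<..<b} \<Longrightarrow> g t = t"
    and moving: "0 \<le> c \<Longrightarrow> c < s \<Longrightarrow> s < d \<Longrightarrow> d \<le> b \<Longrightarrow>
      \<exists>g\<in>G. (\<forall>t. t \<notin> {c<..<d} \<longrightarrow> g t = t) \<and> g s \<noteq> s"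
begin

lemma inv_apply [simp]: "g \<in> G \<Longrightarrow> fun_inv g (g t) = t"
  by (simp add: bij bij_is_inj)

lemma apply_inv [simp]: "g \<in> G \<Longrightarrow> g (fun_inv g t) = t"
  using bij bij_is_surj surj_f_inv_f by metis

lemma inv_comp: "g \<in> G \<Longrightarrow> fun_inv g \<circ> g = id" "g \<in> G \<Longrightarrow> g \<circ> fun_inv g = id"
  by (auto simp: fun_eq_iff)

lemma less_iff [simp]: "g \<in> G \<Longrightarrow> g s < g t \<longleftrightarrow> s < t"
  by (simp add: increasing strict_mono_less)

lemma le_iff [simp]: "g \<in> G \<Longrightarrow> g s \<le> g t \<longleftrightarrow> s \<le> t"
  by (simp add: increasing strict_mono_less_eq)

lemma eq_iff [simp]: "g \<in> G \<Longrightarrow> g s = g t \<longleftrightarrow> s = t"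
  by (simp add: increasing strict_mono_eq)

lemma inv_less_iff: "g \<in> G \<Longrightarrow> fun_inv g s < t \<longleftrightarrow> s < g t"
  using less_iff[of g "fun_inv g s" t] by simp

lemma less_inv_iff: "g \<in> G \<Longrightarrow> s < fun_inv g t \<longleftrightarrow> g s < t"
  using less_iff[of g s "fun_inv g t"] by simp

lemma inv_eq_iff: "g \<in> G \<Longrightarrow> fun_inv g s = t \<longleftrightarrow> s = g t"
  by (metis apply_inv inv_apply)

lemma inv_fixes [simp]: "g \<in> G \<Longrightarrow> g t = t \<Longrightarrow> fun_inv g t = t"
  by (metis inv_apply)

lemma continuous: "g \<in> G \<Longrightarrow> isCont g t"
proof -
  assume g: "g \<in> G"
  have "open (g ` UNIV)" using bij[OF g] by (simp add: bij_is_surj)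
  then have "continuous_on UNIV g"
    by (rule continuous_onI_mono) (use g in auto)
  then show ?thesis by (simp add: continuous_on_eq_continuous_at)
qed

lemma preserves_interval: "g \<in> G \<Longrightarrow> g t \<in> {0<..<b} \<longleftrightarrow> t \<in> {0<..<b}"
  by (metis eq_iff fixes_outside)

lemma moves_inside: "g \<in> G \<Longrightarrow> g t \<noteq> t \<Longrightarrow> 0 < t \<and> t < b"
  using fixes_outside by fastforce

text \<open>The end points \<open>0\<close> and \<open>b\<close> are clamped into the bounds so that the interval can be fed to
  \<open>moving\<close> directly.\<close>

lemma moves_near:
  assumes "g \<in> G" "g t \<noteq> t"
  obtains c d where "0 \<le> c" "c < t" "t < d" "d \<le> b" "\<And>s. c < s \<Longrightarrow> s < d \<Longrightarrow> g s \<noteq> s"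
proof -
  have t: "0 < t" "t < b" using moves_inside assms by auto
  have "open {s. g s \<noteq> s}"
    using continuous[OF assms(1)]
    by (intro open_Collect_neq continuous_intros) (simp add: continuous_at_imp_continuous_on)
  then obtain e where e: "e > 0" "\<And>s. dist s t < e \<Longrightarrow> g s \<noteq> s"
    using assms(2) unfolding open_dist by blast
  show ?thesis
  proof (rule that[of "max 0 (t - e)" "min b (t + e)"])
    show "g s \<noteq> s" if "max 0 (t - e) < s" "s < min b (t + e)" for s
      using that by (intro e(2)) (auto simp: dist_real_def)
  qed (use t e in auto)
qed

lemma wandering_up:
  assumes g: "g \<in> G" and "t < g t"
  obtains c d where "c < t" "t < d" "\<And>s. c < s \<Longrightarrow> d < g s"
proof -
  obtain d where d: "t < d" "d < g t" using dense assms by blast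
  show ?thesis
    by (rule that[of "fun_inv g d" d]) (use d g in \<open>auto simp: inv_less_iff\<close>)
qed

text \<open>On the line an orientation preserving map that moves a point pushes a whole neighbourhood off
  itself, and no later power ever brings it back, because all powers push in the same direction. Hence
  the criterion for disjoint supports below is an equivalence, without passing to powers.\<close>

lemma wandering:
  assumes g: "g \<in> G" and "g t \<noteq> t"
  obtains c d where "c < t" "t < d"
    "\<And>s n. c < s \<Longrightarrow> s < d \<Longrightarrow> (g ^^ Suc n) s \<notin> {c<..<d}"
proof (cases "t < g t")
  case True
  then obtain c d where cd: "c < t" "t < d" "\<And>s. c < s \<Longrightarrow> d < g s"
    using wandering_up g by blast
  have *: "d < (g ^^ Suc n) s" if "c < s" for s n
  proof (induction n)
    case 0
    then show ?case using cd that by simp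
  next
    case (Suc n)
    then have "c < (g ^^ Suc n) s" using cd by linarith
    then show ?case using cd(3) by simp
  qed
  show ?thesis
  proof (rule that[OF cd(1,2)])
    show "(g ^^ Suc n) s \<notin> {c<..<d}" if "c < s" "s < d" for s n
      using *[OF that(1), of n] by (metis greaterThanLessThan_iff less_asym)
  qed
next
  case False
  then have lt: "g t < t" using assms by auto
  then obtain c where c: "g t < c" "c < t" using dense by blast
  define d where "d = fun_inv g c"
  have d: "t < d" using c g by (simp add: d_def less_inv_iff)
  have *: "s < d \<longleftrightarrow> g s < c" for s using g by (simp add: d_def less_inv_iff)
  have **: "(g ^^ Suc n) s < c" if "s < d" for s n
  proof (induction n)
    case 0
    then show ?case using * that by simp
  next
    case (Suc n)
    then have "(g ^^ Suc n) s < d" using c d by linarith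
    then show ?case using * by simp
  qed
  show ?thesis
  proof (rule that[OF c(2) d])
    show "(g ^^ Suc n) s \<notin> {c<..<d}" if "c < s" "s < d" for s n
      using **[OF that(2), of n] by (metis greaterThanLessThan_iff less_asym)
  qed
qed

definition supported :: "(real \<Rightarrow> real) \<Rightarrow> real \<Rightarrow> real \<Rightarrow> bool" where
  "supported g c d \<longleftrightarrow> (\<forall>t. t \<notin> {c<..<d} \<longrightarrow> g t = t)"

lemma supported_maps:
  assumes "g \<in> G" "supported g c d" 
  shows "g t \<in> {c<..<d} \<longleftrightarrow> t \<in> {c<..<d}"
  by (metis assms eq_iff supported_def)

lemma supported_inv: "g \<in> G \<Longrightarrow> supported g c d \<Longrightarrow> supported (fun_inv g) c d"
  by (auto simp: supported_def)

lemma moving_up: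
  assumes "0 \<le> c" "c < s" "s < d" "d \<le> b"
  obtains g where "g \<in> G" "supported g c d" "s < g s"
proof -
  obtain g where g: "g \<in> G" "supported g c d" "g s \<noteq> s"
    using moving[OF assms] unfolding supported_def by blast
  show ?thesis
  proof (cases "s < g s")
    case True then show ?thesis using g that by blast
  next
    case False
    then have "s < fun_inv g s" using g by (simp add: less_inv_iff)
    then show ?thesis using that g supported_inv inv_mem by blast
  qed
qed

text \<open>The supremum of the part of the orbit of \<open>v\<close> that lies below \<open>w\<close> must be \<open>w\<close>: at a
  smaller supremum some element supported below \<open>w\<close> moves the supremum up, and with it the orbit points
  just below it.\<close>

lemma approximately_transitive_up:
  assumes cd: "0 \<le> c" "c < v" "v \<le> w" "w < d" "d \<le> b" and "e > 0"
  obtains g where "g \<in> G" "supported g c d" "w - e < g v" "g v \<le> w"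
proof -
  define S where "S = {g v | g. g \<in> G \<and> supported g c d \<and> g v \<le> w}"
  have "v \<in> S" unfolding S_def using id_mem cd by (auto simp: supported_def intro!: exI[of _ id])
  have bdd: "bdd_above S" unfolding S_def by (auto intro!: bdd_aboveI)
  define s where "s = Sup S"
  have s: "v \<le> s" "s \<le> w" 
    unfolding s_def using bdd \<open>v \<in> S\<close> 
    by (auto intro!: cSup_upper cSup_least simp: S_def)
  have "s = w"
  proof (rule ccontr)
    assume "s \<noteq> w"
    then have "s < w" using s by auto
    then obtain h where h: "h \<in> G" "supported h c w" "s < h s"
      using moving_up[of c s w] cd s by auto
    have "fun_inv h s < s" using h by (simp add: inv_less_iff)
    then obtain t where t: "t \<in> S" "fun_inv h s < t" 
      unfolding s_def using less_cSupD \<open>v \<in> S\<close> by blast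
    obtain g where g: "g \<in> G" "supported g c d" "g v = t" "t \<le> w"
      using t unfolding S_def by auto
    have "h t \<le> w" 
      using h(1,2) g(4) by (metis le_iff supported_def greaterThanLessThan_iff less_irrefl)
    moreover have "supported (h \<circ> g) c d"
      using h(2) g(2) cd s by (auto simp: supported_def)
    moreover have "h \<circ> g \<in> G" using g h comp_mem by blast
    ultimately have "h t \<in> S" unfolding S_def mem_Collect_eq
      using g(3) by (intro exI[of _ "h \<circ> g"]) simp
    then have "h t \<le> s" unfolding s_def using bdd by (rule cSup_upper)
    then show False using t h by (simp add: inv_less_iff)
  qed
  then have "w - e < Sup S" using \<open>e > 0\<close> s_def by simp
  then obtain t where "t \<in> S" "w - e < t" using less_cSupD \<open>v \<in> S\<close> by blast
  then show ?thesis using that unfolding S_def by auto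
qed

lemma approximately_transitive:
  assumes cd: "0 \<le> c" "d \<le> b" and v: "v \<in> {c<..<d}" and w: "w \<in> {c<..<d}"
    and V: "v1 < v" "v < v2" and W: "w1 < w" "w < w2"
  obtains g t where "g \<in> G" "supported g c d" "v1 < t" "t < v2" "w1 < g t" "g t < w2"
proof (cases "v \<le> w")
  case True
  obtain g where "g \<in> G" "supported g c d" "w - (w - w1) < g v" "g v \<le> w"
    by (rule approximately_transitive_up[of c v w d "w - w1"]) (use cd v w W True in auto)
  then show ?thesis using that[of g v] W V by auto
next
  case False
  obtain g where g: "g \<in> G" "supported g c d" "v - (v - v1) < g w" "g w \<le> v"
    by (rule approximately_transitive_up[of c w v d "v - v1"]) (use cd v w V False in auto)
  then show ?thesis using that[of "fun_inv g" "g w"] inv_mem supported_inv W V by auto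
qed

section \<open>Disjointness of supports in terms of the group structure\<close>

definition disjoint_supports :: "(real \<Rightarrow> real) \<Rightarrow> (real \<Rightarrow> real) \<Rightarrow> bool" where
  "disjoint_supports f g \<longleftrightarrow> (\<forall>t. f t = t \<or> g t = t)"

definition commutator :: "(real \<Rightarrow> real) \<Rightarrow> (real \<Rightarrow> real) \<Rightarrow> (real \<Rightarrow> real)" where
  "commutator f g = f \<circ> g \<circ> fun_inv f \<circ> fun_inv g"

text \<open>A criterion for disjoint supports that mentions only the group operations, so that every
  automorphism respects it. The idea is Rubin's: if the support of \<open>f\<close> avoids that of \<open>g\<close>, then from any
  \<open>h\<close> that does not commute with \<open>f\<close> one can carve out, by two commutators with elements
  living on a small piece of the support of \<open>f\<close>, a non-trivial element that commutes with \<open>g\<close>.\<close>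

definition algebraically_disjoint :: "(real \<Rightarrow> real) \<Rightarrow> (real \<Rightarrow> real) \<Rightarrow> bool" where
  "algebraically_disjoint f g \<longleftrightarrow> (\<forall>h\<in>G. f \<circ> h \<noteq> h \<circ> f \<longrightarrow>
     (\<exists>f1\<in>G. \<exists>f2\<in>G. f1 \<circ> g = g \<circ> f1 \<and> f2 \<circ> g = g \<circ> f2 \<and>
        commutator f1 (commutator f2 h) \<noteq> id \<and> commutator f1 (commutator f2 h) \<circ> g = g \<circ> commutator f1 (commutator f2 h)))"

lemma commutator_mem: "f \<in> G \<Longrightarrow> g \<in> G \<Longrightarrow> commutator f g \<in> G"
  unfolding commutator_def by (intro comp_mem inv_mem)

lemma disjoint_supports_commute:
  assumes "f \<in> G" "g \<in> G" "disjoint_supports f g" shows "f \<circ> g = g \<circ> f"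
proof
  fix t show "(f \<circ> g) t = (g \<circ> f) t"
    using assms unfolding disjoint_supports_def comp_def by (metis eq_iff)
qed

text \<open>If \<open>g\<close> moves \<open>s\<close> up and \<open>f\<close> moves \<open>s\<close> but is supported below \<open>g s\<close>, then \<open>f\<close> and
  \<open>g\<close> do not commute: the two composites differ at \<open>s\<close>.\<close>

lemma noncommuting_pair:
  assumes "0 \<le> c" "c < d" "d \<le> b"
  obtains f g where "f \<in> G" "g \<in> G" "supported f c d" "supported g c d" "commutator f g \<noteq> id"
proof -
  obtain s where s: "c < s" "s < d" using dense assms by blast
  obtain g where g: "g \<in> G" "supported g c d" "s < g s"
    using moving_up[of c s d] assms s by auto
  have gs: "g s < d" using supported_maps[OF g(1,2), of s] s by auto
  obtain f where f: "f \<in> G" "supported f c (g s)" "s < f s"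
    using moving_up[of c s "g s"] assms s g gs by auto
  have "f (g s) = g s" using f by (auto simp: supported_def)
  moreover have "commutator f g (g (f s)) = f (g s)"
    using f g by (simp add: commutator_def)
  ultimately have "commutator f g (g (f s)) \<noteq> g (f s)" using f g by simp
  then have "commutator f g \<noteq> id" by auto
  moreover have "supported f c d" using f(2) gs by (auto simp: supported_def)
  ultimately show ?thesis using that f g by blast
qed

text \<open>Let \<open>V\<close> be an interval inside the support of \<open>f\<close> that \<open>h\<close> moves off itself. For \<open>f2\<close>
  supported in \<open>V\<close>, the commutator of \<open>f2\<close> and \<open>h\<close> acts like \<open>f2\<close> on \<open>V\<close> and otherwise only on
  the image of \<open>V\<close> under \<open>h\<close>; commuting it with \<open>f1\<close> supported in \<open>V\<close> leaves just the
  commutator of \<open>f1\<close> and \<open>f2\<close>, which lives where \<open>g\<close> is the identity.\<close>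

lemma disjoint_imp_algebraically_disjoint:
  assumes f: "f \<in> G" and g: "g \<in> G" and fg: "disjoint_supports f g"
  shows "algebraically_disjoint f g"
  unfolding algebraically_disjoint_def
proof (intro ballI impI)
  fix h assume h: "h \<in> G" and nc: "f \<circ> h \<noteq> h \<circ> f"
  then have "\<not> disjoint_supports f h" using disjoint_supports_commute f by blast
  then obtain x where x: "f x \<noteq> x" "h x \<noteq> x" by (auto simp: disjoint_supports_def)
  obtain c1 d1 where V1: "0 \<le> c1" "c1 < x" "x < d1" "d1 \<le> b"
    "\<And>s. c1 < s \<Longrightarrow> s < d1 \<Longrightarrow> f s \<noteq> s" using moves_near[OF f x(1)] by blast
  \<comment> \<open>for \<open>h\<close> only the first power of the wandering interval matters\<close>
  obtain c2 d2 where V2: "c2 < x" "x < d2"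
    "\<And>s n. c2 < s \<Longrightarrow> s < d2 \<Longrightarrow> (h ^^ Suc n) s \<notin> {c2<..<d2}"
    using wandering[OF h x(2)] by blast
  define c d where "c = max c1 c2" and "d = min d1 d2"
  have cd: "0 \<le> c" "c < d" "d \<le> b" using V1 V2 by (auto simp: c_def d_def)
  have hV: "h s \<notin> {c<..<d}" if "s \<in> {c<..<d}" for s
    using V2(3)[of s 0] that by (auto simp: c_def d_def)
  obtain f1 f2 where F: "f1 \<in> G" "f2 \<in> G" "supported f1 c d" "supported f2 c d" "commutator f1 f2 \<noteq> id"
    using noncommuting_pair cd by blast
  have gV: "g s = s" if "s \<in> {c<..<d}" for s
    using fg V1(5)[of s] that by (auto simp: disjoint_supports_def c_def d_def)
  have dj: "disjoint_supports k g" if "supported k c d" for k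
    using that gV by (auto simp: disjoint_supports_def supported_def)
  have "commutator f1 (commutator f2 h) = commutator f1 f2"
  proof
    fix t
    define m where "m = commutator f2 h"
    have mG: "m \<in> G" using F h commutator_mem m_def by auto
    have F': "supported (fun_inv f2) c d" "supported (fun_inv f1) c d" using F supported_inv by auto
    have hi: "fun_inv h s \<notin> {c<..<d}" if "s \<in> {c<..<d}" for s
      using hV[of "fun_inv h s"] that h by auto
    have mV: "m s = f2 s" if "s \<in> {c<..<d}" for s
    proof -
      have "fun_inv f2 (fun_inv h s) = fun_inv h s" using hi[OF that] F' by (auto simp: supported_def)
      then show ?thesis using h by (simp add: m_def commutator_def)
    qed
    have miV: "fun_inv m s = fun_inv f2 s" if "s \<in> {c<..<d}" for s
    proof -
      have "fun_inv f2 s \<in> {c<..<d}" 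
        using supported_maps[of "fun_inv f2"] F' inv_mem F that by blast
      then have "m (fun_inv f2 s) = s" using mV F by simp
      then show ?thesis using mG by (metis inv_apply)
    qed
    show "commutator f1 (commutator f2 h) t = commutator f1 f2 t"
    proof (cases "t \<in> {c<..<d}")
      case True
      have a: "fun_inv f2 t \<in> {c<..<d}"
        using supported_maps[of "fun_inv f2"] F' inv_mem F True by blast
      have b: "fun_inv f1 (fun_inv f2 t) \<in> {c<..<d}"
        using supported_maps[of "fun_inv f1"] F' inv_mem F a by blast
      show ?thesis unfolding m_def[symmetric]
        using miV[OF True] mV[OF b] by (simp add: commutator_def)
    next
      case False
      have "fun_inv m t \<notin> {c<..<d}"
      proof
        assume a: "fun_inv m t \<in> {c<..<d}"
        then have "m (fun_inv m t) = f2 (fun_inv m t)" by (rule mV)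
        then have "t = f2 (fun_inv m t)" using mG by simp
        then have "t \<in> {c<..<d}" using a supported_maps[OF F(2) F(4)] by metis
        then show False using False by simp
      qed
      then have "fun_inv f1 (fun_inv m t) = fun_inv m t" using F' by (auto simp: supported_def)
      then have "commutator f1 m t = f1 t" using mG by (simp add: commutator_def)
      moreover have "f1 t = t" "fun_inv f2 t = t" "fun_inv f1 t = t" "f2 t = t" 
        using False F F' by (auto simp: supported_def)
      ultimately show ?thesis unfolding m_def[symmetric] by (simp add: commutator_def)
    qed
  qed
  moreover have "disjoint_supports (commutator f1 f2) g"
  proof (rule dj)
    have "supported (fun_inv f2) c d" "supported (fun_inv f1) c d" using F supported_inv by auto
    then show "supported (commutator f1 f2) c d" using F by (auto simp: supported_def commutator_def)
  qed
  ultimately show "\<exists>f1\<in>G. \<exists>f2\<in>G. f1 \<circ> g = g \<circ> f1 \<and> f2 \<circ> g = g \<circ> f2 \<and>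
        commutator f1 (commutator f2 h) \<noteq> id \<and> commutator f1 (commutator f2 h) \<circ> g = g \<circ> commutator f1 (commutator f2 h)"
    using F dj disjoint_supports_commute g commutator_mem by metis
qed

lemma commuting_funpow:
  fixes u g :: "real \<Rightarrow> real"
  assumes "u \<circ> g = g \<circ> u" shows "u ((g ^^ n) t) = (g ^^ n) (u t)"
proof (induction n)
  case (Suc n)
  have "u (g s) = g (u s)" for s using assms by (metis comp_apply)
  then show ?case using Suc by simp
qed auto

text \<open>If \<open>f\<close> and \<open>g\<close> both move a point, let \<open>V\<close> be an interval around it that is wandering for
  both and let \<open>h\<close> be supported in \<open>V\<close>. The double commutator supplied by the criterion is supported
  in the four translates of \<open>V\<close> by \<open>id\<close>, \<open>f1\<close>, \<open>f2\<close> and \<open>f1 \<circ> f2\<close>. It commutes with \<open>g\<close>, so its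
  support contains with a point the whole \<open>g\<close>-orbit; but as the translating maps commute with \<open>g\<close>,
  each translate contains at most one point of the orbit.\<close>

lemma algebraically_disjoint_imp_disjoint:
  assumes f: "f \<in> G" and g: "g \<in> G" and fg: "algebraically_disjoint f g"
  shows "disjoint_supports f g"
proof (rule ccontr)
  assume "\<not> disjoint_supports f g"
  then obtain x where x: "f x \<noteq> x" "g x \<noteq> x" by (auto simp: disjoint_supports_def)
  have x0: "0 < x" "x < b" using moves_inside f x by auto
  obtain c1 d1 where V1: "c1 < x" "x < d1"
    "\<And>s n. c1 < s \<Longrightarrow> s < d1 \<Longrightarrow> (f ^^ Suc n) s \<notin> {c1<..<d1}"
    using wandering[OF f x(1)] by blast
  obtain c2 d2 where V2: "c2 < x" "x < d2"
    "\<And>s n. c2 < s \<Longrightarrow> s < d2 \<Longrightarrow> (g ^^ Suc n) s \<notin> {c2<..<d2}"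
    using wandering[OF g x(2)] by blast
  define c d where "c = max 0 (max c1 c2)" and "d = min b (min d1 d2)"
  have cd: "0 \<le> c" "c < x" "x < d" "d \<le> b" using V1 V2 x0 by (auto simp: c_def d_def)
  have fV: "f s \<notin> {c<..<d}" if "s \<in> {c<..<d}" for s
    using V1(3)[of s 0] that by (auto simp: c_def d_def)
  have gV: "(g ^^ Suc n) s \<notin> {c<..<d}" if "s \<in> {c<..<d}" for s n
    using V2(3)[of s n] that unfolding c_def d_def by force
  obtain h where h: "h \<in> G" "supported h c d" "x < h x" using moving_up cd by blast
  have "f (h x) \<noteq> h (f x)"
  proof -
    have "h (f x) = f x" using fV[of x] cd h(2) unfolding supported_def by auto
    then show ?thesis using f h by simp
  qed
  then have "f \<circ> h \<noteq> h \<circ> f" by (metis comp_apply)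
  then obtain f1 f2 where F: "f1 \<in> G" "f2 \<in> G" "f1 \<circ> g = g \<circ> f1" "f2 \<circ> g = g \<circ> f2"
    "commutator f1 (commutator f2 h) \<noteq> id" "commutator f1 (commutator f2 h) \<circ> g = g \<circ> commutator f1 (commutator f2 h)"
    using fg h unfolding algebraically_disjoint_def by blast
  define m where "m = commutator f2 h"
  define k where "k = commutator f1 m"
  have mG: "m \<in> G" "k \<in> G" using F h commutator_mem m_def k_def by auto
  have m_supp: "s \<in> {c<..<d} \<or> fun_inv f2 s \<in> {c<..<d}" if "m s \<noteq> s" for s
  proof (rule ccontr)
    assume "\<not> ?thesis"
    moreover from this have "fun_inv h s = s" 
      using supported_inv[OF h(1,2)] by (auto simp: supported_def)
    ultimately have "m s = s" using h(2) F by (auto simp: m_def commutator_def supported_def)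
    then show False using that by simp
  qed
  have k_supp: "m s \<noteq> s \<or> m (fun_inv f1 s) \<noteq> fun_inv f1 s" if "k s \<noteq> s" for s
  proof (rule ccontr)
    assume "\<not> ?thesis"
    then have "k s = s" using mG F by (simp add: k_def commutator_def)
    then show False using that by simp
  qed
  \<comment> \<open>the support of \<open>k\<close> is covered by the preimages of the interval under these four maps\<close>
  define Us where "Us = {id, fun_inv f2, fun_inv f1, fun_inv f2 \<circ> fun_inv f1}"
  have cover: "\<exists>u\<in>Us. u s \<in> {c<..<d}" if "k s \<noteq> s" for s
    using k_supp[OF that] m_supp unfolding Us_def by auto
  have inv_comm: "fun_inv u \<circ> g = g \<circ> fun_inv u" if "u \<in> G" "u \<circ> g = g \<circ> u" for u
  proof
    fix t
    have "u (g (fun_inv u t)) = g t" using that by (metis comp_apply apply_inv)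
    then show "(fun_inv u \<circ> g) t = (g \<circ> fun_inv u) t" using that by (metis comp_apply inv_apply)
  qed
  have Us_comm: "u \<circ> g = g \<circ> u" if "u \<in> Us" for u
  proof -
    have "fun_inv f2 \<circ> fun_inv f1 \<circ> g = g \<circ> (fun_inv f2 \<circ> fun_inv f1)"
      using inv_comm[of f1] inv_comm[of f2] F by (metis comp_assoc)
    then show ?thesis using that inv_comm[of f1] inv_comm[of f2] F unfolding Us_def by auto
  qed
  have "k \<noteq> id" "k \<circ> g = g \<circ> k" using F unfolding k_def m_def by auto
  then obtain y where y: "k y \<noteq> y" by (auto simp: fun_eq_iff)
  have "k ((g ^^ n) y) \<noteq> (g ^^ n) y" for n
  proof -
    have "inj (g ^^ n)" using g bij bij_is_inj by (metis inj_fn)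
    then show ?thesis using commuting_funpow[OF \<open>k \<circ> g = g \<circ> k\<close>, of n y] y by (simp add: inj_eq)
  qed
  then have un: "(UNIV :: nat set) \<subseteq> (\<Union>u\<in>Us. {n. u ((g ^^ n) y) \<in> {c<..<d}})"
    using cover by blast
  have "finite {n. u ((g ^^ n) y) \<in> {c<..<d}}" if "u \<in> Us" for u
  proof -
    have "i = j" if "u ((g ^^ i) y) \<in> {c<..<d}" "u ((g ^^ j) y) \<in> {c<..<d}" "i \<le> j" for i j
    proof (rule ccontr)
      assume "i \<noteq> j"
      then obtain n where n: "j = Suc n + i" using \<open>i \<le> j\<close> by (metis add.commute add_Suc_right le_neq_implies_less less_imp_Suc_add)
      have "u ((g ^^ j) y) = (g ^^ Suc n) ((g ^^ i) (u y))"
        unfolding commuting_funpow[OF Us_comm[OF \<open>u \<in> Us\<close>]] n by (simp add: funpow_add)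
      then show False using gV that commuting_funpow[OF Us_comm[OF \<open>u \<in> Us\<close>]] by metis
    qed
    then have "i = j" if "u ((g ^^ i) y) \<in> {c<..<d}" "u ((g ^^ j) y) \<in> {c<..<d}" for i j
      using that nat_le_linear by metis
    then have "{n. u ((g ^^ n) y) \<in> {c<..<d}} \<subseteq> {SOME n. u ((g ^^ n) y) \<in> {c<..<d}}"
      by (metis (mono_tags, lifting) mem_Collect_eq singleton_iff someI_ex subsetI)
    then show ?thesis using finite_subset by blast
  qed
  moreover have "finite Us" by (simp add: Us_def)
  ultimately have "finite (\<Union>u\<in>Us. {n. u ((g ^^ n) y) \<in> {c<..<d}})"
    by (intro finite_UN_I)
  then have "finite (UNIV :: nat set)"
    using un finite_subset by blast
  then show False by simp
qed

lemma algebraically_disjoint_iff: "f \<in> G \<Longrightarrow> g \<in> G \<Longrightarrow> algebraically_disjoint f g \<longleftrightarrow> disjoint_supports f g"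
  using algebraically_disjoint_imp_disjoint disjoint_imp_algebraically_disjoint by blast

section \<open>Points as pairs of complementary subgroups\<close>

definition rigid :: "real \<Rightarrow> real \<Rightarrow> (real \<Rightarrow> real) set" where
  "rigid c d = {f \<in> G. supported f c d}"

definition perp :: "(real \<Rightarrow> real) set \<Rightarrow> (real \<Rightarrow> real) set" where
  "perp S = {f \<in> G. \<forall>g\<in>S. disjoint_supports f g}"

text \<open>Topological transitivity on the union of the supports, expressed by the group operations and
  disjointness of supports.\<close>

definition mixing :: "(real \<Rightarrow> real) set \<Rightarrow> bool" where
  "mixing S \<longleftrightarrow> (\<forall>u\<in>S. \<forall>v\<in>S. u \<noteq> id \<longrightarrow> v \<noteq> id \<longrightarrow> (\<exists>g\<in>S. \<not> disjoint_supports (g \<circ> u \<circ> fun_inv g) v))"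

text \<open>A pair of this kind is the algebraic trace of a point \<open>x\<close> of the open interval: the elements
  living to the left of \<open>x\<close> and those living to the right of it. Mixing makes the two regions connected
  and mutual complementarity makes them fill the interval.\<close>

definition cut_pair :: "(real \<Rightarrow> real) set \<Rightarrow> (real \<Rightarrow> real) set \<Rightarrow> bool" where
  "cut_pair L R \<longleftrightarrow> L = perp R \<and> R = perp L \<and> L \<noteq> {id} \<and> R \<noteq> {id} \<and> mixing L \<and> mixing R"

lemma cut_pair_sym: "cut_pair L R \<Longrightarrow> cut_pair R L"
  unfolding cut_pair_def by blast

lemma id_perp: "id \<in> perp S"
  by (auto simp: perp_def disjoint_supports_def id_mem)

lemma rigid_subset:
  assumes "0 \<le> c" "c < d" "d \<le> b" "rigid c d \<subseteq> rigid c' d'"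
  shows "c' \<le> c \<and> d \<le> d'"
proof -
  have *: "c' < s \<and> s < d'" if s: "c < s" "s < d" for s
  proof -
    obtain g where "g \<in> G" "supported g c d" "s < g s"
      using moving_up assms(1,3) s by blast
    then show ?thesis using assms(4) unfolding rigid_def supported_def by fastforce
  qed
  have "c' \<le> c" using dense_ge_bounded[of c d c'] * assms(2) less_imp_le by blast
  moreover have "d \<le> d'" using dense_le_bounded[of c d d'] * assms(2) less_imp_le by blast
  ultimately show ?thesis by blast
qed

lemma rigid_mono: "c' \<le> c \<Longrightarrow> d \<le> d' \<Longrightarrow> rigid c d \<subseteq> rigid c' d'"
  by (auto simp: rigid_def supported_def)

lemma rigid_nontrivial: 
  assumes "0 \<le> c" "c < d" "d \<le> b" shows "rigid c d \<noteq> {id}"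
proof -
  obtain s where s: "c < s" "s < d" using dense assms by blast
  then obtain g where "g \<in> G" "supported g c d" "s < g s"
    using moving_up assms by blast
  then have "g \<in> rigid c d" "g \<noteq> id" by (auto simp: rigid_def)
  then show ?thesis by auto
qed

lemma mixing_rigid:
  assumes "0 \<le> c" "c < d" "d \<le> b" shows "mixing (rigid c d)"
  unfolding mixing_def
proof (intro ballI impI)
  fix u v assume uv: "u \<in> rigid c d" "v \<in> rigid c d" "u \<noteq> id" "v \<noteq> id"
  then have G: "u \<in> G" "v \<in> G" "supported u c d" "supported v c d" by (auto simp: rigid_def)
  obtain x y where x: "u x \<noteq> x" and y: "v y \<noteq> y" using uv by (auto simp: fun_eq_iff)
  have xy: "x \<in> {c<..<d}" "y \<in> {c<..<d}" using x y G by (auto simp: supported_def)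
  obtain c1 d1 where "0 \<le> c1" and V: "c1 < x" "x < d1" and "d1 \<le> b"
    and V': "\<And>s. c1 < s \<Longrightarrow> s < d1 \<Longrightarrow> u s \<noteq> s"
    by (rule moves_near[OF G(1) x]) (rule that)
  obtain c2 d2 where "0 \<le> c2" and W: "c2 < y" "y < d2" and "d2 \<le> b"
    and W': "\<And>s. c2 < s \<Longrightarrow> s < d2 \<Longrightarrow> v s \<noteq> s"
    by (rule moves_near[OF G(2) y]) (rule that)
  obtain g t where g: "g \<in> G" "supported g c d" "c1 < t" "t < d1" "c2 < g t" "g t < d2"
    by (rule approximately_transitive[OF assms(1,3) xy V W]) (rule that)
  have "(g \<circ> u \<circ> fun_inv g) (g t) \<noteq> g t" using V'[of t] g by simp
  then have "\<not> disjoint_supports (g \<circ> u \<circ> fun_inv g) v" using W'[of "g t"] g unfolding disjoint_supports_def by blast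
  then show "\<exists>g\<in>rigid c d. \<not> disjoint_supports (g \<circ> u \<circ> fun_inv g) v" using g by (auto simp: rigid_def)
qed

lemma perp_rigid_fixes:
  assumes "0 \<le> c" "d \<le> b" "f \<in> perp (rigid c d)" "c \<le> t" "t \<le> d" "c < d"
  shows "f t = t"
proof (rule ccontr)
  assume "f t \<noteq> t"
  moreover have f: "f \<in> G" using assms by (auto simp: perp_def)
  ultimately obtain c1 d1 where "0 \<le> c1" and V: "c1 < t" "t < d1" and "d1 \<le> b"
    and V': "\<And>s. c1 < s \<Longrightarrow> s < d1 \<Longrightarrow> f s \<noteq> s"
    by - (rule moves_near[of f t], assumption+, rule that)
  have "max c c1 < min d d1" using V assms by auto
  then obtain s where s: "max c c1 < s" "s < min d d1" using dense by blast
  then obtain g where "g \<in> G" "supported g c d" "s < g s"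
    using moving_up[of c s d] assms by auto
  then have "f s = s" using assms(3) unfolding perp_def rigid_def disjoint_supports_def by fastforce
  then show False using V'[of s] s by auto
qed

lemma cut_pair_rigid:
  assumes "0 < x" "x < b"
  shows "cut_pair (rigid 0 x) (rigid x b)"
proof -
  have "disjoint_supports f g" if "f \<in> rigid 0 x" "g \<in> rigid x b" for f g
  proof -
    have "f t = t \<or> g t = t" for t
      using that unfolding rigid_def supported_def by (cases "t < x") auto
    then show ?thesis by (simp add: disjoint_supports_def)
  qed
  then have "rigid 0 x \<subseteq> perp (rigid x b)" "rigid x b \<subseteq> perp (rigid 0 x)"
    unfolding perp_def by (auto simp: rigid_def disjoint_supports_def)
  moreover have "perp (rigid x b) \<subseteq> rigid 0 x"
  proof
    fix f assume f: "f \<in> perp (rigid x b)"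
    then have fG: "f \<in> G" by (simp add: perp_def)
    have "f t = t" if "t \<notin> {0<..<x}" for t
    proof (cases "x \<le> t \<and> t \<le> b")
      case True then show ?thesis using perp_rigid_fixes[of x b f t] f assms by auto
    next
      case False then show ?thesis using that fixes_outside[OF fG] by auto
    qed
    then show "f \<in> rigid 0 x" using fG by (auto simp: rigid_def supported_def)
  qed
  moreover have "perp (rigid 0 x) \<subseteq> rigid x b"
  proof
    fix f assume f: "f \<in> perp (rigid 0 x)"
    then have fG: "f \<in> G" by (simp add: perp_def)
    have "f t = t" if "t \<notin> {x<..<b}" for t
    proof (cases "0 \<le> t \<and> t \<le> x")
      case True then show ?thesis using perp_rigid_fixes[of 0 x f t] f assms by auto
    next
      case False then show ?thesis using that fixes_outside[OF fG] by auto
    qed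
    then show "f \<in> rigid x b" using fG by (auto simp: rigid_def supported_def)
  qed
  ultimately have "rigid 0 x = perp (rigid x b)" "rigid x b = perp (rigid 0 x)" by blast+
  then show ?thesis
    unfolding cut_pair_def
    using rigid_nontrivial[of 0 x] rigid_nontrivial[of x b] mixing_rigid[of 0 x] mixing_rigid[of x b] assms
    by (metis less_eq_real_def)
qed

text \<open>If all of \<open>L\<close> fixed a point \<open>z\<close> between two points that \<open>L\<close> moves, then no element of \<open>L\<close>
  could carry a support from the left of \<open>z\<close> across \<open>z\<close>; but \<open>L\<close>, being the full set of elements with
  support disjoint from \<open>R\<close>, contains non-trivial elements on both sides.\<close>

lemma mixing_connected:
  assumes "cut_pair L R" and f: "f \<in> L" "f s \<noteq> s" and h: "h \<in> L" "h t \<noteq> t" and z: "s < z" "z < t"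
  shows "\<exists>k\<in>L. k z \<noteq> z"
proof (rule ccontr)
  assume "\<not> ?thesis"
  then have fix_z: "k z = z" if "k \<in> L" for k using that by blast
  have L: "L = perp R" "R = perp L" "mixing L" using assms(1) unfolding cut_pair_def by blast+
  have LG: "L \<subseteq> G" by (subst L(1)) (auto simp: perp_def)
  \<comment> \<open>\<open>L\<close> contains everything that lives where a single element of \<open>L\<close> moves all points\<close>
  have in_L: "u \<in> L" if "u \<in> G" "supported u c d" "k \<in> L" "\<And>s. c < s \<Longrightarrow> s < d \<Longrightarrow> k s \<noteq> s" for u c d k
  proof -
    have "disjoint_supports u g" if "g \<in> R" for g
      unfolding disjoint_supports_def
    proof
      fix y
      have "disjoint_supports g k" using \<open>g \<in> R\<close> \<open>k \<in> L\<close> by (subst (asm) L(2)) (simp add: perp_def)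
      then have "g y = y" if "y \<in> {c<..<d}" 
        using that \<open>\<And>s. c < s \<Longrightarrow> s < d \<Longrightarrow> k s \<noteq> s\<close> unfolding disjoint_supports_def by auto
      then show "u y = y \<or> g y = y" using \<open>supported u c d\<close> unfolding supported_def by blast
    qed
    then show ?thesis using \<open>u \<in> G\<close> by (subst L(1)) (simp add: perp_def)
  qed
  obtain c1 d1 where V: "0 \<le> c1" "c1 < s" "s < d1" "d1 \<le> b" "\<And>s. c1 < s \<Longrightarrow> s < d1 \<Longrightarrow> f s \<noteq> s"
    by (rule moves_near[OF subsetD[OF LG f(1)] f(2)]) (rule that)
  obtain c2 d2 where W: "0 \<le> c2" "c2 < t" "t < d2" "d2 \<le> b" "\<And>s. c2 < s \<Longrightarrow> s < d2 \<Longrightarrow> h s \<noteq> s"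
    by (rule moves_near[OF subsetD[OF LG h(1)] h(2)]) (rule that)
  have d1z: "d1 \<le> z" using V(5)[of z] V z fix_z[OF f(1)] by force
  have c2z: "z \<le> c2" using W(5)[of z] W z fix_z[OF h(1)] by force
  obtain u where u: "u \<in> G" "supported u c1 d1" "s < u s" by (rule moving_up[OF V(1-4)]) (rule that)
  obtain v where v: "v \<in> G" "supported v c2 d2" "t < v t" by (rule moving_up[OF W(1-4)]) (rule that)
  have "u \<in> L" using in_L[OF u(1,2) f(1) V(5)] .
  moreover have "v \<in> L" using in_L[OF v(1,2) h(1) W(5)] .
  moreover have "u \<noteq> id" "v \<noteq> id" using u v by auto
  ultimately obtain g where g: "g \<in> L" "\<not> disjoint_supports (g \<circ> u \<circ> fun_inv g) v"
    using L(3) unfolding mixing_def by blast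
  then obtain y where y: "g (u (fun_inv g y)) \<noteq> y" "v y \<noteq> y" by (auto simp: disjoint_supports_def)
  have gG: "g \<in> G" using g LG by blast
  have "u (fun_inv g y) \<noteq> fun_inv g y" using y gG by auto
  then have "fun_inv g y \<in> {c1<..<d1}" using u(2) unfolding supported_def by blast
  then have "fun_inv g y < z" using d1z by simp
  then have "y < z" using gG fix_z[OF g(1)] by (simp add: inv_less_iff)
  moreover have "y \<in> {c2<..<d2}" using y(2) v(2) unfolding supported_def by blast
  ultimately show False using c2z by simp
qed

text \<open>The regions moved by \<open>L\<close> and by \<open>R\<close> are disjoint and convex, so one of them lies to the
  left of the other; the supremum of the left one is the cutting point.\<close>

lemma cut_pair_ordered:
  assumes LR: "cut_pair L R" and f: "f \<in> L" "f s \<noteq> s" and h: "h \<in> R" "h t \<noteq> t" and st: "s < t"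
  shows "\<exists>x. 0 < x \<and> x < b \<and> L = rigid 0 x \<and> R = rigid x b"
proof -
  have L: "L = perp R" "R = perp L" using LR unfolding cut_pair_def by blast+
  have "perp R \<subseteq> G" "perp L \<subseteq> G" by (auto simp: perp_def)
  then have LG: "L \<subseteq> G" "R \<subseteq> G" using L by metis+
  define U where "U = {t. \<exists>f\<in>L. f t \<noteq> t}"
  define W where "W = {t. \<exists>f\<in>R. f t \<noteq> t}"
  have U: "s \<in> U" and W: "t \<in> W" using f h by (auto simp: U_def W_def)
  have Uconv: "z \<in> U" if "x \<in> U" "y \<in> U" "x < z" "z < y" for x y z
    using mixing_connected[OF LR] that unfolding U_def by blast
  have Wconv: "z \<in> W" if "x \<in> W" "y \<in> W" "x < z" "z < y" for x y z
    using mixing_connected[OF cut_pair_sym[OF LR]] that unfolding W_def by blast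
  have disjUW: "x \<notin> W" if xU: "x \<in> U" for x
  proof
    assume "x \<in> W"
    then obtain k h where kh: "k \<in> L" "k x \<noteq> x" "h \<in> R" "h x \<noteq> x"
      using xU unfolding U_def W_def by blast
    have "h \<in> perp L" using kh(3) L(2) by metis
    then have "disjoint_supports h k" using kh(1) by (simp add: perp_def)
    then show False using kh by (auto simp: disjoint_supports_def)
  qed
  have lt: "x < y" if "x \<in> U" "y \<in> W" for x y
  proof -
    have "x < t"
    proof (rule ccontr)
      assume "\<not> x < t"
      moreover have "x \<noteq> t" using disjUW W that by blast
      ultimately have "t \<in> U" using Uconv[OF U that(1), of t] st by auto
      then show False using disjUW W by blast
    qed
    show ?thesis
    proof (rule ccontr)
      assume "\<not> x < y"
      moreover have "x \<noteq> y" using disjUW that by blast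
      ultimately have "x \<in> W" using Wconv[OF that(2) W, of x] \<open>x < t\<close> by auto
      then show False using disjUW that by blast
    qed
  qed
  define x where "x = Sup U"
  have bdd: "bdd_above U" using lt[OF _ W] by (auto intro!: bdd_aboveI less_imp_le)
  have Ux: "y \<le> x" if "y \<in> U" for y unfolding x_def using bdd that by (rule cSup_upper[rotated])
  have Wx: "x \<le> y" if "y \<in> W" for y 
    unfolding x_def using lt that U by (intro cSup_least) (auto intro: less_imp_le)
  have s0: "0 < s" "s \<le> x" using moves_inside[of f s] f LG Ux U by auto
  have t0: "x \<le> t" "t < b" using moves_inside[of h t] h LG Wx W by auto
  have Lx: "L \<subseteq> rigid 0 x"
  proof
    fix g assume g: "g \<in> L"
    have "g y = y" if "x \<le> y" for y
    proof (rule ccontr)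
      assume "g y \<noteq> y"
      then obtain d where "y < d" "\<And>s. y \<le> s \<Longrightarrow> s < d \<Longrightarrow> g s \<noteq> s"
        using moves_near[of g y] g LG by (metis order_less_le_trans subsetD)
      moreover from this obtain r where "y < r" "r < d" using dense by blast
      ultimately have "g r \<noteq> r" by simp
      then have "r \<in> U" using g unfolding U_def by blast
      then show False using Ux[of r] \<open>y < r\<close> that by auto
    qed
    moreover have "g \<in> G" using g LG by auto
    ultimately show "g \<in> rigid 0 x" using fixes_outside[of g] by (fastforce simp: rigid_def supported_def)
  qed
  have Rx: "R \<subseteq> rigid x b"
  proof
    fix g assume g: "g \<in> R"
    have "g y = y" if "y \<le> x" for y
    proof (rule ccontr)
      assume "g y \<noteq> y"
      then obtain c where "c < y" "\<And>s. c < s \<Longrightarrow> s \<le> y \<Longrightarrow> g s \<noteq> s"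
        using moves_near[of g y] g LG by (metis order_le_less_trans subsetD)
      moreover from this obtain r where "c < r" "r < y" using dense by blast
      ultimately have "g r \<noteq> r" by simp
      then have "r \<in> W" using g unfolding W_def by blast
      then show False using Wx[of r] \<open>r < y\<close> that by auto
    qed
    moreover have "g \<in> G" using g LG by auto
    ultimately show "g \<in> rigid x b" using fixes_outside[of g] by (fastforce simp: rigid_def supported_def)
  qed
  have x: "0 < x" "x < b" using s0 t0 by auto
  then have parts: "rigid 0 x = perp (rigid x b)" "rigid x b = perp (rigid 0 x)"
    using cut_pair_rigid[of x] unfolding cut_pair_def by blast+
  have "perp (rigid x b) \<subseteq> perp R" "perp (rigid 0 x) \<subseteq> perp L"
    using Lx Rx by (auto simp: perp_def)
  then have "perp (rigid x b) \<subseteq> L" "perp (rigid 0 x) \<subseteq> R" by (simp_all only: L[symmetric])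
  then have "rigid 0 x \<subseteq> L" "rigid x b \<subseteq> R" by (simp_all only: parts[symmetric])
  then show ?thesis using Lx Rx x by blast
qed

lemma cut_pairE:
  assumes "cut_pair L R"
  obtains x where "0 < x" "x < b" "L = rigid 0 x" "R = rigid x b"
        | x where "0 < x" "x < b" "L = rigid x b" "R = rigid 0 x"
proof -
  have ne: "L \<noteq> {id}" "R \<noteq> {id}" and L: "L = perp R" "R = perp L"
    using assms unfolding cut_pair_def by blast+
  have "id \<in> L" "id \<in> R" using id_perp L by metis+
  then have "\<exists>f\<in>L. f \<noteq> id" "\<exists>h\<in>R. h \<noteq> id" using ne by blast+
  then obtain f h where fh: "f \<in> L" "f \<noteq> id" "h \<in> R" "h \<noteq> id" by blast
  then obtain s t where st: "f s \<noteq> s" "h t \<noteq> t" by (auto simp: fun_eq_iff)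
  have "f \<in> perp R" using fh(1) L(1) by metis
  then have "disjoint_supports f h" using fh by (simp add: perp_def)
  then have "s \<noteq> t" using st by (auto simp: disjoint_supports_def)
  then consider "s < t" | "t < s" by linarith
  then show ?thesis
  proof cases
    case 1
    then show ?thesis using cut_pair_ordered[OF assms fh(1) st(1) fh(3) st(2)] that by blast
  next
    case 2
    then show ?thesis using cut_pair_ordered[OF cut_pair_sym[OF assms] fh(3) st(2) fh(1) st(1)] that by blast
  qed
qed

section \<open>Automorphisms are induced by monotone bijections\<close>

lemma autD:
  assumes "\<alpha> \<in> aut G"
  shows "bij_betw \<alpha> G G" "\<And>g h. g \<in> G \<Longrightarrow> h \<in> G \<Longrightarrow> \<alpha> (g \<circ> h) = \<alpha> g \<circ> \<alpha> h"
    "\<And>g. g \<in> G \<Longrightarrow> \<alpha> g \<in> G" "\<And>g h. g \<in> G \<Longrightarrow> h \<in> G \<Longrightarrow> \<alpha> g = \<alpha> h \<longleftrightarrow> g = h"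
    "\<alpha> ` G = G"
  using assms unfolding iso_def hom_def comp_group_def bij_betw_def inj_on_def by auto

lemma aut_id: "\<alpha> \<in> aut G \<Longrightarrow> \<alpha> id = id"
proof -
  assume a: "\<alpha> \<in> aut G"
  have m: "\<alpha> id \<in> G" using a autD id_mem by blast
  have "\<alpha> id \<circ> \<alpha> id = \<alpha> id" using autD(2)[OF a id_mem id_mem] by simp
  then have "\<alpha> id (\<alpha> id t) = \<alpha> id t" for t by (metis comp_apply)
  then show ?thesis using m by (auto simp: fun_eq_iff)
qed

lemma aut_inv:
  assumes a: "\<alpha> \<in> aut G" and g: "g \<in> G" shows "\<alpha> (fun_inv g) = fun_inv (\<alpha> g)"
proof -
  have m: "\<alpha> g \<in> G" using a autD g by blast
  have "\<alpha> g \<circ> \<alpha> (fun_inv g) = id"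
    using autD(2)[OF a g inv_mem[OF g]] inv_comp[OF g] aut_id[OF a] by simp
  then have "\<alpha> g (\<alpha> (fun_inv g) t) = t" for t by (metis comp_apply id_apply)
  then show ?thesis using inv_eq_iff[OF m] by (metis ext)
qed

lemma aut_commutator: "\<alpha> \<in> aut G \<Longrightarrow> f \<in> G \<Longrightarrow> g \<in> G \<Longrightarrow> \<alpha> (commutator f g) = commutator (\<alpha> f) (\<alpha> g)"
  unfolding commutator_def by (metis autD(2) aut_inv comp_mem inv_mem)

lemma inv_aut: assumes a: "\<alpha> \<in> aut G" shows "inv_into G \<alpha> \<in> aut G"
proof -
  note b = autD[OF a]
  have "bij_betw (inv_into G \<alpha>) G G" using b(1) by (rule bij_betw_inv_into)
  moreover have m: "inv_into G \<alpha> g \<in> G" if "g \<in> G" for g 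
    using that b(5) by (metis inv_into_into)
  moreover have i: "\<alpha> (inv_into G \<alpha> g) = g" if "g \<in> G" for g
    using that b(5) by (metis f_inv_into_f)
  moreover have "inv_into G \<alpha> (g \<circ> h) = inv_into G \<alpha> g \<circ> inv_into G \<alpha> h" if "g \<in> G" "h \<in> G" for g h
  proof -
    have "\<alpha> (inv_into G \<alpha> g \<circ> inv_into G \<alpha> h) = g \<circ> h"
      using b(2)[OF m[OF that(1)] m[OF that(2)]] i that by simp
    moreover have "inv_into G \<alpha> (\<alpha> k) = k" if "k \<in> G" for k
      using b(1) that by (simp add: bij_betw_def)
    ultimately show ?thesis using comp_mem[OF m[OF that(1)] m[OF that(2)]] by metis
  qed
  ultimately show ?thesis unfolding iso_def hom_def comp_group_def by auto
qed

lemma aut_algebraically_disjoint: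
  assumes a: "\<alpha> \<in> aut G" and fg: "f \<in> G" "g \<in> G" "algebraically_disjoint f g"
  shows "algebraically_disjoint (\<alpha> f) (\<alpha> g)"
  unfolding algebraically_disjoint_def
proof (intro ballI impI)
  note b = autD[OF a]
  have comm_iff: "\<alpha> p \<circ> \<alpha> q = \<alpha> q \<circ> \<alpha> p \<longleftrightarrow> p \<circ> q = q \<circ> p" if "p \<in> G" "q \<in> G" for p q
    using b(2,4) that comp_mem by metis
  fix h' assume h': "h' \<in> G" "\<alpha> f \<circ> h' \<noteq> h' \<circ> \<alpha> f"
  then obtain h where h: "h \<in> G" "h' = \<alpha> h" using b(5) by blast
  then have "f \<circ> h \<noteq> h \<circ> f" using h' fg comm_iff by blast
  then obtain f1 f2 where F: "f1 \<in> G" "f2 \<in> G" "f1 \<circ> g = g \<circ> f1" "f2 \<circ> g = g \<circ> f2"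
    "commutator f1 (commutator f2 h) \<noteq> id" "commutator f1 (commutator f2 h) \<circ> g = g \<circ> commutator f1 (commutator f2 h)"
    using fg h unfolding algebraically_disjoint_def by blast
  have c: "commutator (\<alpha> f1) (commutator (\<alpha> f2) h') = \<alpha> (commutator f1 (commutator f2 h))"
    using F h aut_commutator[OF a] commutator_mem by simp
  have "commutator f1 (commutator f2 h) \<in> G" using F h commutator_mem by blast
  then have "\<alpha> (commutator f1 (commutator f2 h)) \<noteq> id" "\<alpha> (commutator f1 (commutator f2 h)) \<circ> \<alpha> g = \<alpha> g \<circ> \<alpha> (commutator f1 (commutator f2 h))"
    using F fg comm_iff b(4) id_mem aut_id[OF a] by metis+
  then show "\<exists>f1\<in>G. \<exists>f2\<in>G. f1 \<circ> \<alpha> g = \<alpha> g \<circ> f1 \<and> f2 \<circ> \<alpha> g = \<alpha> g \<circ> f2 \<and>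
      commutator f1 (commutator f2 h') \<noteq> id \<and> commutator f1 (commutator f2 h') \<circ> \<alpha> g = \<alpha> g \<circ> commutator f1 (commutator f2 h')"
    using F b(3) comm_iff fg c by metis
qed

lemma aut_disjoint_supports:
  assumes a: "\<alpha> \<in> aut G" and fg: "f \<in> G" "g \<in> G"
  shows "disjoint_supports (\<alpha> f) (\<alpha> g) \<longleftrightarrow> disjoint_supports f g"
proof -
  have i: "inv_into G \<alpha> (\<alpha> f) = f" if "f \<in> G" for f
    using autD(1)[OF a] that by (simp add: bij_betw_def)
  show ?thesis
    using aut_algebraically_disjoint[OF a fg] aut_algebraically_disjoint[OF inv_aut[OF a], of "\<alpha> f" "\<alpha> g"] 
      i fg autD(3)[OF a] algebraically_disjoint_iff by metis
qed

lemma aut_perp: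
  assumes a: "\<alpha> \<in> aut G" and S: "S \<subseteq> G" shows "perp (\<alpha> ` S) = \<alpha> ` perp S"
proof -
  have "disjoint_supports f (\<alpha> g) \<longleftrightarrow> disjoint_supports (inv_into G \<alpha> f) g" if "f \<in> G" "g \<in> S" for f g
  proof -
    have "f = \<alpha> (inv_into G \<alpha> f)" using that(1) autD(5)[OF a] by (simp add: f_inv_into_f)
    moreover have "inv_into G \<alpha> f \<in> G" using that(1) autD(3)[OF inv_aut[OF a]] by blast
    moreover have "g \<in> G" using that(2) S by blast
    ultimately show ?thesis using aut_disjoint_supports[OF a, of "inv_into G \<alpha> f" g] by metis
  qed
  then have 1: "f \<in> perp (\<alpha> ` S) \<longleftrightarrow> inv_into G \<alpha> f \<in> perp S" if "f \<in> G" for f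
    using that autD(3)[OF inv_aut[OF a] that] by (simp add: perp_def)
  have 2: "inv_into G \<alpha> f \<in> T \<longleftrightarrow> f \<in> \<alpha> ` T" if "f \<in> G" "T \<subseteq> G" for f T
  proof
    assume "inv_into G \<alpha> f \<in> T"
    moreover have "f = \<alpha> (inv_into G \<alpha> f)" using that(1) autD(5)[OF a] by (simp add: f_inv_into_f)
    ultimately show "f \<in> \<alpha> ` T" 
      using imageI[of "inv_into G \<alpha> f" T \<alpha>] by metis
  next
    assume "f \<in> \<alpha> ` T"
    then obtain t where t: "t \<in> T" "f = \<alpha> t" by blast
    moreover have "inv_into G \<alpha> (\<alpha> t) = t" 
      using autD(1)[OF a] t that(2) by (simp add: bij_betw_def subsetD)
    ultimately show "inv_into G \<alpha> f \<in> T" by simp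
  qed
  have "perp S \<subseteq> G" by (auto simp: perp_def)
  then have "f \<in> perp (\<alpha> ` S) \<longleftrightarrow> f \<in> \<alpha> ` perp S" if "f \<in> G" for f
    using 1[OF that] 2[OF that, of "perp S"] by simp
  moreover have "perp (\<alpha> ` S) \<subseteq> G" "\<alpha> ` perp S \<subseteq> G" 
    using autD(3)[OF a] by (auto simp: perp_def)
  ultimately show ?thesis by blast
qed

lemma aut_mixing:
  assumes a: "\<alpha> \<in> aut G" and S: "S \<subseteq> G" "mixing S" shows "mixing (\<alpha> ` S)"
  unfolding mixing_def
proof (intro ballI impI)
  fix u' v' assume "u' \<in> \<alpha> ` S" "v' \<in> \<alpha> ` S" and ni: "u' \<noteq> id" "v' \<noteq> id"
  then obtain u v where uv: "u \<in> S" "v \<in> S" "u' = \<alpha> u" "v' = \<alpha> v" by blast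
  then have "u \<noteq> id" "v \<noteq> id" using ni aut_id[OF a] by auto
  then obtain g where g: "g \<in> S" "\<not> disjoint_supports (g \<circ> u \<circ> fun_inv g) v"
    using S uv unfolding mixing_def by blast
  have m: "g \<in> G" "u \<in> G" "v \<in> G" using g uv S by auto
  have "\<alpha> (g \<circ> u \<circ> fun_inv g) = \<alpha> g \<circ> u' \<circ> fun_inv (\<alpha> g)"
    using m uv(3) by (metis autD(2)[OF a] aut_inv[OF a] comp_mem inv_mem)
  moreover have "\<not> disjoint_supports (\<alpha> (g \<circ> u \<circ> fun_inv g)) v'"
    using aut_disjoint_supports[OF a, of "g \<circ> u \<circ> fun_inv g" v] g m uv comp_mem inv_mem by auto
  ultimately show "\<exists>g\<in>\<alpha> ` S. \<not> disjoint_supports (g \<circ> u' \<circ> fun_inv g) v'" using g by auto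
qed

lemma aut_cut_pair:
  assumes a: "\<alpha> \<in> aut G" and LR: "cut_pair L R" shows "cut_pair (\<alpha> ` L) (\<alpha> ` R)"
proof -
  have L: "L = perp R" "R = perp L" and ne: "L \<noteq> {id}" "R \<noteq> {id}" and m: "mixing L" "mixing R"
    using LR unfolding cut_pair_def by blast+
  have "perp R \<subseteq> G" "perp L \<subseteq> G" by (auto simp: perp_def)
  then have S: "L \<subseteq> G" "R \<subseteq> G" using L by metis+
  have "\<alpha> ` T \<noteq> {id}" if T: "T \<subseteq> G" "T \<noteq> {id}" for T
  proof
    assume *: "\<alpha> ` T = {id}"
    have "t = id" if "t \<in> T" for t
    proof -
      have "\<alpha> t = \<alpha> id" using * that aut_id[OF a] by (metis imageI singletonD)
      then show ?thesis using autD(4)[OF a, of t id] that T id_mem by blast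
    qed
    moreover have "T \<noteq> {}" using * by blast
    ultimately show False using T by blast
  qed
  then have "\<alpha> ` L \<noteq> {id}" "\<alpha> ` R \<noteq> {id}" using S ne by blast+
  moreover have "mixing (\<alpha> ` L)" "mixing (\<alpha> ` R)" using aut_mixing[OF a] S m by blast+
  moreover have "\<alpha> ` L = perp (\<alpha> ` R)" using aut_perp[OF a S(2)] L(1) by metis
  moreover have "\<alpha> ` R = perp (\<alpha> ` L)" using aut_perp[OF a S(1)] L(2) by metis
  ultimately show ?thesis unfolding cut_pair_def by blast
qed

definition conj_set :: "(real \<Rightarrow> real) \<Rightarrow> (real \<Rightarrow> real) set \<Rightarrow> (real \<Rightarrow> real) set" where
  "conj_set g S = (\<lambda>f. g \<circ> f \<circ> fun_inv g) ` S"

lemma conj_rigid_subset: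
  assumes g: "g \<in> G" shows "conj_set g (rigid c d) \<subseteq> rigid (g c) (g d)"
proof
  fix k assume "k \<in> conj_set g (rigid c d)"
  then obtain f where f: "f \<in> G" "supported f c d" "k = g \<circ> f \<circ> fun_inv g" 
    by (auto simp: conj_set_def rigid_def)
  have "k t = t" if "t \<notin> {g c<..<g d}" for t
  proof -
    have "fun_inv g t \<notin> {c<..<d}" using that g inv_less_iff less_inv_iff by auto
    then show ?thesis using f g unfolding supported_def by simp
  qed
  then show "k \<in> rigid (g c) (g d)" using f g comp_mem inv_mem by (auto simp: rigid_def supported_def)
qed

lemma conj_rigid:
  assumes g: "g \<in> G" shows "conj_set g (rigid c d) = rigid (g c) (g d)"
proof (intro subset_antisym conj_rigid_subset[OF g])
  show "rigid (g c) (g d) \<subseteq> conj_set g (rigid c d)"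
  proof
    fix k assume k: "k \<in> rigid (g c) (g d)"
    have "fun_inv (fun_inv g) = g" using g bij inv_inv_eq by blast
    then have "fun_inv g \<circ> k \<circ> g \<in> rigid c d"
      using conj_rigid_subset[OF inv_mem[OF g], of "g c" "g d"] k g by (auto simp: conj_set_def)
    moreover have "k = g \<circ> (fun_inv g \<circ> k \<circ> g) \<circ> fun_inv g" using g by (auto simp: fun_eq_iff)
    ultimately show "k \<in> conj_set g (rigid c d)" unfolding conj_set_def by blast
  qed
qed

lemma aut_conj_set:
  assumes a: "\<alpha> \<in> aut G" and "g \<in> G" "S \<subseteq> G" 
  shows "\<alpha> ` conj_set g S = conj_set (\<alpha> g) (\<alpha> ` S)"
proof -
  have "\<alpha> (g \<circ> f \<circ> fun_inv g) = \<alpha> g \<circ> \<alpha> f \<circ> fun_inv (\<alpha> g)" if "f \<in> S" for f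
    using assms(2,3) that by (metis subsetD autD(2)[OF a] aut_inv[OF a] comp_mem inv_mem)
  then show ?thesis unfolding conj_set_def image_image by auto
qed

text \<open>An automorphism permutes the pairs that correspond to points, possibly swapping left and
  right. Whether it swaps cannot depend on the point: left parts of two points are comparable
  under inclusion, while a left part is never contained in a right part. This yields a monotone bijection,
  and it conjugates as claimed since conjugation by \<open>g\<close> carries the pair of \<open>t\<close> to
  the pair of \<open>g t\<close>.\<close>

theorem automorphism_spatial:
  assumes a: "\<alpha> \<in> aut G"
  obtains \<phi> where "bij_betw \<phi> {0<..<b} {0<..<b}"
    "strict_mono_on {0<..<b} \<phi> \<or> strict_antimono_on {0<..<b} \<phi>"
    "\<And>g t. g \<in> G \<Longrightarrow> t \<in> {0<..<b} \<Longrightarrow> \<alpha> g (\<phi> t) = \<phi> (g t)"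
proof -
  let ?I = "{0<..<b}"
  define up where "up x y \<longleftrightarrow> \<alpha> ` rigid 0 x = rigid 0 y \<and> \<alpha> ` rigid x b = rigid y b" for x y
  define dn where "dn x y \<longleftrightarrow> \<alpha> ` rigid 0 x = rigid y b \<and> \<alpha> ` rigid x b = rigid 0 y" for x y
  have sub: "rigid c d \<subseteq> G" for c d by (auto simp: rigid_def)
  have image_sub: "\<alpha> ` S \<subseteq> \<alpha> ` T \<longleftrightarrow> S \<subseteq> T" if "S \<subseteq> G" "T \<subseteq> G" for S T
    using that autD(1)[OF a] inj_on_image_subset_iff[of \<alpha> G S T] by (simp add: bij_betw_def)
  have ex: "\<exists>y\<in>?I. up x y \<or> dn x y" if "x \<in> ?I" for x
  proof -
    have "cut_pair (rigid 0 x) (rigid x b)" using that cut_pair_rigid by auto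
    from aut_cut_pair[OF a this] show ?thesis
      by (cases rule: cut_pairE) (auto simp: up_def dn_def)
  qed
  have onto: "\<exists>x\<in>?I. up x y \<or> dn x y" if "y \<in> ?I" for y
  proof -
    have "cut_pair (rigid 0 y) (rigid y b)" using that cut_pair_rigid by auto
    then have "cut_pair (inv_into G \<alpha> ` rigid 0 y) (inv_into G \<alpha> ` rigid y b)"
      using aut_cut_pair inv_aut a by blast
    moreover have "\<alpha> ` inv_into G \<alpha> ` rigid c d = rigid c d" for c d
      using sub autD(5)[OF a] by (simp add: image_inv_into_cancel)
    ultimately show ?thesis
      by (elim cut_pairE) (metis up_def dn_def greaterThanLessThan_iff)+
  qed
  have LL: "rigid 0 x \<subseteq> rigid 0 y \<longleftrightarrow> x \<le> y" if "x \<in> ?I" "y \<in> ?I" for x y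
    using that rigid_subset[of 0 x 0 y] rigid_mono[of 0 0 x y] by auto
  have RR: "rigid x b \<subseteq> rigid y b \<longleftrightarrow> y \<le> x" if "x \<in> ?I" "y \<in> ?I" for x y
    using that rigid_subset[of x b y b] rigid_mono[of y x b b] by auto
  have LR: "\<not> rigid 0 x \<subseteq> rigid y b" if "x \<in> ?I" "y \<in> ?I" for x y
    using that rigid_subset[of 0 x y b] by auto
  have RL: "\<not> rigid x b \<subseteq> rigid 0 y" if "x \<in> ?I" "y \<in> ?I" for x y
    using that rigid_subset[of x b 0 y] by auto
  have mixed: False if xs: "x \<in> ?I" "x' \<in> ?I" "y \<in> ?I" "y' \<in> ?I" and ud: "up x y" "dn x' y'" for x x' y y'
  proof (cases "x \<le> x'")
    case True
    then have "\<alpha> ` rigid 0 x \<subseteq> \<alpha> ` rigid 0 x'" using LL xs by blast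
    then show False using ud LR xs by (simp add: up_def dn_def)
  next
    case False
    then have "\<alpha> ` rigid 0 x' \<subseteq> \<alpha> ` rigid 0 x" using LL xs by (simp add: image_mono)
    then show False using ud RL xs by (simp add: up_def dn_def)
  qed
  have g_up: "up (g x) (\<alpha> g y)" if "g \<in> G" "up x y" for g x y
  proof -
    have "\<alpha> g \<in> G" "g 0 = 0" "g b = b" "\<alpha> g 0 = 0" "\<alpha> g b = b" 
      using that autD(3)[OF a] fixes_outside by auto
    then show ?thesis using that aut_conj_set[OF a that(1) sub] conj_rigid unfolding up_def by metis
  qed
  have g_dn: "dn (g x) (\<alpha> g y)" if "g \<in> G" "dn x y" for g x y
  proof -
    have "\<alpha> g \<in> G" "g 0 = 0" "g b = b" "\<alpha> g 0 = 0" "\<alpha> g b = b" 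
      using that autD(3)[OF a] fixes_outside by auto
    then show ?thesis using that aut_conj_set[OF a that(1) sub] conj_rigid unfolding dn_def by metis
  qed
  have g_in: "g x \<in> ?I" "\<alpha> g x \<in> ?I" if "g \<in> G" "x \<in> ?I" for g x
    using that autD(3)[OF a] preserves_interval by blast+
  have dichotomy: "(\<forall>x\<in>?I. \<forall>y\<in>?I. \<not> dn x y) \<or> (\<forall>x\<in>?I. \<forall>y\<in>?I. \<not> up x y)"
    using mixed by blast
  consider (up) "\<forall>x\<in>?I. \<exists>y\<in>?I. up x y" "\<forall>y\<in>?I. \<exists>x\<in>?I. up x y" 
    | (dn) "\<forall>x\<in>?I. \<exists>y\<in>?I. dn x y" "\<forall>y\<in>?I. \<exists>x\<in>?I. dn x y" 
  proof (rule disjE[OF dichotomy])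
    assume *: "\<forall>x\<in>?I. \<forall>y\<in>?I. \<not> dn x y"
    show thesis by (rule that(1)) (use ex onto * in blast)+
  next
    assume *: "\<forall>x\<in>?I. \<forall>y\<in>?I. \<not> up x y"
    show thesis by (rule that(2)) (use ex onto * in blast)+
  qed
  then show ?thesis
  proof cases
    case up
    have "\<forall>x\<in>?I. \<exists>y. y \<in> ?I \<and> up x y" using up(1) by blast
    then obtain \<phi> where "\<forall>x\<in>?I. \<phi> x \<in> ?I \<and> up x (\<phi> x)" by (rule bchoice[THEN exE])
    then have \<phi>: "\<phi> x \<in> ?I" "up x (\<phi> x)" if "x \<in> ?I" for x using that by blast+
    have uq: "y = y'" if "y \<in> ?I" "y' \<in> ?I" "up x y" "up x y'" for x y y'
    proof -
      have "rigid 0 y = rigid 0 y'" using that(3,4) by (simp add: up_def)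
      then show ?thesis using LL[OF that(1,2)] LL[OF that(2,1)] by simp
    qed
    have le: "\<phi> x \<le> \<phi> y \<longleftrightarrow> x \<le> y" if "x \<in> ?I" "y \<in> ?I" for x y
    proof -
      have "\<alpha> ` rigid 0 x = rigid 0 (\<phi> x)" "\<alpha> ` rigid 0 y = rigid 0 (\<phi> y)"
        using \<phi>(2)[OF that(1)] \<phi>(2)[OF that(2)] by (auto simp: up_def)
      then show ?thesis
        using image_sub[OF sub sub, of 0 x 0 y] LL[OF that] LL[OF \<phi>(1)[OF that(1)] \<phi>(1)[OF that(2)]] by simp
    qed
    have mono: "strict_mono_on ?I \<phi>"
      by (intro strict_mono_onI) (use le in \<open>auto simp: not_le[symmetric]\<close>)
    have inj: "inj_on \<phi> ?I"
    proof (intro inj_onI)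
      fix x y assume xy: "x \<in> ?I" "y \<in> ?I" "\<phi> x = \<phi> y"
      show "x = y" using le[OF xy(1,2)] le[OF xy(2,1)] xy(3) by simp
    qed
    have "y \<in> \<phi> ` ?I" if yI: "y \<in> ?I" for y
    proof -
      obtain x where x: "x \<in> ?I" "up x y" by (rule bexE[OF bspec[OF up(2) yI]])
      have "\<phi> x = y" by (rule uq[OF \<phi>(1)[OF x(1)] yI \<phi>(2)[OF x(1)] x(2)])
      then show ?thesis using x(1) by (metis imageI)
    qed
    then have "\<phi> ` ?I = ?I" using \<phi>(1) by (metis image_subsetI subsetI subset_antisym)
    then have bijI: "bij_betw \<phi> ?I ?I" using inj by (simp add: bij_betw_def)
    have equi: "\<alpha> g (\<phi> t) = \<phi> (g t)" if "g \<in> G" "t \<in> ?I" for g t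
      by (rule uq[OF g_in(2)[OF that(1) \<phi>(1)[OF that(2)]] \<phi>(1)[OF g_in(1)[OF that]]
            g_up[OF that(1) \<phi>(2)[OF that(2)]] \<phi>(2)[OF g_in(1)[OF that]]])
    show ?thesis by (rule that[OF bijI disjI1[OF mono] equi])
  next
    case dn
    have "\<forall>x\<in>?I. \<exists>y. y \<in> ?I \<and> dn x y" using dn(1) by blast
    then obtain \<phi> where "\<forall>x\<in>?I. \<phi> x \<in> ?I \<and> dn x (\<phi> x)" by (rule bchoice[THEN exE])
    then have \<phi>: "\<phi> x \<in> ?I" "dn x (\<phi> x)" if "x \<in> ?I" for x using that by blast+
    have uq: "y = y'" if "y \<in> ?I" "y' \<in> ?I" "dn x y" "dn x y'" for x y y'
    proof -
      have "rigid y b = rigid y' b" using that(3,4) by (simp add: dn_def)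
      then show ?thesis using RR[OF that(1,2)] RR[OF that(2,1)] by simp
    qed
    have le: "\<phi> y \<le> \<phi> x \<longleftrightarrow> x \<le> y" if "x \<in> ?I" "y \<in> ?I" for x y
    proof -
      have "\<alpha> ` rigid 0 x = rigid (\<phi> x) b" "\<alpha> ` rigid 0 y = rigid (\<phi> y) b"
        using \<phi>(2)[OF that(1)] \<phi>(2)[OF that(2)] by (auto simp: dn_def)
      then show ?thesis
        using image_sub[OF sub sub, of 0 x 0 y] LL[OF that] RR[OF \<phi>(1)[OF that(1)] \<phi>(1)[OF that(2)]] by simp
    qed
    have mono: "strict_antimono_on ?I \<phi>"
      by (intro monotone_onI) (use le in \<open>auto simp: not_le[symmetric]\<close>)
    have inj: "inj_on \<phi> ?I"
    proof (intro inj_onI)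
      fix x y assume xy: "x \<in> ?I" "y \<in> ?I" "\<phi> x = \<phi> y"
      show "x = y" using le[OF xy(1,2)] le[OF xy(2,1)] xy(3) by simp
    qed
    have "y \<in> \<phi> ` ?I" if yI: "y \<in> ?I" for y
    proof -
      obtain x where x: "x \<in> ?I" "dn x y" by (rule bexE[OF bspec[OF dn(2) yI]])
      have "\<phi> x = y" by (rule uq[OF \<phi>(1)[OF x(1)] yI \<phi>(2)[OF x(1)] x(2)])
      then show ?thesis using x(1) by (metis imageI)
    qed
    then have "\<phi> ` ?I = ?I" using \<phi>(1) by (metis image_subsetI subsetI subset_antisym)
    then have bijI: "bij_betw \<phi> ?I ?I" using inj by (simp add: bij_betw_def)
    have equi: "\<alpha> g (\<phi> t) = \<phi> (g t)" if "g \<in> G" "t \<in> ?I" for g t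
      by (rule uq[OF g_in(2)[OF that(1) \<phi>(1)[OF that(2)]] \<phi>(1)[OF g_in(1)[OF that]]
            g_dn[OF that(1) \<phi>(2)[OF that(2)]] \<phi>(2)[OF g_in(1)[OF that]]])
    show ?thesis by (rule that[OF bijI disjI2[OF mono] equi])
  qed
qed

end

section \<open>Order preserving correspondences, multiplicative subgroups and powers\<close>

text \<open>Hoelder's argument: two different ratios would be separated by a rational number, which turns into
  an integral combination of two pairs whose components have opposite signs. The correspondence
  is kept as a relation since it is applied to the slopes of \<open>g\<close> and \<open>\<alpha> g\<close> without first
  showing that one determines the other.\<close>

lemma order_preserving_additive_relation_linear:
  fixes D :: "(real \<times> real) set"
  assumes add: "\<And>x y x' y'. (x, y) \<in> D \<Longrightarrow> (x', y') \<in> D \<Longrightarrow> (x + x', y + y') \<in> D"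
    and neg: "\<And>x y. (x, y) \<in> D \<Longrightarrow> (- x, - y) \<in> D"
    and pos: "\<And>x y. (x, y) \<in> D \<Longrightarrow> 0 < x \<Longrightarrow> 0 < y"
    and zero: "\<And>y. (0, y) \<in> D \<Longrightarrow> y = 0"
  shows "\<exists>s>0. \<forall>(x, y)\<in>D. y = s * x"
proof (cases "\<exists>x y. (x, y) \<in> D \<and> x \<noteq> 0")
  case False
  then show ?thesis using zero by (intro exI[of _ 1]) auto
next
  case True
  then obtain x1 y1 where "(x1, y1) \<in> D" "x1 \<noteq> 0" by blast
  then obtain x0 y0 where D0: "(x0, y0) \<in> D" and x0: "0 < x0"
    using neg[of x1 y1] by (cases "0 < x1") auto
  have y0: "0 < y0" using pos D0 x0 by blast
  have mult: "(real n * x, real n * y) \<in> D" if "(x, y) \<in> D" for n x y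
  proof (induction n)
    case 0
    show ?case using add[OF that neg[OF that]] by simp
  next
    case (Suc n)
    then show ?case using add[OF that Suc] by (simp add: algebra_simps)
  qed
  have imult: "(real_of_int k * x, real_of_int k * y) \<in> D" if "(x, y) \<in> D" for k x y
  proof (cases "0 \<le> k")
    case True
    then show ?thesis using mult[OF that, of "nat k"] by simp
  next
    case False
    then show ?thesis using neg[OF mult[OF that, of "nat (- k)"]] by simp
  qed
  \<comment> \<open>\<open>n * (x, y) - k * (x0, y0)\<close> has components of opposite signs when \<open>q = k / n\<close> lies in between\<close>
  have no_gap: "\<not> (x / x0 < q \<and> q < y / y0)" "\<not> (y / y0 < q \<and> q < x / x0)"
    if xy: "(x, y) \<in> D" and q: "q \<in> \<rat>" for x y q
  proof -
    obtain k n where kn: "q = real_of_int k / real_of_int n" "n > 0"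
      using q by (metis Rats_cases')
    have L: "(real_of_int n * x + real_of_int (- k) * x0, real_of_int n * y + real_of_int (- k) * y0) \<in> D"
      using add imult xy D0 by blast
    have iff: "q < x / x0 \<longleftrightarrow> 0 < real_of_int n * x + real_of_int (- k) * x0"
      "q < y / y0 \<longleftrightarrow> 0 < real_of_int n * y + real_of_int (- k) * y0"
      "x / x0 < q \<longleftrightarrow> real_of_int n * x + real_of_int (- k) * x0 < 0"
      "y / y0 < q \<longleftrightarrow> real_of_int n * y + real_of_int (- k) * y0 < 0"
      using kn(2) x0 y0 unfolding kn(1) by (auto simp: field_simps)
    show "\<not> (x / x0 < q \<and> q < y / y0)"
      unfolding iff using pos[OF neg[OF L]] by auto
    show "\<not> (y / y0 < q \<and> q < x / x0)"
      unfolding iff using pos[OF L] by auto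
  qed
  have "y = (y0 / x0) * x" if xy: "(x, y) \<in> D" for x y
  proof -
    have "x / x0 = y / y0"
    proof (rule ccontr)
      assume "x / x0 \<noteq> y / y0"
      then consider "x / x0 < y / y0" | "y / y0 < x / x0" by linarith
      then show False
      proof cases
        case 1
        from Rats_dense_in_real[OF 1] show False using no_gap(1)[OF xy] by blast
      next
        case 2
        from Rats_dense_in_real[OF 2] show False using no_gap(2)[OF xy] by blast
      qed
    qed
    then show ?thesis using x0 y0 by (simp add: field_simps)
  qed
  moreover have "0 < y0 / x0" using x0 y0 by simp
  ultimately show ?thesis by (intro exI[of _ "y0 / x0"]) auto
qed

definition dense_pos :: "real set \<Rightarrow> bool" where
  "dense_pos Q \<longleftrightarrow> (\<forall>u v. 0 < u \<longrightarrow> u < v \<longrightarrow> (\<exists>q\<in>Q. u < q \<and> q < v))"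

lemma powi_between:
  fixes z u :: real
  assumes "1 < z" "0 < u"
  obtains n :: int where "z powi n \<le> u" "u < z powi (n + 1)"
proof -
  define n where "n = \<lfloor>log z u\<rfloor>"
  have p: "z powr real_of_int k = z powi k" for k
    using assms by (simp add: powr_real_of_int')
  have "real_of_int n \<le> log z u" "log z u < real_of_int (n + 1)" unfolding n_def by linarith+
  then have "z powr real_of_int n \<le> u" "u < z powr real_of_int (n + 1)"
    using assms by (simp_all add: powr_le_iff less_powr_iff)
  then show ?thesis using that[of n] unfolding p by blast
qed

text \<open>If there are elements arbitrarily close to \<open>1\<close> from above, their powers are dense; otherwise the
  infimum of the elements above \<open>1\<close> is attained and generates. For the trivial subgroup the
  generator is \<open>1\<close>.\<close>

lemma mult_subgroup_dense_or_cyclic: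
  fixes Q :: "real set"
  assumes pos: "Q \<subseteq> {0<..}" and one: "1 \<in> Q"
    and mult: "\<And>x y. x \<in> Q \<Longrightarrow> y \<in> Q \<Longrightarrow> x * y \<in> Q" and inv: "\<And>x. x \<in> Q \<Longrightarrow> inverse x \<in> Q"
  shows "dense_pos Q \<or> (\<exists>z\<in>Q. z \<ge> 1 \<and> (\<forall>q\<in>Q. 1 < q \<longrightarrow> z \<le> q) \<and> Q = range (\<lambda>n::int. z powi n))"
proof -
  have pow: "q ^ n \<in> Q" if "q \<in> Q" for q n
    by (induction n) (use one mult that in auto)
  have powi: "q powi n \<in> Q" if "q \<in> Q" for q and n :: int
    using pow that inv by (auto simp: power_int_def)
  show ?thesis
  proof (cases "\<forall>e>1. \<exists>q\<in>Q. 1 < q \<and> q < e")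
    case True
    have "\<exists>q\<in>Q. u < q \<and> q < v" if "0 < u" "u < v" for u v
    proof -
      have "1 < v / u" using that by simp
      then obtain q where q: "q \<in> Q" "1 < q" "q < v / u" using True by blast
      then obtain n :: int where n: "q powi n \<le> u" "u < q powi (n + 1)" using powi_between[of q u] \<open>0 < u\<close> by blast
      have "q powi (n + 1) = q * q powi n" using q by (simp add: power_int_add)
      also have "\<dots> \<le> q * u" using n q by simp
      also have "\<dots> < v" using q that by (simp add: field_simps)
      finally show ?thesis using n powi[OF q(1)] by blast
    qed
    then show ?thesis by (auto simp: dense_pos_def)
  next
    case False
    then obtain e where e: "1 < e" "\<And>q. q \<in> Q \<Longrightarrow> 1 < q \<Longrightarrow> e \<le> q" by (meson not_le)
    show ?thesis
    proof (cases "\<exists>q\<in>Q. 1 < q")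
      case False
      have "q = 1" if "q \<in> Q" for q
      proof -
        have "0 < q" "q \<le> 1" "inverse q \<le> 1" using pos that False inv by (auto simp: not_less[symmetric])
        then show ?thesis by (simp add: field_simps)
      qed
      then have "Q = {1}" using one by blast
      then show ?thesis by auto
    next
      case True
      define m where "m = Inf {q\<in>Q. 1 < q}"
      have bdd: "bdd_below {q\<in>Q. 1 < q}" by (auto intro!: bdd_belowI[of _ 1])
      have m_le: "m \<le> q" if "q \<in> Q" "1 < q" for q
        unfolding m_def by (rule cInf_lower[OF _ bdd]) (use that in auto)
      have m1: "e \<le> m" unfolding m_def by (rule cInf_greatest) (use True e in auto)
      have mQ: "m \<in> Q"
      proof (rule ccontr)
        assume nm: "m \<notin> Q"
        have "m < m * e" using e m1 by simp
        then obtain q where q: "q \<in> Q" "1 < q" "q < m * e"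
          using cInf_lessD[of "{q\<in>Q. 1 < q}" "m * e"] True unfolding m_def by blast
        have "m < q" using m_le[OF q(1,2)] nm q(1) by (cases "m = q") auto
        then obtain q' where q': "q' \<in> Q" "1 < q'" "q' < q"
          using cInf_lessD[of "{q\<in>Q. 1 < q}" q] True unfolding m_def by blast
        have "m \<le> q'" using m_le q' by blast
        then have "m * e \<le> q' * e" using e by simp
        then have "q / q' < e" using q q' by (simp add: divide_less_eq mult.commute)
        moreover have "1 < q / q'" using q' by simp
        moreover have "q / q' \<in> Q" using mult[OF q(1) inv[OF q'(1)]] by (simp add: divide_inverse)
        ultimately show False using e(2) by force
      qed
      have "Q \<subseteq> range (\<lambda>n::int. m powi n)"
      proof
        fix q assume q: "q \<in> Q"
        then have q0: "0 < q" using pos by auto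
        have m0: "1 < m" using e m1 by simp
        obtain n :: int where n: "m powi n \<le> q" "q < m powi (n + 1)" using powi_between[OF m0 q0] .
        have mp: "0 < m powi n" using m0 by simp
        define r where "r = q / m powi n"
        have rQ: "r \<in> Q" unfolding r_def divide_inverse using mult[OF q inv[OF powi[OF mQ]]] .
        have "1 \<le> r" using n mp by (simp add: r_def)
        moreover have "r < m" using n mp m0 by (simp add: r_def divide_simps power_int_add mult.commute)
        ultimately have "r = 1" using m_le[OF rQ] by force
        then have "q = m powi n" using mp by (simp add: r_def)
        then show "q \<in> range (\<lambda>n::int. m powi n)" by blast
      qed
      moreover have "range (\<lambda>n::int. m powi n) \<subseteq> Q" using powi mQ by blast
      ultimately show ?thesis using mQ m1 e m_le by (intro disjI2 bexI[of _ m]) auto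
    qed
  qed
qed

text \<open>Conjugation by a power function does not preserve affinity away from the origin: comparing
  derivatives shows that \<open>((p * t + d) / t) powr (s - 1)\<close> is constant, and as \<open>d \<noteq> 0\<close> the base
  is not.\<close>

lemma powr_conjugate_affine:
  fixes s C m n p d u v :: real
  assumes "s \<noteq> 0" "C \<noteq> 0" "0 < p" "d \<noteq> 0" "0 < u" "u < v"
    and pos: "\<And>t. u < t \<Longrightarrow> t < v \<Longrightarrow> 0 < p * t + d"
    and eq: "\<And>t. u < t \<Longrightarrow> t < v \<Longrightarrow> C * (p * t + d) powr s = m * (C * t powr s) + n"
  shows "s = 1"
proof (rule ccontr)
  assume "s \<noteq> 1"
  have ratio: "((p * t + d) / t) powr (s - 1) = m / p" if t: "u < t" "t < v" for t
  proof -
    have t0: "0 < t" using t assms by simp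
    have D1: "((\<lambda>t. C * (p * t + d) powr s) has_real_derivative C * (s * (p * t + d) powr (s - 1) * p)) (at t)"
      by (auto intro!: derivative_eq_intros simp: pos[OF t])
    have D2: "((\<lambda>t. m * (C * t powr s) + n) has_real_derivative m * (C * (s * t powr (s - 1)))) (at t)"
      by (auto intro!: derivative_eq_intros simp: t0)
    have ev: "\<forall>\<^sub>F t in nhds t. C * (p * t + d) powr s = m * (C * t powr s) + n"
      using eventually_nhds_in_open[of "{u<..<v}" t] t eq by (auto elim!: eventually_mono)
    have "C * (s * (p * t + d) powr (s - 1) * p) = m * (C * (s * t powr (s - 1)))"
      by (rule DERIV_unique[OF D1[THEN DERIV_cong_ev[OF refl ev refl, THEN iffD1]] D2])
    then have "p * (p * t + d) powr (s - 1) = m * t powr (s - 1)" using assms by (simp add: field_simps)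
    then have "(p * t + d) powr (s - 1) / t powr (s - 1) = m / p" using t0 assms(3) by (simp add: field_simps)
    then show ?thesis using t0 pos[OF t] by (simp add: powr_divide)
  qed
  define t1 where "t1 = u + (v - u) / 3"
  define t2 where "t2 = u + 2 * (v - u) / 3"
  have t: "u < t1" "t1 < t2" "t2 < v" using assms by (auto simp: t1_def t2_def field_simps)
  have "((p * t1 + d) / t1) powr (s - 1) = ((p * t2 + d) / t2) powr (s - 1)"
    using ratio[of t1] ratio[of t2] t by simp
  then have "(s - 1) * ln ((p * t1 + d) / t1) = (s - 1) * ln ((p * t2 + d) / t2)"
    by (metis ln_powr)
  moreover have "0 < (p * t1 + d) / t1" "0 < (p * t2 + d) / t2" using pos t assms by auto
  ultimately have "(p * t1 + d) / t1 = (p * t2 + d) / t2"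
    using \<open>s \<noteq> 1\<close> by simp
  then show False using t assms by (simp add: field_simps)
qed

section \<open>Slopes at the left end point\<close>

text \<open>The piecewise linear features used in the analysis of germs. They are formulated symmetrically
  under reflection of the interval, so that statements about the right end point follow from those about
  the left one; this is why a bump is described by its fixed centre \<open>a\<close> instead of a formula \<open>p * t + c\<close>.\<close>

locale pl_moving_group = moving_group +
  assumes b_pos: "0 < b"
    and linear_at_left_end: "g \<in> G \<Longrightarrow> \<exists>p>0. \<exists>e>0. \<forall>t\<in>{0..e}. g t = p * t"
    and linear_at_right_end: "g \<in> G \<Longrightarrow> \<exists>p>0. \<exists>e>0. \<forall>t\<in>{b - e..b}. g t = b - p * (b - t)"
    and affine_somewhere: "g \<in> G \<Longrightarrow> 0 \<le> c \<Longrightarrow> c < d \<Longrightarrow> d \<le> b \<Longrightarrow>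
      \<exists>u v. c \<le> u \<and> u < v \<and> v \<le> d \<and> affine_on {u<..<v} g"
    and affine_bump: "0 \<le> c \<Longrightarrow> c < d \<Longrightarrow> d \<le> b \<Longrightarrow>
      \<exists>g\<in>G. (\<forall>t. t \<notin> {c<..<d} \<longrightarrow> g t = t) \<and>
        (\<exists>a u v p. c < a \<and> a < d \<and> c < u \<and> u < v \<and> v < d \<and> 0 < p \<and> p \<noteq> 1 \<and>
          (\<forall>t\<in>{u<..<v}. g t = a + p * (t - a)))"
begin

lemma sigma_l_eqI:
  assumes "0 < e" "\<And>t. 0 \<le> t \<Longrightarrow> t \<le> e \<Longrightarrow> g t = p * t"
  shows "sigma_l g = p"
proof -
  have "((\<lambda>t. p * t) has_vector_derivative p) (at 0 within {0..e})"
    by (auto intro!: derivative_eq_intros simp flip: has_real_derivative_iff_has_vector_derivative)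
  then have "(g has_vector_derivative p) (at 0 within {0..e})"
    by (rule has_vector_derivative_transform[rotated 2]) (use assms in auto)
  then have "(g has_vector_derivative p) (at_right 0)"
    using assms(1) by (simp add: at_within_Icc_at_right)
  then show ?thesis unfolding sigma_l_def by (intro vector_derivative_within) auto
qed

lemma sigma_l:
  assumes "g \<in> G"
  shows "0 < sigma_l g" "\<exists>e>0. \<forall>t\<in>{0..e}. g t = sigma_l g * t"
proof -
  obtain p e where p: "0 < p" "0 < e" "\<And>t. 0 \<le> t \<Longrightarrow> t \<le> e \<Longrightarrow> g t = p * t"
    using linear_at_left_end[OF assms] by auto
  have "sigma_l g = p" using sigma_l_eqI[OF p(2,3)] .
  then show "0 < sigma_l g" "\<exists>e>0. \<forall>t\<in>{0..e}. g t = sigma_l g * t" using p by auto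
qed

lemma sigma_l_id: "sigma_l id = 1"
  by (rule sigma_l_eqI[of 1]) auto

lemma sigma_l_comp:
  assumes g: "g \<in> G" and h: "h \<in> G"
  shows "sigma_l (g \<circ> h) = sigma_l g * sigma_l h"
proof -
  obtain e where e: "0 < e" "\<forall>t\<in>{0..e}. g t = sigma_l g * t" using sigma_l(2)[OF g] by blast
  obtain d where d: "0 < d" "\<forall>t\<in>{0..d}. h t = sigma_l h * t" using sigma_l(2)[OF h] by blast
  have pos: "0 < sigma_l h" using sigma_l(1)[OF h] .
  show ?thesis
  proof (rule sigma_l_eqI[of "min d (e / sigma_l h)"])
    fix t :: real assume t: "0 \<le> t" "t \<le> min d (e / sigma_l h)"
    then have "0 \<le> sigma_l h * t" "sigma_l h * t \<le> e" using pos by (auto simp: field_simps)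
    then show "(g \<circ> h) t = sigma_l g * sigma_l h * t" using e d t by simp
  qed (use d e pos in simp)
qed

lemma sigma_l_inv:
  assumes "g \<in> G" shows "sigma_l (fun_inv g) = inverse (sigma_l g)"
proof -
  have "sigma_l g * sigma_l (fun_inv g) = 1"
    using sigma_l_comp[OF assms inv_mem[OF assms]] inv_comp(2)[OF assms] sigma_l_id by simp
  then show ?thesis by (metis inverse_unique)
qed

lemma sigma_l_image_subgroup:
  shows "sigma_l ` G \<subseteq> {0<..}" "1 \<in> sigma_l ` G"
    "x \<in> sigma_l ` G \<Longrightarrow> y \<in> sigma_l ` G \<Longrightarrow> x * y \<in> sigma_l ` G"
    "x \<in> sigma_l ` G \<Longrightarrow> inverse x \<in> sigma_l ` G"
proof -
  show "sigma_l ` G \<subseteq> {0<..}" using sigma_l(1) by auto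
  show "1 \<in> sigma_l ` G" using sigma_l_id id_mem by (metis imageI)
  show "x * y \<in> sigma_l ` G" if "x \<in> sigma_l ` G" "y \<in> sigma_l ` G"
    using that sigma_l_comp comp_mem by (auto simp: image_iff) metis
  show "inverse x \<in> sigma_l ` G" if "x \<in> sigma_l ` G"
    using that sigma_l_inv inv_mem by (auto simp: image_iff) metis
qed

end

section \<open>Increasing conjugations preserve the slope at the left end point\<close>

text \<open>Two groups are needed although the automorphism acts on one: a decreasing automorphism becomes
  an increasing conjugation after one of the two copies of the group has been reflected.\<close>

locale conjugate_pl_groups = G1: pl_moving_group b G1 + G2: pl_moving_group b G2 for b G1 G2 +
  fixes \<alpha> :: "(real \<Rightarrow> real) \<Rightarrow> real \<Rightarrow> real" and \<phi> :: "real \<Rightarrow> real"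
  assumes bij_phi: "bij_betw \<phi> {0<..<b} {0<..<b}"
    and mono_phi: "strict_mono_on {0<..<b} \<phi>"
    and image_alpha: "\<alpha> ` G1 = G2"
    and conj: "g \<in> G1 \<Longrightarrow> t \<in> {0<..<b} \<Longrightarrow> \<alpha> g (\<phi> t) = \<phi> (g t)"
begin

lemma alpha_mem: "g \<in> G1 \<Longrightarrow> \<alpha> g \<in> G2"
  using image_alpha by blast

lemma phi_mem: "0 < t \<Longrightarrow> t < b \<Longrightarrow> 0 < \<phi> t \<and> \<phi> t < b"
  using bij_phi by (auto simp: bij_betw_def)

lemma phi_less_iff: "\<lbrakk>0 < s; s < b; 0 < t; t < b\<rbrakk> \<Longrightarrow> \<phi> s < \<phi> t \<longleftrightarrow> s < t"
  using mono_phi by (simp add: strict_mono_on_less)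

lemma phi_le_iff: "\<lbrakk>0 < s; s < b; 0 < t; t < b\<rbrakk> \<Longrightarrow> \<phi> s \<le> \<phi> t \<longleftrightarrow> s \<le> t"
  using phi_less_iff[of t s] by (simp add: not_less[symmetric])

lemma phi_onto: 
  assumes "0 < s" "s < b" obtains t where "0 < t" "t < b" "\<phi> t = s"
proof -
  have "s \<in> \<phi> ` {0<..<b}" using bij_phi assms by (simp add: bij_betw_def)
  then show ?thesis using that by auto
qed

lemma small_point:
  assumes "0 < e" "0 < e'"
  obtains r where "0 < r" "r < b" "r \<le> e" "\<phi> r \<le> e'"
proof -
  define m where "m = min e (b / 2)"
  have m: "0 < m" "m < b" "m \<le> e" using assms G1.b_pos by (auto simp: m_def)
  define s where "s = min e' (\<phi> m)"
  have s: "0 < s" "s < b" "s \<le> e'" "s \<le> \<phi> m" using assms phi_mem[OF m(1,2)] by (auto simp: s_def)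
  obtain r where r: "0 < r" "r < b" "\<phi> r = s" using phi_onto[OF s(1,2)] .
  have "r \<le> m" using s r m by (simp flip: phi_le_iff)
  then show ?thesis using that[of r] r s m by simp
qed

text \<open>Near \<open>0\<close> both \<open>g\<close> and \<open>\<alpha> g\<close> are multiplications, hence \<open>\<phi>\<close> intertwines the two; the
  neighbourhood still depends on \<open>g\<close>.\<close>

lemma germ_relation:
  assumes g: "g \<in> G1"
  obtains r where "0 < r" "r < b"
    "\<And>t. 0 < t \<Longrightarrow> t \<le> r \<Longrightarrow> 0 < sigma_l g * t \<and> sigma_l g * t < b \<and> \<phi> (sigma_l g * t) = sigma_l (\<alpha> g) * \<phi> t"
proof -
  obtain e where e: "0 < e" "\<forall>t\<in>{0..e}. g t = sigma_l g * t" using G1.sigma_l(2)[OF g] by blast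
  obtain e' where e': "0 < e'" "\<forall>t\<in>{0..e'}. \<alpha> g t = sigma_l (\<alpha> g) * t" 
    using G2.sigma_l(2)[OF alpha_mem[OF g]] by blast
  obtain r where r: "0 < r" "r < b" "r \<le> e" "\<phi> r \<le> e'" by (rule small_point[OF e(1) e'(1)]) (rule that)
  show ?thesis
  proof (rule that[OF r(1,2)])
    fix t assume t: "0 < t" "t \<le> r"
    have gt: "g t = sigma_l g * t" using t r e(2) by simp
    have "0 < g t \<and> g t < b" using G1.preserves_interval[OF g, of t] t r by simp
    moreover have "\<phi> t \<le> \<phi> r" using phi_le_iff t r by simp
    then have "\<alpha> g (\<phi> t) = sigma_l (\<alpha> g) * \<phi> t" using e'(2) r phi_mem[of t] t by simp
    moreover have "\<alpha> g (\<phi> t) = \<phi> (g t)" using conj[OF g] t r by simp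
    ultimately show "0 < sigma_l g * t \<and> sigma_l g * t < b \<and> \<phi> (sigma_l g * t) = sigma_l (\<alpha> g) * \<phi> t"
      unfolding gt by simp
  qed
qed

lemma sigma_l_order:
  assumes g: "g \<in> G1" and h: "h \<in> G1"
  shows "sigma_l (\<alpha> g) < sigma_l (\<alpha> h) \<longleftrightarrow> sigma_l g < sigma_l h"
proof -
  obtain r where r: "0 < r" "r < b" and gr: "\<And>t. 0 < t \<Longrightarrow> t \<le> r \<Longrightarrow> 0 < sigma_l g * t \<and> sigma_l g * t < b \<and> \<phi> (sigma_l g * t) = sigma_l (\<alpha> g) * \<phi> t"
    by (rule germ_relation[OF g]) (rule that)
  obtain r' where r': "0 < r'" "r' < b" and hr: "\<And>t. 0 < t \<Longrightarrow> t \<le> r' \<Longrightarrow> 0 < sigma_l h * t \<and> sigma_l h * t < b \<and> \<phi> (sigma_l h * t) = sigma_l (\<alpha> h) * \<phi> t"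
    by (rule germ_relation[OF h]) (rule that)
  define t where "t = min r r'"
  have t: "0 < t" "t \<le> r" "t \<le> r'" using r r' by (auto simp: t_def)
  have p: "0 < \<phi> t" using phi_mem t r by simp
  have "sigma_l (\<alpha> g) < sigma_l (\<alpha> h) \<longleftrightarrow> \<phi> (sigma_l g * t) < \<phi> (sigma_l h * t)"
    using gr[OF t(1,2)] hr[OF t(1,3)] p by simp
  also have "\<dots> \<longleftrightarrow> sigma_l g * t < sigma_l h * t" 
    using gr[OF t(1,2)] hr[OF t(1,3)] by (intro phi_less_iff) auto
  finally show ?thesis using t by simp
qed

lemma alpha_comp:
  assumes g: "g \<in> G1" and h: "h \<in> G1"
  shows "\<alpha> (g \<circ> h) = \<alpha> g \<circ> \<alpha> h"
proof
  fix s
  have gh: "g \<circ> h \<in> G1" using G1.comp_mem[OF g h] .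
  show "\<alpha> (g \<circ> h) s = (\<alpha> g \<circ> \<alpha> h) s"
  proof (cases "0 < s \<and> s < b")
    case True
    then obtain t where t: "0 < t" "t < b" "\<phi> t = s" using phi_onto by blast
    have ht: "h t \<in> {0<..<b}" using G1.preserves_interval[OF h, of t] t by simp
    have "\<alpha> (g \<circ> h) s = \<phi> (g (h t))" using conj[OF gh, of t] t by simp
    also have "\<dots> = \<alpha> g (\<alpha> h s)" using conj[OF g ht] conj[OF h, of t] t by simp
    finally show ?thesis by simp
  next
    case False
    then have "\<alpha> g s = s" "\<alpha> h s = s" "\<alpha> (g \<circ> h) s = s"
      using g h gh alpha_mem by (auto intro!: G2.fixes_outside)
    then show ?thesis by simp
  qed
qed

lemma sigma_l_alpha_comp:
  "g \<in> G1 \<Longrightarrow> h \<in> G1 \<Longrightarrow> sigma_l (\<alpha> (g \<circ> h)) = sigma_l (\<alpha> g) * sigma_l (\<alpha> h)"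
  by (simp add: alpha_comp alpha_mem G2.sigma_l_comp)

lemma sigma_l_alpha_one:
  assumes g: "g \<in> G1" "sigma_l g = 1" shows "sigma_l (\<alpha> g) = 1"
proof -
  obtain r where r: "0 < r" "r < b" and gr: "\<And>t. 0 < t \<Longrightarrow> t \<le> r \<Longrightarrow> 0 < sigma_l g * t \<and> sigma_l g * t < b \<and> \<phi> (sigma_l g * t) = sigma_l (\<alpha> g) * \<phi> t"
    by (rule germ_relation[OF g(1)]) (rule that)
  have "\<phi> r = sigma_l (\<alpha> g) * \<phi> r" using gr[of r] r g by simp
  then show ?thesis using phi_mem r by force
qed

lemma sigma_l_alpha_inv:
  assumes g: "g \<in> G1" shows "sigma_l (\<alpha> (fun_inv g)) = inverse (sigma_l (\<alpha> g))"
proof -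
  have "sigma_l (\<alpha> (g \<circ> fun_inv g)) = 1"
    using G1.inv_comp(2)[OF g] sigma_l_alpha_one[OF G1.id_mem G1.sigma_l_id] by simp
  then have "sigma_l (\<alpha> g) * sigma_l (\<alpha> (fun_inv g)) = 1"
    using sigma_l_alpha_comp[OF g G1.inv_mem[OF g]] by simp
  then show ?thesis by (metis inverse_unique)
qed

lemma sigma_l_alpha_powr:
  obtains s where "0 < s" "\<And>g. g \<in> G1 \<Longrightarrow> sigma_l (\<alpha> g) = sigma_l g powr s"
proof -
  define D where "D = (\<lambda>g. (ln (sigma_l g), ln (sigma_l (\<alpha> g)))) ` G1"
  have pos: "0 < sigma_l g" "0 < sigma_l (\<alpha> g)" if "g \<in> G1" for g
    using that G1.sigma_l(1) G2.sigma_l(1) alpha_mem by auto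
  have "\<exists>s>0. \<forall>(x, y)\<in>D. y = s * x"
  proof (rule order_preserving_additive_relation_linear)
    fix x y x' y' assume "(x, y) \<in> D" "(x', y') \<in> D"
    then obtain g h where gh: "g \<in> G1" "h \<in> G1" "x = ln (sigma_l g)" "y = ln (sigma_l (\<alpha> g))"
      "x' = ln (sigma_l h)" "y' = ln (sigma_l (\<alpha> h))" unfolding D_def by auto
    have "(ln (sigma_l (g \<circ> h)), ln (sigma_l (\<alpha> (g \<circ> h)))) \<in> D"
      unfolding D_def using G1.comp_mem gh(1,2) by blast
    then show "(x + x', y + y') \<in> D"
      using gh pos[OF gh(1)] pos[OF gh(2)] by (simp add: G1.sigma_l_comp sigma_l_alpha_comp ln_mult)
  next
    fix x y assume "(x, y) \<in> D"
    then obtain g where g: "g \<in> G1" "x = ln (sigma_l g)" "y = ln (sigma_l (\<alpha> g))" unfolding D_def by auto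
    have "(ln (sigma_l (fun_inv g)), ln (sigma_l (\<alpha> (fun_inv g)))) \<in> D"
      unfolding D_def using G1.inv_mem g(1) by blast
    then show "(- x, - y) \<in> D" 
      using g pos by (simp add: G1.sigma_l_inv sigma_l_alpha_inv ln_inverse)
  next
    fix x y assume "(x, y) \<in> D" "0 < x"
    then obtain g where g: "g \<in> G1" "x = ln (sigma_l g)" "y = ln (sigma_l (\<alpha> g))" unfolding D_def by auto
    have "1 < sigma_l g" using g \<open>0 < x\<close> pos by (simp add: ln_gt_zero_iff)
    then have "1 < sigma_l (\<alpha> g)"
      using sigma_l_order[OF G1.id_mem g(1)] G1.sigma_l_id sigma_l_alpha_one[OF G1.id_mem] by simp
    then show "0 < y" using g by simp
  next
    fix y assume "(0, y) \<in> D"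
    then obtain g where g: "g \<in> G1" "0 = ln (sigma_l g)" "y = ln (sigma_l (\<alpha> g))" unfolding D_def by auto
    then have "sigma_l g = 1" using pos[of g] by (metis ln_eq_zero_iff)
    then show "y = 0" using sigma_l_alpha_one g by simp
  qed
  then obtain s where s: "0 < s" "\<And>x y. (x, y) \<in> D \<Longrightarrow> y = s * x" by blast
  show ?thesis
  proof (rule that[OF s(1)])
    fix g assume g: "g \<in> G1"
    have "ln (sigma_l (\<alpha> g)) = s * ln (sigma_l g)" using s(2) g unfolding D_def by blast
    then show "sigma_l (\<alpha> g) = sigma_l g powr s"
      using pos[OF g] by (simp add: powr_def) (metis exp_ln)
  qed
qed

text \<open>The neighbourhood can be chosen independently of \<open>g\<close>. A fixed contraction \<open>k\<close> satisfies the
  relation on \<open>(0, r]\<close>; its powers carry any \<open>t\<close> in there into the neighbourhood that belongs to \<open>g\<close>, and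
  the relation at the contracted point is the one at \<open>t\<close> up to the multiplier of that power.\<close>

lemma uniform_germ_relation:
  assumes k: "k \<in> G1" "sigma_l k < 1"
  obtains r where "0 < r" "r < b"
    "\<And>g t. g \<in> G1 \<Longrightarrow> sigma_l g \<le> 1 \<Longrightarrow> 0 < t \<Longrightarrow> t \<le> r \<Longrightarrow> \<phi> (sigma_l g * t) = sigma_l (\<alpha> g) * \<phi> t"
proof -
  define q where "q = sigma_l k"
  define q' where "q' = sigma_l (\<alpha> k)"
  have q: "0 < q" "q < 1" using k G1.sigma_l(1) by (auto simp: q_def)
  have q': "0 < q'" using G2.sigma_l(1)[OF alpha_mem[OF k(1)]] by (simp add: q'_def)
  obtain r where r: "0 < r" "r < b" and kr0: "\<And>t. 0 < t \<Longrightarrow> t \<le> r \<Longrightarrow> 0 < sigma_l k * t \<and> sigma_l k * t < b \<and> \<phi> (sigma_l k * t) = sigma_l (\<alpha> k) * \<phi> t"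
    by (rule germ_relation[OF k(1)]) (rule that)
  note kr = kr0[folded q_def q'_def]
  have iter: "\<phi> (q ^ n * t) = q' ^ n * \<phi> t" if "0 < t" "t \<le> r" for n t
  proof (induction n)
    case (Suc n)
    have "0 < q ^ n * t" using q that by simp
    moreover have "q ^ n * t \<le> 1 * r" using q that by (intro mult_mono power_le_one) auto
    ultimately show ?case using kr[of "q ^ n * t"] Suc by (simp add: mult.assoc)
  qed simp
  show ?thesis
  proof (rule that[OF r])
    fix g t assume g: "g \<in> G1" "sigma_l g \<le> 1" and t: "0 < t" "t \<le> r"
    obtain e where e: "0 < e" and ge: "\<And>t. 0 < t \<Longrightarrow> t \<le> e \<Longrightarrow> 0 < sigma_l g * t \<and> sigma_l g * t < b \<and> \<phi> (sigma_l g * t) = sigma_l (\<alpha> g) * \<phi> t"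
      by (rule germ_relation[OF g(1)]) (rule that)
    have p: "0 < sigma_l g" using G1.sigma_l(1) g by blast
    have "0 < e / t" using e t by simp
    then obtain n where "q ^ n < e / t" using real_arch_pow_inv[of "e / t" q] q by auto
    then have n: "q ^ n * t \<le> e" "0 < q ^ n * t" using t q by (auto simp: field_simps)
    have "sigma_l g * t \<le> 1 * r" using g t p by (intro mult_mono) auto
    then have "q' ^ n * \<phi> (sigma_l g * t) = \<phi> (q ^ n * (sigma_l g * t))"
      using iter[of "sigma_l g * t" n] p t by simp
    also have "\<dots> = \<phi> (sigma_l g * (q ^ n * t))" by (simp add: algebra_simps)
    also have "\<dots> = sigma_l (\<alpha> g) * (q' ^ n * \<phi> t)" using ge[OF n(2,1)] iter[OF t] by simp
    finally show "\<phi> (sigma_l g * t) = sigma_l (\<alpha> g) * \<phi> t" using q' by simp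
  qed
qed

text \<open>The uniform relation determines \<open>\<phi>\<close> on a dense set of points \<open>q * r\<close> with \<open>q\<close> a slope, and
  monotonicity of \<open>\<phi>\<close> does the rest.\<close>

lemma phi_power_near_0:
  assumes dense: "dense_pos (sigma_l ` G1)" and s: "0 < s"
    and pw: "\<And>g. g \<in> G1 \<Longrightarrow> sigma_l (\<alpha> g) = sigma_l g powr s"
  obtains r C where "0 < r" "r < b" "0 < C" "\<And>t. 0 < t \<Longrightarrow> t < r \<Longrightarrow> \<phi> t = C * t powr s"
proof -
  have "\<exists>q\<in>sigma_l ` G1. 1 / 2 < q \<and> q < 1"
    using dense[unfolded dense_pos_def, rule_format, of "1 / 2" 1] by simp
  then obtain k where k: "k \<in> G1" "sigma_l k < 1" by blast
  obtain r where r: "0 < r" "r < b" 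
    and rel: "\<And>g t. g \<in> G1 \<Longrightarrow> sigma_l g \<le> 1 \<Longrightarrow> 0 < t \<Longrightarrow> t \<le> r \<Longrightarrow> \<phi> (sigma_l g * t) = sigma_l (\<alpha> g) * \<phi> t"
    by (rule uniform_germ_relation[OF k]) (rule that)
  have pr: "0 < \<phi> r" using phi_mem r by blast
  have Q: "\<phi> (q * r) = q powr s * \<phi> r" if q: "q \<in> sigma_l ` G1" "q \<le> 1" for q
    using rel[of _ r] pw q r by auto
  have powr_le: "x powr s < y powr s \<longleftrightarrow> x < y" if "0 < x" "0 < y" for x y :: real
    using powr_less_mono2[OF s, of x y] powr_less_cancel2[OF s that] that by auto
  have main: "\<phi> (u * r) = u powr s * \<phi> r" if u: "0 < u" "u < 1" for u
  proof -
    \<comment> \<open>\<open>w\<close> is the factor at which the power law would give the value \<open>\<phi> (u * r)\<close>\<close>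
    define w where "w = (\<phi> (u * r) / \<phi> r) powr (1 / s)"
    have ur: "0 < u * r" "u * r < r" using u r by auto
    have pu: "0 < \<phi> (u * r)" "\<phi> (u * r) < \<phi> r" using phi_mem[of "u * r"] phi_less_iff[of "u * r" r] ur r by auto
    have w: "0 < w" using pu pr by (simp add: w_def)
    have ws: "w powr s * \<phi> r = \<phi> (u * r)" using pu pr s by (simp add: w_def powr_powr)
    have w1: "w < 1" 
    proof (rule ccontr)
      assume "\<not> w < 1"
      then have "1 \<le> w powr s" using s by (simp add: ge_one_powr_ge_zero)
      then have "\<phi> r \<le> w powr s * \<phi> r" using pr by simp
      then show False using ws pu by simp
    qed
    have "w = u"
    proof (rule ccontr)
      assume "w \<noteq> u"
      then consider "w < u" | "u < w" by linarith
      then show False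
      proof cases
        case 1
        then obtain q where q: "q \<in> sigma_l ` G1" "w < q" "q < u" using dense w unfolding dense_pos_def by blast
        have "\<phi> (q * r) < \<phi> (u * r)" 
        proof -
          have *: "0 < q * r" "q * r < u * r" using q w r by auto
          then have "q * r < b" "u * r < b" using ur r by linarith+
          then show ?thesis using phi_less_iff[of "q * r" "u * r"] * ur by blast
        qed
        then have "q powr s * \<phi> r < w powr s * \<phi> r" using Q[OF q(1)] q u ws by simp
        then show False using powr_le[of q w] q w pr by simp
      next
        case 2
        then obtain q where q: "q \<in> sigma_l ` G1" "u < q" "q < w" using dense u unfolding dense_pos_def by blast
        have "q * r < 1 * r" using q w1 r by (intro mult_strict_right_mono) auto
        moreover have *: "u * r < q * r" "0 < q * r" using q r u by auto
        ultimately have "q * r < b" "u * r < b" using r by linarith+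
        then have "\<phi> (u * r) < \<phi> (q * r)" using phi_less_iff[of "u * r" "q * r"] * ur by blast
        then have "w powr s * \<phi> r < q powr s * \<phi> r" using Q[OF q(1)] q w1 ws by simp
        then show False using powr_le[of w q] q w u pr by simp
      qed
    qed
    then show ?thesis using ws by simp
  qed
  show ?thesis
  proof (rule that[OF r])
    show "0 < \<phi> r / r powr s" using pr r by simp
    show "\<phi> t = \<phi> r / r powr s * t powr s" if t: "0 < t" "t < r" for t
      using main[of "t / r"] t r by (simp add: powr_divide)
  qed
qed

text \<open>A bump supported in the region where \<open>\<phi>\<close> is a power function has an affine piece centred at
  a point other than \<open>0\<close>, and its conjugate is affine somewhere on the image of this piece.\<close>

lemma exponent_eq_1:
  assumes dense: "dense_pos (sigma_l ` G1)" and s: "0 < s"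
    and pw: "\<And>g. g \<in> G1 \<Longrightarrow> sigma_l (\<alpha> g) = sigma_l g powr s"
  shows "s = 1"
proof -
  obtain r C where r: "0 < r" "r < b" and C: "0 < C" and phi: "\<And>t. 0 < t \<Longrightarrow> t < r \<Longrightarrow> \<phi> t = C * t powr s"
    by (rule phi_power_near_0[OF dense s pw]) (assumption, rule that)
  obtain g a u v p where g: "g \<in> G1" "\<And>t. t \<notin> {0<..<r} \<Longrightarrow> g t = t"
    and a: "0 < a" "a < r" and u: "0 < u" "u < v" "v < r" and p: "0 < p" "p \<noteq> 1"
    and gt: "\<And>t. u < t \<Longrightarrow> t < v \<Longrightarrow> g t = a + p * (t - a)"
    using G1.affine_bump[of 0 r] r by auto
  have gr: "0 < g t \<and> g t < r" if "0 < t" "t < r" for t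
    using that g G1.eq_iff[OF g(1)] by (metis greaterThanLessThan_iff)
  have "\<phi> u < \<phi> v" using phi_less_iff u r by simp
  then obtain y1 y2 where y: "\<phi> u \<le> y1" "y1 < y2" "y2 \<le> \<phi> v" and aff: "affine_on {y1<..<y2} (\<alpha> g)"
    using G2.affine_somewhere[OF alpha_mem[OF g(1)], of "\<phi> u" "\<phi> v"] phi_mem[of u] phi_mem[of v] u r by auto
  obtain m n where mn: "\<And>y. y1 < y \<Longrightarrow> y < y2 \<Longrightarrow> \<alpha> g y = m * y + n"
    using aff unfolding affine_on_def by auto
  have "0 < y1" "y2 < b" using y phi_mem[of u] phi_mem[of v] u r by auto
  then have y': "0 < y1" "y1 < b" "0 < y2" "y2 < b" using y(2) by linarith+
  obtain u1 where u1: "0 < u1" "u1 < b" "\<phi> u1 = y1" by (rule phi_onto[OF y'(1,2)]) (rule that)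
  obtain v1 where v1: "0 < v1" "v1 < b" "\<phi> v1 = y2" by (rule phi_onto[OF y'(3,4)]) (rule that)
  note uv = u1 v1
  have uv': "u \<le> u1" "u1 < v1" "v1 \<le> v" 
    using phi_le_iff[of u u1] phi_less_iff[of u1 v1] phi_le_iff[of v1 v] y uv u r by auto
  show ?thesis
  proof (rule powr_conjugate_affine[of s C p "a * (1 - p)" u1 v1 m n])
    fix t assume t: "u1 < t" "t < v1"
    then have t0: "0 < t" "t < r" "u < t" "t < v" using uv uv' u by auto
    have gt': "g t = p * t + a * (1 - p)" using gt t0 by (simp add: algebra_simps)
    then show "0 < p * t + a * (1 - p)" using gr[OF t0(1,2)] by simp
    have "y1 < \<phi> t" "\<phi> t < y2" 
      using phi_less_iff[of u1 t] phi_less_iff[of t v1] t uv t0 r by auto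
    then have "\<alpha> g (\<phi> t) = m * \<phi> t + n" using mn by blast
    moreover have "\<alpha> g (\<phi> t) = \<phi> (g t)" using conj[OF g(1), of t] t0 r by simp
    ultimately have "\<phi> (g t) = m * \<phi> t + n" by simp
    then show "C * (p * t + a * (1 - p)) powr s = m * (C * t powr s) + n"
      using phi[OF t0(1,2)] phi[of "g t"] gr[OF t0(1,2)] gt' by simp
  qed (use s C p a uv uv' in auto)
qed

lemma sigma_l_alpha_dense:
  assumes "dense_pos (sigma_l ` G1)" "g \<in> G1" shows "sigma_l (\<alpha> g) = sigma_l g"
proof -
  obtain s where s: "0 < s" "\<And>g. g \<in> G1 \<Longrightarrow> sigma_l (\<alpha> g) = sigma_l g powr s"
    using sigma_l_alpha_powr by blast
  have "s = 1" using exponent_eq_1[OF assms(1) s] .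
  then show ?thesis using s(2) assms(2) G1.sigma_l(1)[OF assms(2)] by simp
qed

text \<open>A discrete group of slopes leaves no room for an exponent other than \<open>1\<close>: the exponent maps
  the least slope above \<open>1\<close> to a slope above \<open>1\<close>, and some slope is mapped to the least one. This is where
  it matters that both groups have the same slopes.\<close>

lemma sigma_l_alpha_same_image:
  assumes same: "sigma_l ` G1 = sigma_l ` G2" and g: "g \<in> G1" shows "sigma_l (\<alpha> g) = sigma_l g"
proof (cases "dense_pos (sigma_l ` G1)")
  case True then show ?thesis using sigma_l_alpha_dense g by blast
next
  case False
  obtain s where s: "0 < s" "\<And>g. g \<in> G1 \<Longrightarrow> sigma_l (\<alpha> g) = sigma_l g powr s"
    using sigma_l_alpha_powr by blast
  have "\<exists>z\<in>sigma_l ` G1. z \<ge> 1 \<and> (\<forall>q\<in>sigma_l ` G1. 1 < q \<longrightarrow> z \<le> q) \<and> sigma_l ` G1 = range (\<lambda>n::int. z powi n)"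
    using mult_subgroup_dense_or_cyclic[OF G1.sigma_l_image_subgroup] False by blast
  then obtain z where z: "z \<in> sigma_l ` G1" "1 \<le> z" "\<And>q. q \<in> sigma_l ` G1 \<Longrightarrow> 1 < q \<Longrightarrow> z \<le> q"
    and range: "sigma_l ` G1 = range (\<lambda>n::int. z powi n)" by blast
  show ?thesis
  proof (cases "z = 1")
    case True
    then have "sigma_l g = 1" using g range by auto
    then show ?thesis using sigma_l_alpha_one g by simp
  next
    case False
    then have z1: "1 < z" using z by simp
    obtain k where k: "k \<in> G1" "z = sigma_l k" using z by blast
    have "z powr s \<in> sigma_l ` G1" using same k s(2)[OF k(1)] alpha_mem[OF k(1)] by (metis imageI)
    moreover have "1 < z powr s" using z1 s(1) by (simp add: gr_one_powr)
    ultimately have "z powr 1 \<le> z powr s" using z(3) z1 by simp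
    then have "1 \<le> s" using powr_le_cancel_iff[OF z1] by blast
    obtain h where h: "h \<in> G1" "z = sigma_l (\<alpha> h)" using z(1) same image_alpha by blast
    have "1 < sigma_l h" using sigma_l_order[OF G1.id_mem h(1)] sigma_l_alpha_one[OF G1.id_mem G1.sigma_l_id] 
      G1.sigma_l_id h z1 by simp
    then have "z \<le> sigma_l h" using z(3) h by blast
    then have "z powr s \<le> sigma_l h powr s" using s(1) z1 by (intro powr_mono2) auto
    then have "z powr s \<le> z powr 1" using s(2)[OF h(1)] h z1 by simp
    then have "s \<le> 1" using powr_le_cancel_iff[OF z1] by blast
    with \<open>1 \<le> s\<close> have "s = 1" by simp
    then show ?thesis using s(2)[OF g] G1.sigma_l(1)[OF g] by simp
  qed
qed

end

section \<open>Both end points, and decreasing automorphisms\<close>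

definition reflect :: "real \<Rightarrow> (real \<Rightarrow> real) \<Rightarrow> real \<Rightarrow> real" where
  "reflect b g t = b - g (b - t)"

lemma reflect_reflect [simp]: "reflect b (reflect b g) = g"
  by (auto simp: reflect_def)

lemma reflect_comp: "reflect b (g \<circ> h) = reflect b g \<circ> reflect b h"
  by (auto simp: reflect_def)

lemma reflect_id [simp]: "reflect b id = id"
  by (auto simp: reflect_def)

context pl_moving_group begin

lemma reflect_inv: "g \<in> G \<Longrightarrow> fun_inv (reflect b g) = reflect b (fun_inv g)"
  by (rule inv_unique_comp) (simp_all add: reflect_comp[symmetric] inv_comp)

lemma reflected_group: "pl_moving_group b (reflect b ` G)"
proof unfold_locales
  show "id \<in> reflect b ` G" using id_mem reflect_id by (metis imageI)
next
  fix g h assume "g \<in> reflect b ` G" "h \<in> reflect b ` G"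
  then show "g \<circ> h \<in> reflect b ` G" using comp_mem by (auto simp: reflect_comp[symmetric])
next
  fix g assume "g \<in> reflect b ` G"
  then show "fun_inv g \<in> reflect b ` G" using inv_mem by (auto simp: reflect_inv)
next
  fix g assume "g \<in> reflect b ` G"
  then obtain k where k: "k \<in> G" "g = reflect b k" by blast
  have "reflect b (fun_inv k) \<circ> g = id" "g \<circ> reflect b (fun_inv k) = id"
    using inv_comp[OF k(1)] by (simp_all add: k(2) reflect_comp[symmetric])
  then show "bij g" by (rule o_bij)
next
  fix g assume "g \<in> reflect b ` G"
  then show "strict_mono g" by (auto simp: reflect_def strict_mono_def)
next
  fix g t assume g: "g \<in> reflect b ` G" and t: "t \<notin> {0<..<b}"
  obtain k where k: "k \<in> G" "g = reflect b k" using g by blast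
  have "k (b - t) = b - t" using t by (intro fixes_outside[OF k(1)]) auto
  then show "g t = t" by (simp add: k reflect_def)
next
  fix c s d :: real assume "0 \<le> c" "c < s" "s < d" "d \<le> b"
  then obtain g where g: "g \<in> G" "\<forall>t. t \<notin> {b - d<..<b - c} \<longrightarrow> g t = t" "g (b - s) \<noteq> b - s"
    using moving[of "b - d" "b - s" "b - c"] by auto
  have "\<forall>t. t \<notin> {c<..<d} \<longrightarrow> reflect b g t = t" using g(2) by (auto simp: reflect_def)
  moreover have "reflect b g s \<noteq> s" using g(3) by (auto simp: reflect_def)
  ultimately show "\<exists>g\<in>reflect b ` G. (\<forall>t. t \<notin> {c<..<d} \<longrightarrow> g t = t) \<and> g s \<noteq> s" using g(1) by blast
next
  show "0 < b" by (rule b_pos)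
next
  fix g assume "g \<in> reflect b ` G"
  then obtain k where k: "k \<in> G" "g = reflect b k" by blast
  obtain p e where p: "0 < p" "0 < e" "\<forall>t\<in>{b - e..b}. k t = b - p * (b - t)"
    using linear_at_right_end[OF k(1)] by blast
  have "\<forall>t\<in>{0..e}. g t = p * t" using p by (auto simp: k reflect_def)
  then show "\<exists>p>0. \<exists>e>0. \<forall>t\<in>{0..e}. g t = p * t" using p by blast
next
  fix g assume "g \<in> reflect b ` G"
  then obtain k where k: "k \<in> G" "g = reflect b k" by blast
  obtain p e where p: "0 < p" "0 < e" "\<forall>t\<in>{0..e}. k t = p * t"
    using linear_at_left_end[OF k(1)] by blast
  have "\<forall>t\<in>{b - e..b}. g t = b - p * (b - t)" using p by (auto simp: k reflect_def)
  then show "\<exists>p>0. \<exists>e>0. \<forall>t\<in>{b - e..b}. g t = b - p * (b - t)" using p by blast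
next
  fix g and c d :: real assume "g \<in> reflect b ` G" and cd: "0 \<le> c" "c < d" "d \<le> b"
  then obtain k where k: "k \<in> G" "g = reflect b k" by blast
  obtain u v where u: "b - d \<le> u" "u < v" "v \<le> b - c" "affine_on {u<..<v} k"
    using affine_somewhere[OF k(1), of "b - d" "b - c"] cd by auto
  then obtain m n where mn: "\<forall>t\<in>{u<..<v}. k t = m * t + n" by (auto simp: affine_on_def)
  have "\<forall>t\<in>{b - v<..<b - u}. g t = m * t + (b - m * b - n)"
    using mn by (auto simp: k reflect_def algebra_simps)
  then have "affine_on {b - v<..<b - u} g" unfolding affine_on_def by blast
  moreover have "c \<le> b - v" "b - v < b - u" "b - u \<le> d" using u by auto
  ultimately show "\<exists>u v. c \<le> u \<and> u < v \<and> v \<le> d \<and> affine_on {u<..<v} g" by blast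
next
  fix c d :: real assume cd: "0 \<le> c" "c < d" "d \<le> b"
  have cd': "0 \<le> b - d" "b - d < b - c" "b - c \<le> b" using cd by auto
  obtain g where g: "g \<in> G" "\<forall>t. t \<notin> {b - d<..<b - c} \<longrightarrow> g t = t" and
    "\<exists>a u v p. b - d < a \<and> a < b - c \<and> b - d < u \<and> u < v \<and> v < b - c \<and> 0 < p \<and> p \<noteq> 1 \<and>
          (\<forall>t\<in>{u<..<v}. g t = a + p * (t - a))"
    using affine_bump[OF cd'] by blast
  then obtain a u v p where a: "b - d < a" "a < b - c" "b - d < u" "u < v" "v < b - c" "0 < p" "p \<noteq> 1"
    "\<forall>t\<in>{u<..<v}. g t = a + p * (t - a)" by blast
  have "\<forall>t. t \<notin> {c<..<d} \<longrightarrow> reflect b g t = t" using g(2) by (auto simp: reflect_def)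
  moreover have "\<forall>t\<in>{b - v<..<b - u}. reflect b g t = (b - a) + p * (t - (b - a))"
  proof
    fix t assume "t \<in> {b - v<..<b - u}"
    then have "b - t \<in> {u<..<v}" by auto
    from a(8)[rule_format, OF this] show "reflect b g t = (b - a) + p * (t - (b - a))"
      by (simp add: reflect_def algebra_simps)
  qed
  moreover have "c < b - a" "b - a < d" "c < b - v" "b - v < b - u" "b - u < d" using a by auto
  ultimately show "\<exists>g\<in>reflect b ` G. (\<forall>t. t \<notin> {c<..<d} \<longrightarrow> g t = t) \<and>
        (\<exists>a u v p. c < a \<and> a < d \<and> c < u \<and> u < v \<and> v < d \<and> 0 < p \<and> p \<noteq> 1 \<and>
          (\<forall>t\<in>{u<..<v}. g t = a + p * (t - a)))"
    using g(1) a(6,7) by blast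
qed

lemma sigma_r_reflect:
  assumes g: "g \<in> G" shows "sigma_l (reflect b g) = sigma_r b g"
proof -
  obtain p e where p: "0 < p" "0 < e" "\<forall>t\<in>{b - e..b}. g t = b - p * (b - t)"
    using linear_at_right_end[OF g] by blast
  have "sigma_l (reflect b g) = p"
    by (rule sigma_l_eqI[OF p(2)]) (use p in \<open>auto simp: reflect_def\<close>)
  moreover have "sigma_r b g = p"
  proof -
    have "((\<lambda>t. b - p * (b - t)) has_vector_derivative p) (at b within {b - e..b})"
      by (auto intro!: derivative_eq_intros simp flip: has_real_derivative_iff_has_vector_derivative)
    then have "(g has_vector_derivative p) (at b within {b - e..b})"
      by (rule has_vector_derivative_transform[rotated 2]) (use p in auto)
    then have "(g has_vector_derivative p) (at_left b)"
      using p(2) by (simp add: at_within_Icc_at_left)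
    then show ?thesis unfolding sigma_r_def by (intro vector_derivative_within) auto
  qed
  ultimately show ?thesis by simp
qed

lemma sigma_r_image: "sigma_l ` reflect b ` G = sigma_r b ` G"
  unfolding image_image by (intro image_cong refl sigma_r_reflect)

lemma increasing_aut_preserves_slopes:
  assumes a: "\<alpha> \<in> aut G" and bij: "bij_betw \<phi> {0<..<b} {0<..<b}" and mono: "strict_mono_on {0<..<b} \<phi>"
    and conj: "\<And>g t. g \<in> G \<Longrightarrow> t \<in> {0<..<b} \<Longrightarrow> \<alpha> g (\<phi> t) = \<phi> (g t)"
    and g: "g \<in> G"
  shows "sigma_l (\<alpha> g) = sigma_l g \<and> sigma_r b (\<alpha> g) = sigma_r b g"
proof
  interpret C: conjugate_pl_groups b G G \<alpha> \<phi>
    by unfold_locales (use bij mono conj autD(5)[OF a] in auto)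
  show "sigma_l (\<alpha> g) = sigma_l g" by (rule C.sigma_l_alpha_same_image[OF refl g])
next
  define \<alpha>' where "\<alpha>' k = reflect b (\<alpha> (reflect b k))" for k
  define \<phi>' where "\<phi>' t = b - \<phi> (b - t)" for t
  interpret R: pl_moving_group b "reflect b ` G" by (rule reflected_group)
  have "bij_betw \<phi>' {0<..<b} {0<..<b}"
  proof -
    have m: "bij_betw (\<lambda>t. b - t) {0<..<b} {0<..<b}"
      by (rule bij_betwI[of _ _ _ "\<lambda>t. b - t"]) auto
    have "bij_betw ((\<lambda>t. b - t) \<circ> (\<phi> \<circ> (\<lambda>t. b - t))) {0<..<b} {0<..<b}"
      by (intro bij_betw_trans[OF _ m] bij_betw_trans[OF m bij])
    then show ?thesis by (simp add: \<phi>'_def[abs_def] comp_def)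
  qed
  moreover have "strict_mono_on {0<..<b} \<phi>'"
  proof (rule strict_mono_onI)
    fix r s assume "r \<in> {0<..<b}" "s \<in> {0<..<b}" "r < s"
    then show "\<phi>' r < \<phi>' s" using strict_mono_onD[OF mono, of "b - s" "b - r"] by (simp add: \<phi>'_def)
  qed
  moreover have "\<alpha>' ` reflect b ` G = reflect b ` G"
  proof -
    have "\<alpha>' ` reflect b ` G = reflect b ` \<alpha> ` G" by (simp add: \<alpha>'_def image_image)
    then show ?thesis using autD(5)[OF a] by simp
  qed
  moreover have "\<alpha>' k (\<phi>' t) = \<phi>' (k t)" if kG: "k \<in> reflect b ` G" and tI: "t \<in> {0<..<b}" for k t
  proof -
    obtain h where h: "h \<in> G" "k = reflect b h" using kG by blast
    then show ?thesis using conj[OF h(1), of "b - t"] tI by (simp add: \<alpha>'_def \<phi>'_def reflect_def)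
  qed
  ultimately interpret C: conjugate_pl_groups b "reflect b ` G" "reflect b ` G" \<alpha>' \<phi>'
    by unfold_locales auto
  have "sigma_l (\<alpha>' (reflect b g)) = sigma_l (reflect b g)"
    by (rule C.sigma_l_alpha_same_image[OF refl]) (use g in auto)
  then show "sigma_r b (\<alpha> g) = sigma_r b g"
    using sigma_r_reflect g autD(3)[OF a g] by (simp add: \<alpha>'_def)
qed

text \<open>Reflecting the target turns \<open>\<alpha>\<close> into an increasing conjugation from \<open>G\<close> to its mirror image,
  reflecting the source into one from the mirror image to \<open>G\<close>. The first one alone already shows that
  the two groups of slopes agree, which is what the second one needs.\<close>

lemma decreasing_aut_swaps_slopes:
  assumes a: "\<alpha> \<in> aut G" and bij: "bij_betw \<phi> {0<..<b} {0<..<b}" and anti: "strict_antimono_on {0<..<b} \<phi>"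
    and conj: "\<And>g t. g \<in> G \<Longrightarrow> t \<in> {0<..<b} \<Longrightarrow> \<alpha> g (\<phi> t) = \<phi> (g t)"
    and sigma: "dense_pos (sigma_l ` G) \<or> sigma_l ` G = sigma_r b ` G"
    and g: "g \<in> G"
  shows "sigma_r b (\<alpha> g) = sigma_l g \<and> sigma_l (\<alpha> g) = sigma_r b g"
proof -
  interpret R: pl_moving_group b "reflect b ` G" by (rule reflected_group)
  have m: "bij_betw (\<lambda>t. b - t) {0<..<b} {0<..<b}"
    by (rule bij_betwI[of _ _ _ "\<lambda>t. b - t"]) auto
  have anti': "\<phi> s < \<phi> r" if "r \<in> {0<..<b}" "s \<in> {0<..<b}" "r < s" for r s
    using anti that unfolding monotone_on_def by blast
  \<comment> \<open>from \<open>G\<close> to its mirror image\<close>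
  define \<alpha>1 where "\<alpha>1 k = reflect b (\<alpha> k)" for k
  define \<phi>1 where "\<phi>1 t = b - \<phi> t" for t
  interpret C1: conjugate_pl_groups b G "reflect b ` G" \<alpha>1 \<phi>1
  proof unfold_locales
    show "bij_betw \<phi>1 {0<..<b} {0<..<b}"
      using bij_betw_trans[OF bij m] by (simp add: \<phi>1_def[abs_def] comp_def)
    show "strict_mono_on {0<..<b} \<phi>1" by (rule strict_mono_onI) (use anti' in \<open>simp add: \<phi>1_def\<close>)
    show "\<alpha>1 ` G = reflect b ` G"
    proof -
      have "\<alpha>1 ` G = reflect b ` \<alpha> ` G" by (simp add: \<alpha>1_def image_image)
      then show ?thesis using autD(5)[OF a] by simp
    qed
    show "\<alpha>1 k (\<phi>1 t) = \<phi>1 (k t)" if "k \<in> G" "t \<in> {0<..<b}" for k t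
      using conj[OF that] by (simp add: \<alpha>1_def \<phi>1_def reflect_def)
  qed
  \<comment> \<open>from the mirror image of \<open>G\<close> back to \<open>G\<close>\<close>
  define \<alpha>2 where "\<alpha>2 k = \<alpha> (reflect b k)" for k
  define \<phi>2 where "\<phi>2 t = \<phi> (b - t)" for t
  interpret C2: conjugate_pl_groups b "reflect b ` G" G \<alpha>2 \<phi>2
  proof unfold_locales
    show "bij_betw \<phi>2 {0<..<b} {0<..<b}"
      using bij_betw_trans[OF m bij] by (simp add: \<phi>2_def[abs_def] comp_def)
    show "strict_mono_on {0<..<b} \<phi>2" by (rule strict_mono_onI) (use anti' in \<open>simp add: \<phi>2_def\<close>)
    show "\<alpha>2 ` reflect b ` G = G"
      using autD(5)[OF a] by (simp add: \<alpha>2_def image_image)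
    show "\<alpha>2 k (\<phi>2 t) = \<phi>2 (k t)" if kG: "k \<in> reflect b ` G" and tI: "t \<in> {0<..<b}" for k t
    proof -
      obtain h where h: "h \<in> G" "k = reflect b h" using kG by blast
      then show ?thesis using conj[OF h(1), of "b - t"] tI by (simp add: \<alpha>2_def \<phi>2_def reflect_def)
    qed
  qed
  have r1: "sigma_l (\<alpha>1 k) = sigma_r b (\<alpha> k)" if "k \<in> G" for k
    using sigma_r_reflect[OF autD(3)[OF a that]] by (simp add: \<alpha>1_def)
  have 1: "sigma_r b (\<alpha> k) = sigma_l k" if k: "k \<in> G" for k
    using sigma
  proof
    assume "dense_pos (sigma_l ` G)"
    from C1.sigma_l_alpha_dense[OF this k] show ?thesis using r1[OF k] by simp
  next
    assume "sigma_l ` G = sigma_r b ` G"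
    then have "sigma_l ` G = sigma_l ` reflect b ` G" by (simp only: sigma_r_image)
    from C1.sigma_l_alpha_same_image[OF this k] show ?thesis using r1[OF k] by simp
  qed
  have "sigma_r b ` \<alpha> ` G = sigma_l ` G" unfolding image_image using 1 by (intro image_cong) auto
  then have "sigma_l ` reflect b ` G = sigma_l ` G" using autD(5)[OF a] sigma_r_image by simp
  then have "sigma_l (\<alpha>2 (reflect b g)) = sigma_l (reflect b g)"
    by (rule C2.sigma_l_alpha_same_image) (use g in auto)
  then have "sigma_l (\<alpha> g) = sigma_r b g" using sigma_r_reflect[OF g] by (simp add: \<alpha>2_def)
  then show ?thesis using 1[OF g] by simp
qed

text \<open>The chain rule at \<open>0\<close> for \<open>\<alpha> g \<circ> \<theta> = \<theta> \<circ> g\<close>, carried out with difference quotients because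
  \<open>\<theta>\<close> is differentiable at the end point only.\<close>

lemma differentiable_conjugation_swaps_left_slope:
  assumes a: "\<alpha> \<in> aut G" 
    and conj: "\<And>g t. g \<in> G \<Longrightarrow> t \<in> {0<..<b} \<Longrightarrow> \<alpha> g (\<theta> t) = \<theta> (g t)"
    and th: "\<theta> 0 = b" "\<And>t. t \<in> {0<..<b} \<Longrightarrow> \<theta> t \<in> {0<..<b}"
    and d: "d \<noteq> 0" "(\<theta> has_real_derivative d) (at 0 within {0..b})"
    and g: "g \<in> G"
  shows "sigma_r b (\<alpha> g) = sigma_l g"
proof -
  define p where "p = sigma_l g"
  define q where "q = sigma_r b (\<alpha> g)"
  have p: "0 < p" using sigma_l(1)[OF g] by (simp add: p_def)
  obtain e where e: "0 < e" "\<forall>t\<in>{0..e}. g t = p * t" using sigma_l(2)[OF g] unfolding p_def by blast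
  have ag: "\<alpha> g \<in> G" using autD(3)[OF a g] .
  obtain e' where e': "0 < e'" "\<forall>t\<in>{0..e'}. reflect b (\<alpha> g) t = q * t"
    using pl_moving_group.sigma_l(2)[OF reflected_group imageI[OF ag]] sigma_r_reflect[OF ag] unfolding q_def by auto
  have D: "((\<lambda>t. (\<theta> t - b) / t) \<longlongrightarrow> d) (at_right 0)"
    using d(2) b_pos th(1) by (simp add: at_within_Icc_at_right has_field_derivative_iff)
  have "filterlim (\<lambda>t. p * t) (at_right 0) (at_right 0)"
    using p by (intro filterlim_times_pos[OF filterlim_ident]) auto
  then have Dp: "((\<lambda>t. (\<theta> (p * t) - b) / (p * t)) \<longlongrightarrow> d) (at_right 0)"
    by (rule filterlim_compose[OF D])
  have "(\<theta> \<longlongrightarrow> \<theta> 0) (at 0 within {0..b})"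
    using DERIV_continuous[OF d(2)] by (simp add: continuous_within)
  then have "(\<theta> \<longlongrightarrow> b) (at_right 0)" using b_pos th(1) by (simp add: at_within_Icc_at_right)
  then have "\<forall>\<^sub>F t in at_right 0. b - e' < \<theta> t" by (rule order_tendstoD) (use e' in simp)
  moreover have "\<forall>\<^sub>F t in at_right 0. t < min e b"
    using e b_pos by (intro order_tendstoD[OF tendsto_ident_at]) auto
  moreover have "\<forall>\<^sub>F t :: real in at_right 0. 0 < t" by (simp add: eventually_at_right_less)
  ultimately have "\<forall>\<^sub>F t in at_right 0. (\<theta> (p * t) - b) / (p * t) = q / p * ((\<theta> t - b) / t)"
  proof eventually_elim
    case (elim t)
    have gt: "g t = p * t" using elim e by simp
    have "\<theta> t < b" using th(2)[of t] elim by simp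
    then have "\<alpha> g (\<theta> t) = b - q * (b - \<theta> t)" using e'(2)[rule_format, of "b - \<theta> t"] elim by (simp add: reflect_def)
    moreover have "\<alpha> g (\<theta> t) = \<theta> (p * t)" using conj[OF g, of t] elim gt by simp
    ultimately have "\<theta> (p * t) - b = q * (\<theta> t - b)" by (simp add: algebra_simps)
    then show ?case using p elim by simp
  qed
  then have "((\<lambda>t. q / p * ((\<theta> t - b) / t)) \<longlongrightarrow> d) (at_right 0)"
    by (rule Lim_transform_eventually[OF Dp])
  moreover have "((\<lambda>t. q / p * ((\<theta> t - b) / t)) \<longlongrightarrow> q / p * d) (at_right 0)"
    by (intro tendsto_intros D)
  ultimately have "d = q / p * d" by (rule tendsto_unique[OF trivial_limit_at_right_real])
  then have "p * d = q * d" using p by (simp add: nonzero_eq_divide_eq mult.commute)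
  then show ?thesis using d(1) by (simp add: p_def q_def)
qed

text \<open>If \<open>\<phi> t = \<theta> t'\<close> with \<open>t' \<noteq> t\<close>, an element that moves \<open>t\<close> but fixes \<open>t'\<close> gives a
  contradiction.\<close>

lemma conjugation_unique:
  assumes a: "\<alpha> \<in> aut G" 
    and conj: "\<And>g t. g \<in> G \<Longrightarrow> t \<in> {0<..<b} \<Longrightarrow> \<alpha> g (\<phi> t) = \<phi> (g t)"
    and conj': "\<And>g t. g \<in> G \<Longrightarrow> t \<in> {0<..<b} \<Longrightarrow> \<alpha> g (\<theta> t) = \<theta> (g t)"
    and phi: "inj_on \<phi> {0<..<b}" "\<phi> ` {0<..<b} \<subseteq> \<theta> ` {0<..<b}"
    and t: "t \<in> {0<..<b}"
  shows "\<phi> t = \<theta> t"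
proof (rule ccontr)
  assume ne: "\<phi> t \<noteq> \<theta> t"
  obtain t' where t': "t' \<in> {0<..<b}" "\<phi> t = \<theta> t'" using phi(2) t by blast
  have tt: "t' \<noteq> t" using ne t' by auto
  obtain g where g: "g \<in> G" "g t \<noteq> t" "g t' = t'"
  proof (cases "t' < t")
    case True
    then show ?thesis using moving[of t' t b] t t' that by auto
  next
    case False
    then show ?thesis using moving[of 0 t t'] t t' tt that by auto
  qed
  have "\<phi> (g t) = \<phi> t" using conj[OF g(1) t] conj'[OF g(1) t'(1)] t' g(3) by simp
  moreover have "g t \<in> {0<..<b}" using preserves_interval[OF g(1)] t by blast
  ultimately have "g t = t" using phi(1) t by (simp add: inj_on_eq_iff)
  then show False using g by simp
qed

end

lemma continuous_on_antimono_image: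
  fixes f :: "real \<Rightarrow> real"
  assumes "open (f ` S)" "strict_antimono_on S f" shows "continuous_on S f"
proof -
  have "continuous_on S (\<lambda>t. - f t)"
  proof (rule continuous_onI_mono)
    have "(\<lambda>t. - f t) ` S = uminus ` (f ` S)" by auto
    then show "open ((\<lambda>t. - f t) ` S)" using open_negations[OF assms(1)] by simp
    show "- f x \<le> - f y" if "x \<in> S" "y \<in> S" "x \<le> y" for x y
      using assms(2) that unfolding monotone_on_def by (cases "x = y") (auto simp: less_le)
  qed
  from continuous_on_minus[OF this] show ?thesis by simp
qed

lemma strict_antimono_bij_homeomorphism:
  fixes \<phi> :: "real \<Rightarrow> real"
  assumes bij: "bij_betw \<phi> {0<..<b} {0<..<b}" and anti: "strict_antimono_on {0<..<b} \<phi>"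
  shows "homeomorphism {0<..<b} {0<..<b} \<phi> (inv_into {0<..<b} \<phi>)"
proof -
  let ?I = "{0<..<b}" and ?\<psi> = "inv_into {0<..<b} \<phi>"
  have bij': "bij_betw ?\<psi> ?I ?I" using bij by (rule bij_betw_inv_into)
  have im: "\<phi> ` ?I = ?I" "?\<psi> ` ?I = ?I" using bij bij' by (auto simp: bij_betw_def)
  have r: "\<phi> (?\<psi> y) = y" if "y \<in> ?I" for y using that im(1) by (metis f_inv_into_f)
  have l: "?\<psi> (\<phi> x) = x" if "x \<in> ?I" for x using that bij by (simp add: bij_betw_def)
  have mem: "?\<psi> y \<in> ?I" if "y \<in> ?I" for y using that im(2) by blast
  have anti': "strict_antimono_on ?I ?\<psi>"
  proof (rule monotone_onI)
    fix x y assume xy: "x \<in> ?I" "y \<in> ?I" "x < y"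
    show "?\<psi> y < ?\<psi> x"
    proof (rule ccontr)
      assume "\<not> ?\<psi> y < ?\<psi> x"
      then consider "?\<psi> x = ?\<psi> y" | "?\<psi> x < ?\<psi> y" by linarith
      then have "\<phi> (?\<psi> y) \<le> \<phi> (?\<psi> x)"
        using anti mem[OF xy(1)] mem[OF xy(2)] unfolding monotone_on_def by cases (auto intro: less_imp_le)
      then show False using r xy by simp
    qed
  qed
  show ?thesis
    by (rule homeomorphismI)
      (use continuous_on_antimono_image[OF _ anti] continuous_on_antimono_image[OF _ anti'] im l r in auto)
qed

context pl_moving_group begin

lemma conj_on_iff:
  assumes "bij_betw \<phi> {0<..<b} {0<..<b}"
  shows "conj_on {0<..<b} \<phi> G \<alpha> \<longleftrightarrow> (\<forall>g\<in>G. \<forall>t\<in>{0<..<b}. \<alpha> g (\<phi> t) = \<phi> (g t))"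
proof
  let ?I = "{0<..<b}"
  have im: "\<phi> ` ?I = ?I" and inj: "inj_on \<phi> ?I" using assms by (auto simp: bij_betw_def)
  show "conj_on ?I \<phi> G \<alpha>" if *: "\<forall>g\<in>G. \<forall>t\<in>?I. \<alpha> g (\<phi> t) = \<phi> (g t)"
    unfolding conj_on_def
  proof (intro ballI)
    fix g t assume g: "g \<in> G" and t: "t \<in> ?I"
    have "inv_into ?I \<phi> t \<in> ?I" "\<phi> (inv_into ?I \<phi> t) = t"
      using t im by (metis inv_into_into, metis f_inv_into_f)
    then show "\<alpha> g t = \<phi> (g (inv_into ?I \<phi> t))" using * g by metis
  qed
  show "\<forall>g\<in>G. \<forall>t\<in>?I. \<alpha> g (\<phi> t) = \<phi> (g t)" if *: "conj_on ?I \<phi> G \<alpha>"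
  proof (intro ballI)
    fix g t assume g: "g \<in> G" and t: "t \<in> ?I"
    have "\<phi> t \<in> ?I" using im t by blast
    then have "\<alpha> g (\<phi> t) = \<phi> (g (inv_into ?I \<phi> (\<phi> t)))" using * g unfolding conj_on_def by blast
    then show "\<alpha> g (\<phi> t) = \<phi> (g t)" using inv_into_f_f[OF inj t] by simp
  qed
qed

lemma cyclic_if_not_dense:
  assumes "\<not> dense_pos (sigma_l ` G)"
  shows "cyclic_group (pos_real_group\<lparr>carrier := sigma_l ` G\<rparr>)"
proof -
  define Q where "Q = sigma_l ` G"
  define H where "H = pos_real_group\<lparr>carrier := Q\<rparr>"
  note sub = sigma_l_image_subgroup[folded Q_def]
  have H: "carrier H = Q" "monoid.mult H = (*)" "monoid.one H = 1"
    by (simp_all add: H_def pos_real_group_def)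
  have inv: "inverse x * x = 1" if "x \<in> Q" for x using sub(1) that by auto
  have "\<exists>y\<in>Q. y * x = 1" if "x \<in> Q" for x using sub(4) inv that by blast
  then interpret group H
    by (intro groupI) (use sub in \<open>auto simp: H mult.assoc\<close>)
  obtain z where z: "z \<in> Q" "Q = range (\<lambda>n::int. z powi n)"
    using mult_subgroup_dense_or_cyclic[OF sub] assms unfolding Q_def by blast
  have z0: "0 < z" using sub(1) z(1) by auto
  have pow: "z [^]\<^bsub>H\<^esub> (n::nat) = z ^ n" for n
    by (induction n) (simp_all add: H nat_pow_def mult.commute)
  have inv_eq: "m_inv H x = inverse x" if "x \<in> Q" for x
    using that sub inv by (intro inv_equality) (auto simp: H)
  have "z [^]\<^bsub>H\<^esub> (n::int) = z powi n" for n
  proof (cases "n < 0")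
    case False
    then have "z [^]\<^bsub>H\<^esub> n = z ^ nat n" by (simp only: int_pow_def2 pow if_False)
    then show ?thesis using False by (simp add: power_int_def)
  next
    case True
    have mem: "z ^ nat (- n) \<in> Q" using nat_pow_closed[of z] pow z(1) by (simp add: H)
    have "z [^]\<^bsub>H\<^esub> n = m_inv H (z ^ nat (- n))" using True by (simp only: int_pow_def2 pow if_True)
    also have "\<dots> = inverse (z ^ nat (- n))" by (rule inv_eq[OF mem])
    also have "\<dots> = z powi n" using True by (simp add: power_int_def power_inverse)
    finally show ?thesis .
  qed
  then have "carrier H = range (\<lambda>n::int. z [^]\<^bsub>H\<^esub> n)" using z(2) by (simp add: H)
  then have "cyclic_group H" using cyclic_group z(1) H(1) by metis
  then show ?thesis by (simp add: H_def Q_def)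
qed

text \<open>If \<open>\<psi>\<close> is not preserved, the inducing bijection is decreasing, the slopes at the left end point are
  not dense and the groups of slopes at the two end points are different. A decreasing automorphism
  that is differentiable at the left end point would make the two groups equal.\<close>

theorem psi_not_preserved_imp_exceptional:
  assumes a: "\<alpha> \<in> aut G" and g0: "g0 \<in> G" "psi b (\<alpha> g0) \<noteq> psi b g0"
  shows "cyclic_group (pos_real_group\<lparr>carrier := sigma_l ` G\<rparr>) \<and>
     (\<exists>\<alpha>. decreasing_aut {0..b} G \<alpha>) \<and>
     \<not> (\<exists>\<alpha> \<theta>. decreasing_aut {0..b} G \<alpha> \<and> induces {0..b} \<theta> G \<alpha> \<and> diff_at_ends 0 b \<theta>)"
proof -
  let ?I = "{0<..<b}"
  obtain \<phi> where bij: "bij_betw \<phi> ?I ?I" and mono: "strict_mono_on ?I \<phi> \<or> strict_antimono_on ?I \<phi>"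
    and conj: "\<And>g t. g \<in> G \<Longrightarrow> t \<in> ?I \<Longrightarrow> \<alpha> g (\<phi> t) = \<phi> (g t)"
    by (rule automorphism_spatial[OF a]) (rule that)
  have anti: "strict_antimono_on ?I \<phi>"
    using mono increasing_aut_preserves_slopes[OF a bij _ conj g0(1)] g0(2) by (auto simp: psi_def)
  have no: "\<not> (dense_pos (sigma_l ` G) \<or> sigma_l ` G = sigma_r b ` G)"
    using decreasing_aut_swaps_slopes[OF a bij anti conj _ g0(1)] g0(2) by (auto simp: psi_def mult.commute)
  have "decreasing_aut {0..b} G \<alpha>"
    unfolding decreasing_aut_def induces_int_def interior_atLeastAtMost_real
    using a strict_antimono_bij_homeomorphism[OF bij anti] conj_on_iff[OF bij] conj anti by blast
  moreover have "cyclic_group (pos_real_group\<lparr>carrier := sigma_l ` G\<rparr>)"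
    using cyclic_if_not_dense no by blast
  moreover have False if dec: "decreasing_aut {0..b} G \<beta>" and ind: "induces {0..b} \<theta> G \<beta>" and diff: "diff_at_ends 0 b \<theta>" for \<beta> \<theta>
  proof -
    have b: "\<beta> \<in> aut G" using dec by (simp add: decreasing_aut_def)
    obtain \<eta> \<eta>' where eta: "homeomorphism ?I ?I \<eta> \<eta>'" "conj_on ?I \<eta> G \<beta>" "strict_antimono_on ?I \<eta>"
      using dec unfolding decreasing_aut_def induces_int_def interior_atLeastAtMost_real
      by (elim conjE exE) (rule that)
    obtain \<theta>' \<theta>'' where theta: "homeomorphism {0..b} {0..b} \<theta> \<theta>'" "homeomorphism ?I ?I \<theta> \<theta>''" "conj_on ?I \<theta> G \<beta>"
      using ind unfolding induces_def induces_int_def interior_atLeastAtMost_real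
      by (elim conjE exE) (rule that)
    have bij_hom: "bij_betw f S S" if "homeomorphism S S f f'" for f f' and S :: "real set"
      using that by (intro bij_betwI[of f S S f']) (auto simp: homeomorphism_def)
    have bijs: "bij_betw \<eta> ?I ?I" "bij_betw \<theta> ?I ?I" "bij_betw \<theta> {0..b} {0..b}" 
      using bij_hom eta(1) theta(1,2) by blast+
    have ce: "\<beta> g (\<eta> t) = \<eta> (g t)" if "g \<in> G" "t \<in> ?I" for g t
      by (rule bspec[OF bspec[OF conj_on_iff[OF bijs(1), THEN iffD1, OF eta(2)] that(1)] that(2)])
    have ct: "\<beta> g (\<theta> t) = \<theta> (g t)" if "g \<in> G" "t \<in> ?I" for g t
      by (rule bspec[OF bspec[OF conj_on_iff[OF bijs(2), THEN iffD1, OF theta(3)] that(1)] that(2)])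
    have inj: "inj_on \<eta> ?I" and im: "\<eta> ` ?I = ?I" "\<theta> ` ?I = ?I" using bijs by (auto simp: bij_betw_def)
    have eq: "\<eta> t = \<theta> t" if "t \<in> ?I" for t
      by (rule conjugation_unique[OF b ce ct inj _ that]) (simp_all add: im)
    obtain d where d: "d \<noteq> 0" "(\<theta> has_real_derivative d) (at 0 within {0..b})"
      using diff unfolding diff_at_ends_def by blast
    have "\<theta> 0 = b"
    proof -
      have lim: "(\<theta> \<longlongrightarrow> \<theta> 0) (at_right 0)"
        using DERIV_continuous[OF d(2)] b_pos by (simp add: continuous_within at_within_Icc_at_right)
      have m: "b / 2 \<in> ?I" using b_pos by simp
      have "\<forall>\<^sub>F t in at_right 0. t < b / 2"
        using b_pos by (intro order_tendstoD[OF tendsto_ident_at]) auto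
      moreover have "\<forall>\<^sub>F t :: real in at_right 0. 0 < t" by (simp add: eventually_at_right_less)
      ultimately have "\<forall>\<^sub>F t in at_right 0. \<theta> (b / 2) \<le> \<theta> t"
      proof eventually_elim
        case (elim t)
        then have t: "t \<in> ?I" by simp
        have "\<eta> (b / 2) < \<eta> t" using eta(3) t m elim unfolding monotone_on_def by blast
        then show ?case using eq[OF t] eq[OF m] by simp
      qed
      then have "\<theta> (b / 2) \<le> \<theta> 0" by (intro tendsto_lowerbound[OF lim]) auto
      moreover have "\<theta> (b / 2) \<in> ?I" using im(2) m by blast
      ultimately have "0 < \<theta> 0" by simp
      have z: "0 \<in> {0..b}" using b_pos by simp
      have t0: "\<theta> 0 \<in> {0..b}" using bijs(3) z by (auto simp: bij_betw_def)
      show ?thesis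
      proof (rule ccontr)
        assume "\<theta> 0 \<noteq> b"
        then have "\<theta> 0 \<in> ?I" using t0 \<open>0 < \<theta> 0\<close> by auto
        then obtain t where t: "t \<in> ?I" "\<theta> t = \<theta> 0" using im(2) by (metis imageE)
        have "inj_on \<theta> {0..b}" using bijs(3) by (simp add: bij_betw_def)
        then have "t = 0" using t z by (auto dest: inj_onD)
        then show False using t by simp
      qed
    qed
    then have swap: "sigma_r b (\<beta> g) = sigma_l g" if "g \<in> G" for g
      using im(2) by (intro differentiable_conjugation_swaps_left_slope[OF b ct _ _ d that]) auto
    have "sigma_r b ` \<beta> ` G = sigma_l ` G" unfolding image_image using swap by (intro image_cong) auto
    then have "sigma_l ` G = sigma_r b ` G" using autD(5)[OF b] by simp
    then show False using no by blast
  qed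
  ultimately show ?thesis by blast
qed

end

section \<open>Local structure of piecewise linear homeomorphisms\<close>

lemma pos_real_group_inverse:
  assumes "x > 0" shows "m_inv pos_real_group x = inverse x"
proof -
  have "group pos_real_group"
  proof (rule groupI)
    fix x assume "x \<in> carrier pos_real_group"
    then show "\<exists>y\<in>carrier pos_real_group. y \<otimes>\<^bsub>pos_real_group\<^esub> x = \<one>\<^bsub>pos_real_group\<^esub>"
      by (intro bexI[of _ "inverse x"]) (auto simp: pos_real_group_def)
  qed (auto simp: pos_real_group_def)
  then show ?thesis using assms by (intro group.inv_equality) (auto simp: pos_real_group_def)
qed

lemma add_real_group_inverse: "m_inv add_real_group x = - x"
proof -
  have "group add_real_group"
  proof (rule groupI)
    fix x assume "x \<in> carrier add_real_group"
    show "\<exists>y\<in>carrier add_real_group. y \<otimes>\<^bsub>add_real_group\<^esub> x = \<one>\<^bsub>add_real_group\<^esub>"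
      by (intro bexI[of _ "- x"]) (auto simp: add_real_group_def)
  qed (auto simp: add_real_group_def)
  then show ?thesis by (intro group.inv_equality) (auto simp: add_real_group_def)
qed

lemma affine_right_derivative:
  fixes f :: "real \<Rightarrow> real"
  assumes "0 < e" "\<forall>s\<in>{t..t + e}. f s = f t + m * (s - t)"
  shows "(f has_real_derivative m) (at_right t)"
proof -
  have "((\<lambda>s. f t + m * (s - t)) has_real_derivative m) (at t within {t..t + e})"
    by (auto intro!: derivative_eq_intros)
  then have "(f has_real_derivative m) (at t within {t..t + e})"
    by (rule has_field_derivative_transform_within[OF _ zero_less_one])
      (use assms(1) bspec[OF assms(2), symmetric] in \<open>simp_all only: atLeastAtMost_iff\<close>, simp)
  then show ?thesis using assms(1) by (simp add: at_within_Icc_at_right)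
qed

lemma affine_left_derivative:
  fixes f :: "real \<Rightarrow> real"
  assumes "0 < e" "\<forall>s\<in>{t - e..t}. f s = f t + m * (s - t)"
  shows "(f has_real_derivative m) (at_left t)"
proof -
  have "((\<lambda>s. f t + m * (s - t)) has_real_derivative m) (at t within {t - e..t})"
    by (auto intro!: derivative_eq_intros)
  then have "(f has_real_derivative m) (at t within {t - e..t})"
    by (rule has_field_derivative_transform_within[OF _ zero_less_one])
      (use assms(1) bspec[OF assms(2), symmetric] in \<open>simp_all only: atLeastAtMost_iff\<close>, simp)
  then show ?thesis using assms(1) by (simp add: at_within_Icc_at_left)
qed

lemma right_derivative_unique:
  fixes f :: "real \<Rightarrow> real"
  assumes "(f has_real_derivative d) (at_right t)" "(f has_real_derivative e) (at_right t)"
  shows "d = e"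
  using assms unfolding has_field_derivative_iff by (rule tendsto_unique[OF trivial_limit_at_right_real])

lemma left_derivative_unique:
  fixes f :: "real \<Rightarrow> real"
  assumes "(f has_real_derivative d) (at_left t)" "(f has_real_derivative e) (at_left t)"
  shows "d = e"
  using assms unfolding has_field_derivative_iff by (rule tendsto_unique[OF trivial_limit_at_left_real])

lemma derivative_from_sides:
  fixes f :: "real \<Rightarrow> real"
  assumes "(f has_real_derivative d) (at_left t)" "(f has_real_derivative d) (at_right t)"
  shows "(f has_real_derivative d) (at t)"
  using assms unfolding has_field_derivative_iff by (rule filterlim_split_at)

lemma PL_oD:
  assumes "f \<in> PL_o"
  shows "strict_mono f" "continuous_on UNIV f" "bij f"
  using assms unfolding PL_o_def homeomorphism_def by (auto intro!: o_bij simp: fun_eq_iff)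

lemma PL_o_right_affine:
  assumes f: "f \<in> PL_o"
  obtains m e where "0 < m" "0 < e" "\<forall>s\<in>{t..t + e}. f s = f t + m * (s - t)"
proof -
  obtain S where S: "finite S" "\<And>u v. {u<..<v} \<inter> S = {} \<Longrightarrow> affine_on {u<..<v} f"
    using f unfolding PL_o_def by blast
  obtain d where d: "0 < d" "\<And>x. x \<in> S \<Longrightarrow> x \<noteq> t \<Longrightarrow> d \<le> dist t x"
    using finite_set_avoid[OF S(1), of t] by blast
  have "{t<..<t + d} \<inter> S = {}" using d(2) by (force simp: dist_real_def)
  then obtain m c where mc: "\<And>s. t < s \<Longrightarrow> s < t + d \<Longrightarrow> f s = m * s + c"
    using S(2) unfolding affine_on_def by (metis greaterThanLessThan_iff)
  have "(f \<longlongrightarrow> f t) (at_right t)"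
    using PL_oD(2)[OF f] by (metis UNIV_I at_within_open continuous_on_def open_UNIV filterlim_at_split)
  moreover have "\<forall>\<^sub>F s in at_right t. f s = m * s + c"
    unfolding eventually_at_right_field using mc d(1) by (intro exI[of _ "t + d"]) auto
  ultimately have "((\<lambda>s. m * s + c) \<longlongrightarrow> f t) (at_right t)" by (rule Lim_transform_eventually)
  moreover have "((\<lambda>s. m * s + c) \<longlongrightarrow> m * t + c) (at_right t)" by (intro tendsto_intros)
  ultimately have ft: "f t = m * t + c" by (rule tendsto_unique[OF trivial_limit_at_right_real])
  have eq: "\<forall>s\<in>{t..t + d / 2}. f s = f t + m * (s - t)"
  proof
    fix s assume "s \<in> {t..t + d / 2}"
    then show "f s = f t + m * (s - t)" using mc[of s] ft d(1) by (cases "s = t") (auto simp: algebra_simps)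
  qed
  have "f t < f (t + d / 2)" using PL_oD(1)[OF f] d(1) by (simp add: strict_mono_less)
  moreover have "f (t + d / 2) = f t + m * (d / 2)" using bspec[OF eq, of "t + d / 2"] d(1) by simp
  ultimately have "0 < m" using d(1) by (simp add: zero_less_mult_iff)
  then show ?thesis by (rule that[OF _ _ eq]) (use d(1) in simp)
qed

lemma PL_o_left_affine:
  assumes f: "f \<in> PL_o"
  obtains m e where "0 < m" "0 < e" "\<forall>s\<in>{t - e..t}. f s = f t + m * (s - t)"
proof -
  obtain S where S: "finite S" "\<And>u v. {u<..<v} \<inter> S = {} \<Longrightarrow> affine_on {u<..<v} f"
    using f unfolding PL_o_def by blast
  obtain d where d: "0 < d" "\<And>x. x \<in> S \<Longrightarrow> x \<noteq> t \<Longrightarrow> d \<le> dist t x"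
    using finite_set_avoid[OF S(1), of t] by blast
  have "{t - d<..<t} \<inter> S = {}" using d(2) by (force simp: dist_real_def)
  then obtain m c where mc: "\<And>s. t - d < s \<Longrightarrow> s < t \<Longrightarrow> f s = m * s + c"
    using S(2) unfolding affine_on_def by (metis greaterThanLessThan_iff)
  have "(f \<longlongrightarrow> f t) (at_left t)"
    using PL_oD(2)[OF f] by (metis UNIV_I at_within_open continuous_on_def open_UNIV filterlim_at_split)
  moreover have "\<forall>\<^sub>F s in at_left t. f s = m * s + c"
    unfolding eventually_at_left_field using mc d(1) by (intro exI[of _ "t - d"]) auto
  ultimately have "((\<lambda>s. m * s + c) \<longlongrightarrow> f t) (at_left t)" by (rule Lim_transform_eventually)
  moreover have "((\<lambda>s. m * s + c) \<longlongrightarrow> m * t + c) (at_left t)" by (intro tendsto_intros)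
  ultimately have ft: "f t = m * t + c" by (rule tendsto_unique[OF trivial_limit_at_left_real])
  have eq: "\<forall>s\<in>{t - d / 2..t}. f s = f t + m * (s - t)"
  proof
    fix s assume "s \<in> {t - d / 2..t}"
    then show "f s = f t + m * (s - t)" using mc[of s] ft d(1) by (cases "s = t") (auto simp: algebra_simps)
  qed
  have "f (t - d / 2) < f t" using PL_oD(1)[OF f] d(1) by (simp add: strict_mono_less)
  moreover have "f (t - d / 2) = f t + m * (- d / 2)" using bspec[OF eq, of "t - d / 2"] d(1) by simp
  ultimately have "0 < m" using d(1) by (simp add: zero_less_mult_iff)
  then show ?thesis by (rule that[OF _ _ eq]) (use d(1) in simp)
qed

lemma inverse_affine_right:
  fixes f h :: "real \<Rightarrow> real"
  assumes hf: "\<And>s. h (f s) = s" and m: "0 < m" and e: "0 < e" and f: "\<forall>s\<in>{t..t + e}. f s = f t + m * (s - t)"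
  shows "\<forall>y\<in>{f t..f t + m * e}. h y = h (f t) + inverse m * (y - f t)"
proof
  fix y assume y: "y \<in> {f t..f t + m * e}"
  define s where "s = t + (y - f t) / m"
  have "s \<in> {t..t + e}" using y m by (auto simp: s_def field_simps)
  then have "f s = y" using bspec[OF f, of s] m by (simp add: s_def)
  then show "h y = h (f t) + inverse m * (y - f t)" using hf[of s] hf[of t] by (simp add: s_def field_simps)
qed

lemma inverse_affine_left:
  fixes f h :: "real \<Rightarrow> real"
  assumes hf: "\<And>s. h (f s) = s" and m: "0 < m" and e: "0 < e" and f: "\<forall>s\<in>{t - e..t}. f s = f t + m * (s - t)"
  shows "\<forall>y\<in>{f t - m * e..f t}. h y = h (f t) + inverse m * (y - f t)"
proof
  fix y assume y: "y \<in> {f t - m * e..f t}"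
  define s where "s = t + (y - f t) / m"
  have "s \<in> {t - e..t}" using y m by (auto simp: s_def field_simps)
  then have "f s = y" using bspec[OF f, of s] m by (simp add: s_def)
  then show "h y = h (f t) + inverse m * (y - f t)" using hf[of s] hf[of t] by (simp add: s_def field_simps)
qed

lemma PL_o_inverse:
  assumes f: "f \<in> PL_o" shows "fun_inv f \<in> PL_o"
proof -
  have b: "bij f" and sm: "strict_mono f" using PL_oD[OF f] by auto
  have hf: "fun_inv f (f s) = s" and fh: "f (fun_inv f y) = y" for s y
    using b by (auto simp: bij_is_inj bij_is_surj surj_f_inv_f)
  obtain f' where f': "homeomorphism UNIV UNIV f f'" using f unfolding PL_o_def by blast
  \<comment> \<open>the homeomorphism that accompanies \<open>f\<close> can only be its inverse function\<close>
  have "f' = fun_inv f"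
    using f' b by (intro ext) (metis UNIV_I homeomorphism_apply1 homeomorphism_apply2 hf)
  then have "homeomorphism UNIV UNIV (fun_inv f) f" using f' homeomorphism_symD by blast
  moreover have "strict_mono (fun_inv f)"
    by (intro strict_monoI) (metis fh sm strict_mono_less)
  moreover obtain S where S: "finite S" "\<And>u v. {u<..<v} \<inter> S = {} \<Longrightarrow> affine_on {u<..<v} f"
    using f unfolding PL_o_def by blast
  have "affine_on {u<..<v} (fun_inv f)" if uv: "{u<..<v} \<inter> f ` S = {}" for u v
  proof (cases "u < v")
    case True
    have less: "u < f s \<longleftrightarrow> fun_inv f u < s" "f s < v \<longleftrightarrow> s < fun_inv f v" for s
      using strict_mono_less[OF sm, of "fun_inv f u" s] strict_mono_less[OF sm, of s "fun_inv f v"] fh by auto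
    have "{fun_inv f u<..<fun_inv f v} \<inter> S = {}"
    proof (rule equals0I)
      fix x assume "x \<in> {fun_inv f u<..<fun_inv f v} \<inter> S"
      then have "f x \<in> {u<..<v} \<inter> f ` S" using less by auto
      then show False using uv by blast
    qed
    then obtain m c where mc: "\<And>s. fun_inv f u < s \<Longrightarrow> s < fun_inv f v \<Longrightarrow> f s = m * s + c"
      using S(2) unfolding affine_on_def by (metis greaterThanLessThan_iff)
    have "fun_inv f u < fun_inv f v" using less(1)[of "fun_inv f v"] fh True by simp
    then obtain s1 where s1: "fun_inv f u < s1" "s1 < fun_inv f v" using dense by blast
    then obtain s2 where s2: "s1 < s2" "s2 < fun_inv f v" using dense by blast
    have "f s1 < f s2" using sm s2 by (simp add: strict_mono_less)
    then have m: "m \<noteq> 0" using mc[of s1] mc[of s2] s1 s2 by auto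
    have "fun_inv f y = inverse m * y + (- c / m)" if y: "y \<in> {u<..<v}" for y
    proof -
      have "y = m * fun_inv f y + c" using mc[of "fun_inv f y"] less[of "fun_inv f y"] fh y by simp
      then have "y - c = m * fun_inv f y" by linarith
      then have "fun_inv f y = (y - c) / m" using m by simp
      then show ?thesis by (simp add: divide_inverse algebra_simps)
    qed
    then show ?thesis unfolding affine_on_def by blast
  qed (simp add: affine_on_def)
  then have "\<exists>S. finite S \<and> (\<forall>u v. {u<..<v} \<inter> S = {} \<longrightarrow> affine_on {u<..<v} (fun_inv f))"
    using S(1) by blast
  ultimately show ?thesis unfolding PL_o_def by blast
qed

text \<open>Membership of inverses has to be established first, because the subgroup hypothesis speaks
  about the inverse operation of \<open>comp_group (PL_G I A P)\<close>, which is meaningful only if inverse functions stay in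
  the carrier.\<close>

lemma PL_G_inverse:
  assumes P: "\<And>p. p \<in> P \<Longrightarrow> inverse p \<in> P" and f: "f \<in> PL_G I A P"
  shows "fun_inv f \<in> PL_G I A P"
proof -
  have pl: "f \<in> PL_o" and sup: "support f \<subseteq> I" and sl: "slopes f \<subseteq> P" and br: "break_points f \<subseteq> A" and im: "f ` A = A"
    using f by (auto simp: PL_G_def)
  let ?h = "fun_inv f"
  have hf: "?h (f s) = s" and fh: "f (?h y) = y" for s y
    using PL_oD(3)[OF pl] by (auto simp: bij_is_inj bij_is_surj surj_f_inv_f)
  have local: "\<exists>l r. 0 < l \<and> 0 < r \<and> (f has_real_derivative l) (at_left t) \<and> (f has_real_derivative r) (at_right t) \<and>
     (?h has_real_derivative inverse l) (at_left (f t)) \<and> (?h has_real_derivative inverse r) (at_right (f t))" for t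
  proof -
    obtain r e where r: "0 < r" "0 < e" "\<forall>s\<in>{t..t + e}. f s = f t + r * (s - t)"
      using PL_o_right_affine[OF pl] by blast
    obtain l d where l: "0 < l" "0 < d" "\<forall>s\<in>{t - d..t}. f s = f t + l * (s - t)"
      using PL_o_left_affine[OF pl] by blast
    have "(?h has_real_derivative inverse r) (at_right (f t))"
      by (rule affine_right_derivative[OF _ inverse_affine_right[OF hf r]]) (use r in simp)
    moreover have "(?h has_real_derivative inverse l) (at_left (f t))"
      by (rule affine_left_derivative[OF _ inverse_affine_left[OF hf l]]) (use l in simp)
    ultimately show ?thesis
      using r l affine_right_derivative[OF r(2,3)] affine_left_derivative[OF l(2,3)] by blast
  qed
  have "slopes ?h \<subseteq> P"
  proof
    fix d assume "d \<in> slopes ?h"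
    then obtain y where y: "(?h has_real_derivative d) (at y)" by (auto simp: slopes_def)
    obtain l r where lr: "0 < l" "0 < r" "(f has_real_derivative l) (at_left (?h y))" "(f has_real_derivative r) (at_right (?h y))"
      "(?h has_real_derivative inverse l) (at_left y)" "(?h has_real_derivative inverse r) (at_right y)"
      using local[of "?h y"] unfolding fh by blast
    have "d = inverse l" "d = inverse r"
      using left_derivative_unique[OF has_field_derivative_at_within[OF y] lr(5)]
        right_derivative_unique[OF has_field_derivative_at_within[OF y] lr(6)] by auto
    then have "l = r" "d = inverse l" by auto
    then have "(f has_real_derivative l) (at (?h y))" using lr derivative_from_sides by blast
    then have "l \<in> slopes f" by (auto simp: slopes_def)
    then show "d \<in> P" using sl P \<open>d = inverse l\<close> by blast
  qed
  moreover have "break_points ?h \<subseteq> A"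
  proof
    fix y assume "y \<in> break_points ?h"
    then obtain d e where y: "(?h has_real_derivative d) (at_left y)" "(?h has_real_derivative e) (at_right y)" "d \<noteq> e"
      by (auto simp: break_points_def)
    obtain l r where lr: "0 < l" "0 < r" "(f has_real_derivative l) (at_left (?h y))" "(f has_real_derivative r) (at_right (?h y))"
      "(?h has_real_derivative inverse l) (at_left y)" "(?h has_real_derivative inverse r) (at_right y)"
      using local[of "?h y"] unfolding fh by blast
    have "l \<noteq> r" using left_derivative_unique[OF y(1) lr(5)] right_derivative_unique[OF y(2) lr(6)] y(3) by auto
    then have "?h y \<in> break_points f" using lr by (auto simp: break_points_def)
    then have "f (?h y) \<in> f ` A" using br by blast
    then show "y \<in> A" using im fh by simp
  qed
  moreover have "support ?h \<subseteq> I"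
  proof
    fix t assume "t \<in> support ?h"
    then have "f t \<noteq> t" using hf[of t] by (auto simp: support_def)
    then show "t \<in> I" using sup by (auto simp: support_def)
  qed
  moreover have "?h ` A = A"
  proof -
    have "?h ` f ` A = A" by (simp add: image_image hf)
    then show ?thesis using im by simp
  qed
  ultimately show ?thesis using PL_o_inverse[OF pl] by (simp add: PL_G_def)
qed

text \<open>The support condition leaves the end points open. There continuity decides: just beyond an end
  point the element is the identity, and it is affine up to the end point.\<close>

lemma PL_G_fixes_outside:
  assumes g: "g \<in> PL_G {l..u} A P" and t: "t \<notin> {l<..<u}"
  shows "g t = t"
proof -
  have out: "g s = s" if "s < l \<or> u < s" for s
  proof -
    have "support g \<subseteq> {l..u}" using g by (simp add: PL_G_def)
    then show ?thesis using that unfolding support_def by force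
  qed
  have pl: "g \<in> PL_o" using g by (simp add: PL_G_def)
  have gl: "g l = l"
  proof -
    obtain m e where m: "0 < e" "\<forall>s\<in>{l - e..l}. g s = g l + m * (s - l)" using PL_o_left_affine[OF pl] by metis
    have "g (l - e) = g l + m * (- e)" "g (l - e / 2) = g l + m * (- e / 2)"
      using bspec[OF m(2), of "l - e"] bspec[OF m(2), of "l - e / 2"] m(1) by auto
    moreover have "g (l - e) = l - e" "g (l - e / 2) = l - e / 2" using out m(1) by auto
    ultimately show ?thesis by (simp add: field_simps)
  qed
  have gu: "g u = u"
  proof -
    obtain m e where m: "0 < e" "\<forall>s\<in>{u..u + e}. g s = g u + m * (s - u)" using PL_o_right_affine[OF pl] by metis
    have "g (u + e) = g u + m * e" "g (u + e / 2) = g u + m * (e / 2)"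
      using bspec[OF m(2), of "u + e"] bspec[OF m(2), of "u + e / 2"] m(1) by auto
    moreover have "g (u + e) = u + e" "g (u + e / 2) = u + e / 2" using out m(1) by auto
    ultimately show ?thesis by (simp add: field_simps)
  qed
  from out[of t] t gl gu show ?thesis by (cases "t = l \<or> t = u") auto
qed

section \<open>Piecewise linear bumps\<close>

text \<open>Slope \<open>p\<close> on an interval of length \<open>x\<close>, followed by slope \<open>1 / p\<close> until the graph returns to the
  diagonal at \<open>a + (p + 1) * x\<close>. Writing the function with \<open>max\<close> and \<open>min\<close> makes continuity and
  strict monotonicity immediate, and inverting each of the three affine functions while exchanging \<open>max\<close> and \<open>min\<close>
  gives the inverse.\<close>

definition bump :: "real \<Rightarrow> real \<Rightarrow> real \<Rightarrow> real \<Rightarrow> real" where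
  "bump a x p t = max t (min (a + p * (t - a)) (a + p * x + (t - a - x) / p))"

definition bump_inv :: "real \<Rightarrow> real \<Rightarrow> real \<Rightarrow> real \<Rightarrow> real" where
  "bump_inv a x p t = min t (max (a + (t - a) / p) (a + x + p * (t - a - p * x)))"

lemma bump_cases:
  assumes "1 < p" "0 < x"
  shows "t \<le> a \<Longrightarrow> bump a x p t = t"
    "a \<le> t \<Longrightarrow> t \<le> a + x \<Longrightarrow> bump a x p t = a + p * (t - a)"
    "a + x \<le> t \<Longrightarrow> t \<le> a + (p + 1) * x \<Longrightarrow> bump a x p t = a + p * x + (t - a - x) / p"
    "a + (p + 1) * x \<le> t \<Longrightarrow> bump a x p t = t"
proof -
  define L where "L = a + p * (t - a)"
  define M where "M = a + p * x + (t - a - x) / p"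
  have bump: "bump a x p t = max t (min L M)" by (simp add: bump_def L_def M_def)
  have "inverse p < 1" using assms by (simp add: inverse_less_1_iff)
  then have k: "0 \<le> p - inverse p" "0 \<le> 1 - inverse p" "0 \<le> p - 1" using assms by simp_all
  \<comment> \<open>the three affine functions cross at \<open>a\<close>, \<open>a + x\<close> and \<open>a + (p + 1) * x\<close>\<close>
  have LM: "M - L = (p - inverse p) * (a + x - t)"
    using assms unfolding L_def M_def by (simp add: field_simps)
  have M: "M - t = (1 - inverse p) * (a + (p + 1) * x - t)"
    using assms unfolding M_def by (simp add: field_simps)
  have L: "L - t = (p - 1) * (t - a)" unfolding L_def by (simp add: algebra_simps)
  have LM': "t \<le> a + x \<Longrightarrow> L \<le> M" "a + x \<le> t \<Longrightarrow> M \<le> L"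
    using LM mult_nonneg_nonneg[OF k(1), of "a + x - t"] mult_nonneg_nonpos[OF k(1), of "a + x - t"] by linarith+
  have M': "t \<le> a + (p + 1) * x \<Longrightarrow> t \<le> M" "a + (p + 1) * x \<le> t \<Longrightarrow> M \<le> t"
    using M mult_nonneg_nonneg[OF k(2), of "a + (p + 1) * x - t"] mult_nonneg_nonpos[OF k(2), of "a + (p + 1) * x - t"]
    by linarith+
  have L': "a \<le> t \<Longrightarrow> t \<le> L" "t \<le> a \<Longrightarrow> L \<le> t"
    using L mult_nonneg_nonneg[OF k(3), of "t - a"] mult_nonneg_nonpos[OF k(3), of "t - a"] by linarith+
  show "t \<le> a \<Longrightarrow> bump a x p t = t" using L' unfolding bump by linarith
  show "a \<le> t \<Longrightarrow> t \<le> a + x \<Longrightarrow> bump a x p t = a + p * (t - a)"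
    using L' LM' unfolding bump L_def[symmetric] by linarith
  show "a + x \<le> t \<Longrightarrow> t \<le> a + (p + 1) * x \<Longrightarrow> bump a x p t = a + p * x + (t - a - x) / p"
    using M' LM' unfolding bump M_def[symmetric] by linarith
  show "a + (p + 1) * x \<le> t \<Longrightarrow> bump a x p t = t" using M' unfolding bump by linarith
qed

lemma bump_inv_cases:
  assumes "1 < p" "0 < x"
  shows "t \<le> a \<Longrightarrow> bump_inv a x p t = t"
    "a \<le> t \<Longrightarrow> t \<le> a + p * x \<Longrightarrow> bump_inv a x p t = a + (t - a) / p"
    "a + p * x \<le> t \<Longrightarrow> t \<le> a + (p + 1) * x \<Longrightarrow> bump_inv a x p t = a + x + p * (t - a - p * x)"
    "a + (p + 1) * x \<le> t \<Longrightarrow> bump_inv a x p t = t"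
proof -
  define L where "L = a + (t - a) / p"
  define M where "M = a + x + p * (t - a - p * x)"
  have bump: "bump_inv a x p t = min t (max L M)" by (simp add: bump_inv_def L_def M_def)
  have "inverse p < 1" using assms by (simp add: inverse_less_1_iff)
  then have k: "0 \<le> p - inverse p" "0 \<le> 1 - inverse p" "0 \<le> p - 1" using assms by simp_all
  have LM: "M - L = (p - inverse p) * (t - (a + p * x))"
    using assms unfolding L_def M_def by (simp add: field_simps)
  have M: "t - M = (p - 1) * (a + (p + 1) * x - t)"
    unfolding M_def by (simp add: algebra_simps)
  have L: "t - L = (1 - inverse p) * (t - a)" using assms unfolding L_def by (simp add: field_simps)
  have LM': "a + p * x \<le> t \<Longrightarrow> L \<le> M" "t \<le> a + p * x \<Longrightarrow> M \<le> L"
    using LM mult_nonneg_nonneg[OF k(1), of "t - (a + p * x)"] mult_nonneg_nonpos[OF k(1), of "t - (a + p * x)"] by linarith+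
  have M': "t \<le> a + (p + 1) * x \<Longrightarrow> M \<le> t" "a + (p + 1) * x \<le> t \<Longrightarrow> t \<le> M"
    using M mult_nonneg_nonneg[OF k(3), of "a + (p + 1) * x - t"] mult_nonneg_nonpos[OF k(3), of "a + (p + 1) * x - t"]
    by linarith+
  have L': "a \<le> t \<Longrightarrow> L \<le> t" "t \<le> a \<Longrightarrow> t \<le> L"
    using L mult_nonneg_nonneg[OF k(2), of "t - a"] mult_nonneg_nonpos[OF k(2), of "t - a"] by linarith+
  show "t \<le> a \<Longrightarrow> bump_inv a x p t = t" using L' unfolding bump by linarith
  show "a \<le> t \<Longrightarrow> t \<le> a + p * x \<Longrightarrow> bump_inv a x p t = a + (t - a) / p"
    using L' LM' unfolding bump L_def[symmetric] by linarith
  show "a + p * x \<le> t \<Longrightarrow> t \<le> a + (p + 1) * x \<Longrightarrow> bump_inv a x p t = a + x + p * (t - a - p * x)"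
    using M' LM' unfolding bump M_def[symmetric] by linarith
  show "a + (p + 1) * x \<le> t \<Longrightarrow> bump_inv a x p t = t" using M' unfolding bump by linarith
qed

lemma bump_inv_bump:
  assumes px: "1 < p" "0 < x" shows "bump_inv a x p (bump a x p t) = t"
proof -
  consider (1) "t \<le> a" | (2) "a \<le> t" "t \<le> a + x" | (3) "a + x \<le> t" "t \<le> a + (p + 1) * x" | (4) "a + (p + 1) * x \<le> t"
    by linarith
  then show ?thesis
  proof cases
    case 1
    then show ?thesis using bump_cases(1)[OF px 1] bump_inv_cases(1)[OF px 1] by simp
  next
    case 2
    have "a \<le> a + p * (t - a)" "a + p * (t - a) \<le> a + p * x" using 2 px by auto
    then show ?thesis using bump_cases(2)[OF px 2] bump_inv_cases(2)[OF px] px by simp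
  next
    case 3
    have "a + p * x \<le> a + p * x + (t - a - x) / p" "a + p * x + (t - a - x) / p \<le> a + (p + 1) * x" 
      using 3 px by (auto simp: field_simps)
    then show ?thesis using bump_cases(3)[OF px 3] bump_inv_cases(3)[OF px] px by simp
  next
    case 4
    then show ?thesis using bump_cases(4)[OF px 4] bump_inv_cases(4)[OF px 4] by simp
  qed
qed

lemma bump_bump_inv:
  assumes px: "1 < p" "0 < x" shows "bump a x p (bump_inv a x p t) = t"
proof -
  consider (1) "t \<le> a" | (2) "a \<le> t" "t \<le> a + p * x" | (3) "a + p * x \<le> t" "t \<le> a + (p + 1) * x" | (4) "a + (p + 1) * x \<le> t"
    by linarith
  then show ?thesis
  proof cases
    case 1
    then show ?thesis using bump_cases(1)[OF px 1] bump_inv_cases(1)[OF px 1] by simp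
  next
    case 2
    have "a \<le> a + (t - a) / p" "a + (t - a) / p \<le> a + x" using 2 px by (auto simp: field_simps)
    then show ?thesis using bump_cases(2)[OF px] bump_inv_cases(2)[OF px 2] px by simp
  next
    case 3
    have "0 \<le> p * (t - a - p * x)" using 3 px by simp
    moreover have "p * (t - a - p * x) \<le> p * x" using 3 px by (intro mult_left_mono) (auto simp: algebra_simps)
    ultimately have "a + x \<le> a + x + p * (t - a - p * x)" "a + x + p * (t - a - p * x) \<le> a + (p + 1) * x" 
      by (auto simp: algebra_simps)
    then show ?thesis using bump_cases(3)[OF px] bump_inv_cases(3)[OF px 3] px by simp
  next
    case 4
    then show ?thesis using bump_cases(4)[OF px 4] bump_inv_cases(4)[OF px 4] by simp
  qed
qed

lemma bump_PL_o:
  assumes px: "1 < p" "0 < x" shows "bump a x p \<in> PL_o"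
proof -
  have "homeomorphism UNIV UNIV (bump a x p) (bump_inv a x p)"
  proof (rule homeomorphismI)
    show "continuous_on UNIV (bump a x p)"
      unfolding bump_def[abs_def] by (intro continuous_intros) (use px in auto)
    show "continuous_on UNIV (bump_inv a x p)"
      unfolding bump_inv_def[abs_def] by (intro continuous_intros) (use px in auto)
  qed (use bump_inv_bump[OF px] bump_bump_inv[OF px] in auto)
  moreover have "strict_mono (bump a x p)"
  proof (rule strict_monoI)
    fix s t :: real assume st: "s < t"
    have "a + p * (s - a) < a + p * (t - a)" using st px by simp
    moreover have "a + p * x + (s - a - x) / p < a + p * x + (t - a - x) / p" using st px by (simp add: divide_strict_right_mono)
    ultimately show "bump a x p s < bump a x p t" unfolding bump_def using st by (simp add: max_def min_def)
  qed
  moreover have "affine_on {u<..<v} (bump a x p)" if uv: "{u<..<v} \<inter> {a, a + x, a + (p + 1) * x} = {}" for u v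
  proof -
    have o: "s \<le> u \<or> v \<le> s" if "s \<in> {a, a + x, a + (p + 1) * x}" for s 
    proof (rule ccontr)
      assume "\<not> ?thesis"
      then have "s \<in> {u<..<v}" by simp
      then show False using uv that by blast
    qed
    consider "v \<le> a" | "a \<le> u" "v \<le> a + x" | "a + x \<le> u" "v \<le> a + (p + 1) * x" | "a + (p + 1) * x \<le> u"
      using o[of a] o[of "a + x"] o[of "a + (p + 1) * x"] by auto
    then show ?thesis
    proof cases
      case 1
      have "\<forall>t\<in>{u<..<v}. bump a x p t = 1 * t + 0" using bump_cases(1)[OF px] 1 by simp
      then show ?thesis unfolding affine_on_def by blast
    next
      case 2
      have "\<forall>t\<in>{u<..<v}. bump a x p t = p * t + (a - p * a)" using bump_cases(2)[OF px] 2 by (simp add: algebra_simps)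
      then show ?thesis unfolding affine_on_def by blast
    next
      case 3
      have "\<forall>t\<in>{u<..<v}. bump a x p t = inverse p * t + (a + p * x - (a + x) / p)" 
        using bump_cases(3)[OF px] 3 by (simp add: diff_divide_distrib add_divide_distrib divide_inverse algebra_simps)
      then show ?thesis unfolding affine_on_def by blast
    next
      case 4
      have "\<forall>t\<in>{u<..<v}. bump a x p t = 1 * t + 0" using bump_cases(4)[OF px] 4 by simp
      then show ?thesis unfolding affine_on_def by blast
    qed
  qed
  then have "\<exists>S. finite S \<and> (\<forall>u v. {u<..<v} \<inter> S = {} \<longrightarrow> affine_on {u<..<v} (bump a x p))"
    by (intro exI[of _ "{a, a + x, a + (p + 1) * x}"]) simp
  ultimately show ?thesis unfolding PL_o_def by blast
qed

text \<open>The right derivative exists everywhere, so it decides which slopes can occur, whether or not the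
  point is a corner.\<close>

lemma bump_right_slope:
  assumes px: "1 < p" "0 < x"
  shows "\<exists>m\<in>{1, p, inverse p}. (bump a x p has_real_derivative m) (at_right t) \<and>
    (t \<notin> {a, a + x, a + (p + 1) * x} \<longrightarrow> (bump a x p has_real_derivative m) (at t))"
proof -
  have D: "(bump a x p has_real_derivative m) (at_right t) \<and>
      (t \<notin> {a, a + x, a + (p + 1) * x} \<longrightarrow> (bump a x p has_real_derivative m) (at t))"
    if "u \<le> t" "t < v" "u < t \<or> t \<in> {a, a + x, a + (p + 1) * x}" 
      and eq: "\<And>s. u \<le> s \<Longrightarrow> s \<le> v \<Longrightarrow> bump a x p s = k + m * s" for u v m k
  proof
    show "(bump a x p has_real_derivative m) (at_right t)"
    proof (rule affine_right_derivative[of "v - t"])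
      show "\<forall>s\<in>{t..t + (v - t)}. bump a x p s = bump a x p t + m * (s - t)"
      proof
        fix s assume "s \<in> {t..t + (v - t)}"
        then show "bump a x p s = bump a x p t + m * (s - t)" 
          using eq[of s] eq[of t] that(1,2) by (simp add: algebra_simps)
      qed
    qed (use that in simp)
    show "t \<notin> {a, a + x, a + (p + 1) * x} \<longrightarrow> (bump a x p has_real_derivative m) (at t)"
    proof
      assume "t \<notin> {a, a + x, a + (p + 1) * x}"
      then have t: "t \<in> {u<..<v}" using that by auto
      have "((\<lambda>s. k + m * s) has_real_derivative m) (at t)" by (auto intro!: derivative_eq_intros)
      then show "(bump a x p has_real_derivative m) (at t)"
        by (rule has_field_derivative_transform_within_open[OF _ open_greaterThanLessThan t]) (simp add: eq)
    qed
  qed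
  have lt: "a + x < a + (p + 1) * x" using px by (simp add: algebra_simps)
  consider (1) "t < a" | (2) "a \<le> t" "t < a + x" | (3) "a + x \<le> t" "t < a + (p + 1) * x" | (4) "a + (p + 1) * x \<le> t"
    by linarith
  then show ?thesis
  proof cases
    case 1
    have "bump a x p s = 0 + 1 * s" if "t - 1 \<le> s" "s \<le> a" for s using bump_cases(1)[OF px that(2)] by simp
    from D[where u = "t - 1" and v = a, OF _ _ _ this] 1 show ?thesis by auto
  next
    case 2
    have "bump a x p s = (a - p * a) + p * s" if "a \<le> s" "s \<le> a + x" for s 
      using bump_cases(2)[OF px that] by (simp add: algebra_simps)
    from D[where u = a and v = "a + x", OF _ _ _ this] 2 show ?thesis by (cases "t = a") auto
  next
    case 3
    have "bump a x p s = (a + p * x - (a + x) / p) + inverse p * s" if "a + x \<le> s" "s \<le> a + (p + 1) * x" for s 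
      using bump_cases(3)[OF px that] by (simp add: diff_divide_distrib add_divide_distrib divide_inverse algebra_simps)
    from D[where u = "a + x" and v = "a + (p + 1) * x", OF _ _ _ this] 3 show ?thesis by (cases "t = a + x") auto
  next
    case 4
    have "bump a x p s = 0 + 1 * s" if "a + (p + 1) * x \<le> s" "s \<le> t + 1" for s using bump_cases(4)[OF px that(1)] by simp
    from D[where u = "a + (p + 1) * x" and v = "t + 1", OF _ _ _ this] 4 show ?thesis by (cases "t = a + (p + 1) * x") auto
  qed
qed

section \<open>Groups between the bounded elements and the full group\<close>

locale slope_module =
  fixes P A :: "real set"
  assumes P: "subgroup P pos_real_group" "P \<noteq> {1}"
    and A: "subgroup A add_real_group" "A \<noteq> {0}" "\<And>p a. p \<in> P \<Longrightarrow> a \<in> A \<Longrightarrow> p * a \<in> A"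
begin

lemma P_facts: "P \<subseteq> {0<..}" "1 \<in> P" "\<And>p q. p \<in> P \<Longrightarrow> q \<in> P \<Longrightarrow> p * q \<in> P" "\<And>p. p \<in> P \<Longrightarrow> inverse p \<in> P"
proof -
  show P0: "P \<subseteq> {0<..}" using subgroup.subset[OF P(1)] by (simp add: pos_real_group_def)
  show "1 \<in> P" using subgroup.one_closed[OF P(1)] by (simp add: pos_real_group_def)
  show "p * q \<in> P" if "p \<in> P" "q \<in> P" for p q 
    using subgroup.m_closed[OF P(1) that] by (simp add: pos_real_group_def)
  show "inverse p \<in> P" if "p \<in> P" for p
    using subgroup.m_inv_closed[OF P(1) that] pos_real_group_inverse[of p] P0 that by auto
qed

lemma A_facts: "0 \<in> A" "\<And>a c. a \<in> A \<Longrightarrow> c \<in> A \<Longrightarrow> a + c \<in> A" "\<And>a. a \<in> A \<Longrightarrow> - a \<in> A"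
  "\<And>a c. a \<in> A \<Longrightarrow> c \<in> A \<Longrightarrow> a - c \<in> A"
proof -
  show "0 \<in> A" using subgroup.one_closed[OF A(1)] by (simp add: add_real_group_def)
  show add: "a + c \<in> A" if "a \<in> A" "c \<in> A" for a c
    using subgroup.m_closed[OF A(1) that] by (simp add: add_real_group_def)
  show um: "- a \<in> A" if "a \<in> A" for a
    using subgroup.m_inv_closed[OF A(1) that] add_real_group_inverse[of a] by simp
  show "a - c \<in> A" if "a \<in> A" "c \<in> A" for a c
    using add[OF that(1) um[OF that(2)]] by simp
qed

lemma expanding_slope: obtains p where "p \<in> P" "1 < p"
proof -
  obtain q where q: "q \<in> P" "q \<noteq> 1" using P(2) P_facts(2) by blast
  have "0 < q" using q P_facts(1) by auto
  show ?thesis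
  proof (cases "1 < q")
    case True then show ?thesis using that q by blast
  next
    case False
    then have "1 < inverse q" using \<open>0 < q\<close> q(2) by (simp add: one_less_inverse_iff)
    then show ?thesis using that P_facts(4)[OF q(1)] by blast
  qed
qed

text \<open>A non-zero element of \<open>A\<close> can be shrunk by powers of a slope below \<open>1\<close>.\<close>

lemma small_element:
  assumes "0 < e" obtains x where "x \<in> A" "0 < x" "x < e"
proof -
  obtain y where y: "y \<in> A" "y \<noteq> 0" using A(2) A_facts(1) by blast
  then obtain a where a: "a \<in> A" "0 < a" using A_facts(3)[of y] by (cases "0 < y") auto
  obtain p where p: "p \<in> P" "1 < p" using expanding_slope .
  have q: "inverse p \<in> P" "0 < inverse p" "inverse p < 1" using P_facts(4)[OF p(1)] p(2) by (auto simp: inverse_less_1_iff)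
  have mem: "inverse p ^ n * a \<in> A" for n
    by (induction n) (use a A(3)[OF q(1)] in \<open>auto simp: mult.assoc\<close>)
  obtain n where "inverse p ^ n < e / a" using real_arch_pow_inv[of "e / a" "inverse p"] assms a q by auto
  then have "inverse p ^ n * a < e" using a by (simp add: pos_less_divide_eq)
  moreover have "0 < inverse p ^ n * a" using q a by simp
  ultimately show ?thesis using that mem by blast
qed

lemma dense_A:
  assumes "u < v" obtains a where "a \<in> A" "u < a" "a < v"
proof -
  obtain x where x: "x \<in> A" "0 < x" "x < v - u" using small_element[of "v - u"] assms by auto
  have nat: "real n * x \<in> A" for n
    by (induction n) (use A_facts x in \<open>auto simp: distrib_right\<close>)
  have int: "real_of_int k * x \<in> A" for k
    using nat[of "nat k"] A_facts(3)[OF nat[of "nat (- k)"]] by (cases "0 \<le> k") auto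
  define k where "k = \<lfloor>u / x\<rfloor> + 1"
  have "u / x < real_of_int k" "real_of_int k \<le> u / x + 1" unfolding k_def by linarith+
  then have "u < real_of_int k * x" "real_of_int k * x \<le> u + x" using x(2) by (auto simp: field_simps)
  then show ?thesis using that int x(3) by force
qed

lemma bump_PL_G:
  assumes p: "p \<in> P" "1 < p" and x: "x \<in> A" "0 < x" and a: "a \<in> A" and I: "{a..a + (p + 1) * x} \<subseteq> I"
  shows "bump a x p \<in> PL_G I A P"
proof -
  note px = p(2) x(2)
  have ip: "inverse p \<in> P" using P_facts(4) p by blast
  have px_A: "p * x \<in> A" using A(3) p x by blast
  have end_A: "a + x \<in> A" "a + (p + 1) * x \<in> A"
    using A_facts(2) a x px_A by (auto simp: distrib_right add.assoc)
  have "support (bump a x p) \<subseteq> I"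
  proof
    fix t assume t: "t \<in> support (bump a x p)"
    then have "\<not> t \<le> a" "\<not> a + (p + 1) * x \<le> t"
      using bump_cases(1)[OF px, of t a] bump_cases(4)[OF px, of a t] unfolding support_def by blast+
    then have "t \<in> {a..a + (p + 1) * x}" by simp
    then show "t \<in> I" using I by blast
  qed
  moreover have "slopes (bump a x p) \<subseteq> P"
  proof
    fix d assume "d \<in> slopes (bump a x p)"
    then obtain t where "(bump a x p has_real_derivative d) (at t)" by (auto simp: slopes_def)
    then have d: "(bump a x p has_real_derivative d) (at_right t)" by (rule has_field_derivative_at_within)
    obtain m where m: "m \<in> {1, p, inverse p}" "(bump a x p has_real_derivative m) (at_right t)"
      using bump_right_slope[OF px] by blast
    have "d = m" using right_derivative_unique[OF d m(2)] .
    then show "d \<in> P" using m(1) p(1) ip P_facts(2) by auto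
  qed
  moreover have "break_points (bump a x p) \<subseteq> A"
  proof
    fix t assume "t \<in> break_points (bump a x p)"
    then obtain d e where t: "(bump a x p has_real_derivative d) (at_left t)" "(bump a x p has_real_derivative e) (at_right t)" "d \<noteq> e"
      by (auto simp: break_points_def)
    show "t \<in> A"
    proof (rule ccontr)
      assume "t \<notin> A"
      then have "t \<notin> {a, a + x, a + (p + 1) * x}" using a end_A by blast
      then obtain m where "(bump a x p has_real_derivative m) (at t)"
        using bump_right_slope[OF px, of a t] by blast
      then have "(bump a x p has_real_derivative m) (at_left t)" "(bump a x p has_real_derivative m) (at_right t)"
        by (auto intro: has_field_derivative_at_within)
      then show False using left_derivative_unique[OF t(1)] right_derivative_unique[OF t(2)] t(3) by blast
    qed
  qed
  moreover have "bump a x p ` A = A"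
  proof
    have m: "max y z \<in> A" "min y z \<in> A" if "y \<in> A" "z \<in> A" for y z using that by (auto simp: max_def min_def)
    have "bump a x p t \<in> A" if t: "t \<in> A" for t
    proof -
      have "a + p * (t - a) \<in> A" by (intro A_facts(2,4) A(3) p(1) a t)
      moreover have "a + p * x + (t - a - x) / p \<in> A"
        using A_facts A(3)[OF ip, of "t - a - x"] px_A a t x(1) by (simp add: divide_inverse mult.commute)
      ultimately show ?thesis unfolding bump_def using m t by blast
    qed
    then show "bump a x p ` A \<subseteq> A" by blast
    have inv: "bump_inv a x p t \<in> A" if t: "t \<in> A" for t
    proof -
      have "a + (t - a) / p \<in> A"
        using A_facts A(3)[OF ip, of "t - a"] a t by (simp add: divide_inverse mult.commute)
      moreover have "a + x + p * (t - a - p * x) \<in> A"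
        by (intro A_facts(2,4) A(3) p(1) px_A a t x(1))
      ultimately show ?thesis unfolding bump_inv_def using m t by blast
    qed
    show "A \<subseteq> bump a x p ` A"
    proof
      fix t assume "t \<in> A"
      then show "t \<in> bump a x p ` A" using inv bump_bump_inv[OF px, of a t] by (metis imageI)
    qed
  qed
  ultimately show ?thesis using bump_PL_o[OF px] by (simp add: PL_G_def)
qed

text \<open>The length \<open>x\<close> is chosen so small that a bump starting within distance \<open>x\<close> to the left of \<open>s\<close>
  stays inside \<open>(c, d)\<close>.\<close>

lemma bump_exists:
  assumes "0 \<le> c" "c < s" "s < d" "d \<le> b"
  obtains a x p where "bump a x p \<in> PL_B 0 b A P" "1 < p" "0 < x" "c < a" "a < s" "s < a + x" "a + (p + 1) * x < d"
proof -
  obtain p where p: "p \<in> P" "1 < p" using expanding_slope .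
  define e where "e = min (s - c) (d - s) / (p + 1)"
  have e: "0 < e" using assms p by (simp add: e_def)
  obtain x where x: "x \<in> A" "0 < x" "x < e" using small_element[OF e] .
  have "(p + 1) * x < (p + 1) * e" using x p by simp
  also have "\<dots> = min (s - c) (d - s)" using p by (simp add: e_def)
  finally have px: "(p + 1) * x < s - c" "(p + 1) * x < d - s" by auto
  moreover have "x < (p + 1) * x" using x p by simp
  ultimately have xs: "x < s - c" by linarith
  obtain a where a: "a \<in> A" "s - x < a" "a < s" using dense_A[of "s - x" s] x by auto
  have ends: "c < a" "a < s" "s < a + x" "a + (p + 1) * x < d" using a xs px by linarith+
  have "{a..a + (p + 1) * x} \<subseteq> {0..b}" using ends assms by auto
  then have G: "bump a x p \<in> PL_G {0..b} A P" using bump_PL_G p x a by blast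
  have "\<forall>\<^sub>F t in nhds 0. t < a"
    using eventually_nhds_in_open[of "{..<a}" 0] ends assms by simp
  then have "\<forall>\<^sub>F t in nhds 0. bump a x p t = t"
    by eventually_elim (use bump_cases(1)[OF p(2) x(2)] in auto)
  moreover have "\<forall>\<^sub>F t in nhds b. a + (p + 1) * x < t"
    using eventually_nhds_in_open[of "{a + (p + 1) * x<..}" b] ends assms by simp
  then have "\<forall>\<^sub>F t in nhds b. bump a x p t = t"
    by eventually_elim (use bump_cases(4)[OF p(2) x(2)] in auto)
  ultimately have "bump a x p \<in> PL_B 0 b A P" using G by (simp add: PL_B_def)
  then show ?thesis using that p x ends by blast
qed

lemma pl_moving_group_PL_G:
  assumes b: "0 < b" and G: "subgroup G (comp_group (PL_G {0..b} A P))" "PL_B 0 b A P \<subseteq> G"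
  shows "pl_moving_group b G"
proof -
  let ?K = "PL_G {0..b} A P"
  have sub: "G \<subseteq> ?K" using subgroup.subset[OF G(1)] by (simp add: comp_group_def)
  have pl: "g \<in> PL_o" if "g \<in> G" for g using sub that by (auto simp: PL_G_def)
  have fix_out: "g t = t" if "g \<in> G" "t \<notin> {0<..<b}" for g t
    using PL_G_fixes_outside[OF subsetD[OF sub that(1)] that(2)] .
  show ?thesis
  proof unfold_locales
    show "id \<in> G" using subgroup.one_closed[OF G(1)] by (simp add: comp_group_def)
  next
    fix g h assume "g \<in> G" "h \<in> G"
    then show "g \<circ> h \<in> G" using subgroup.m_closed[OF G(1)] by (simp add: comp_group_def)
  next
    fix g assume g: "g \<in> G"
    then have b: "bij g" using pl PL_oD by blast
    have comp: "g \<circ> fun_inv g = id" "fun_inv g \<circ> g = id"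
      using b by (auto simp: fun_eq_iff bij_is_inj bij_is_surj surj_f_inv_f)
    have "m_inv (comp_group ?K) g = fun_inv g"
      unfolding m_inv_def
    proof (rule the_equality)
      show "fun_inv g \<in> carrier (comp_group ?K) \<and> g \<otimes>\<^bsub>comp_group ?K\<^esub> fun_inv g = \<one>\<^bsub>comp_group ?K\<^esub> \<and>
          fun_inv g \<otimes>\<^bsub>comp_group ?K\<^esub> g = \<one>\<^bsub>comp_group ?K\<^esub>"
        using PL_G_inverse[OF P_facts(4), of g] g sub comp by (auto simp: comp_group_def)
      fix h assume "h \<in> carrier (comp_group ?K) \<and> g \<otimes>\<^bsub>comp_group ?K\<^esub> h = \<one>\<^bsub>comp_group ?K\<^esub> \<and>
          h \<otimes>\<^bsub>comp_group ?K\<^esub> g = \<one>\<^bsub>comp_group ?K\<^esub>"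
      then have "h \<circ> g = id" by (simp add: comp_group_def)
      then have "h \<circ> g \<circ> fun_inv g = fun_inv g" by simp
      then show "h = fun_inv g" using comp(1) by (metis comp_assoc comp_id)
    qed
    then show "fun_inv g \<in> G" using subgroup.m_inv_closed[OF G(1) g] by simp
  next
    fix g assume "g \<in> G"
    then show "bij g" "strict_mono g" using pl PL_oD by blast+
  next
    fix g t assume "g \<in> G" "t \<notin> {0<..<b}"
    then show "g t = t" by (rule fix_out)
  next
    fix c s d :: real assume cd: "0 \<le> c" "c < s" "s < d" "d \<le> b"
    obtain a x p where *: "bump a x p \<in> PL_B 0 b A P" "1 < p" "0 < x" "c < a" "a < s" "s < a + x" "a + (p + 1) * x < d"
      by (rule bump_exists[OF cd]) (rule that)
    note px = *(2,3)
    have "bump a x p t = t" if "t \<notin> {c<..<d}" for t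
      using bump_cases(1)[OF px, of t a] bump_cases(4)[OF px, of a t] that * by force
    moreover have "bump a x p s \<noteq> s"
    proof -
      have "bump a x p s - s = (p - 1) * (s - a)"
        using bump_cases(2)[OF px, of a s] * by (simp add: algebra_simps)
      moreover have "0 < (p - 1) * (s - a)" using * by simp
      ultimately show ?thesis by linarith
    qed
    moreover have "bump a x p \<in> G" using *(1) G(2) by blast
    ultimately show "\<exists>g\<in>G. (\<forall>t. t \<notin> {c<..<d} \<longrightarrow> g t = t) \<and> g s \<noteq> s" by blast
  next
    show "0 < b" by (rule b)
  next
    fix g assume g: "g \<in> G"
    obtain m e where m: "0 < m" "0 < e" "\<forall>s\<in>{0..0 + e}. g s = g 0 + m * (s - 0)" using PL_o_right_affine[OF pl[OF g]] .
    then show "\<exists>p>0. \<exists>e>0. \<forall>t\<in>{0..e}. g t = p * t" using fix_out[OF g, of 0] by auto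
  next
    fix g assume g: "g \<in> G"
    obtain m e where m: "0 < m" "0 < e" "\<forall>s\<in>{b - e..b}. g s = g b + m * (s - b)" using PL_o_left_affine[OF pl[OF g]] .
    have "\<forall>t\<in>{b - e..b}. g t = b - m * (b - t)"
      using m(3) fix_out[OF g, of b] by (simp add: algebra_simps)
    then show "\<exists>p>0. \<exists>e>0. \<forall>t\<in>{b - e..b}. g t = b - p * (b - t)" using m by blast
  next
    fix g and c d :: real assume g: "g \<in> G" and cd: "0 \<le> c" "c < d" "d \<le> b"
    obtain m e where m: "0 < m" "0 < e" "\<forall>s\<in>{c..c + e}. g s = g c + m * (s - c)" using PL_o_right_affine[OF pl[OF g]] .
    have "g s = m * s + (g c - m * c)" if "s \<in> {c<..<min d (c + e)}" for s
      using bspec[OF m(3), of s] that by (simp add: algebra_simps)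
    then have "affine_on {c<..<min d (c + e)} g" unfolding affine_on_def by blast
    then show "\<exists>u v. c \<le> u \<and> u < v \<and> v \<le> d \<and> affine_on {u<..<v} g"
      using cd m(2) by (intro exI[of _ c] exI[of _ "min d (c + e)"]) auto
  next
    fix c d :: real assume cd: "0 \<le> c" "c < d" "d \<le> b"
    obtain s where s: "c < s" "s < d" using dense[OF cd(2)] by blast
    obtain a x p where *: "bump a x p \<in> PL_B 0 b A P" "1 < p" "0 < x" "c < a" "a < s" "s < a + x" "a + (p + 1) * x < d"
      by (rule bump_exists[OF cd(1) s cd(3)]) (rule that)
    note px = *(2,3)
    have "\<forall>t. t \<notin> {c<..<d} \<longrightarrow> bump a x p t = t"
      using bump_cases(1)[OF px, of _ a] bump_cases(4)[OF px, of a] * by force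
    moreover have "\<forall>t\<in>{a<..<a + x}. bump a x p t = a + p * (t - a)"
      using bump_cases(2)[OF px, of a] by simp
    moreover have "a + x < a + (p + 1) * x" using px by (simp add: algebra_simps)
    then have "c < a" "a < d" "a < a + x" "a + x < d" using * s by linarith+
    moreover have "bump a x p \<in> G" "0 < p" "p \<noteq> 1" using * G(2) by auto
    ultimately show "\<exists>g\<in>G. (\<forall>t. t \<notin> {c<..<d} \<longrightarrow> g t = t) \<and>
        (\<exists>a u v p. c < a \<and> a < d \<and> c < u \<and> u < v \<and> v < d \<and> 0 < p \<and> p \<noteq> 1 \<and>
          (\<forall>t\<in>{u<..<v}. g t = a + p * (t - a)))" by blast
  qed
qed

end

theorem theorem3p8:
  fixes P A :: "real set" and b :: real and G :: "(real \<Rightarrow> real) set"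
  assumes P: "subgroup P pos_real_group" "P \<noteq> {1}"
    and A: "subgroup A add_real_group" "A \<noteq> {0}" "\<And>p a. p \<in> P \<Longrightarrow> a \<in> A \<Longrightarrow> p * a \<in> A"
    and b: "b \<in> A" "b > 0"
    and G: "subgroup G (comp_group (PL_G {0..b} A P))" "PL_B 0 b A P \<subseteq> G"
  shows "(\<forall>\<alpha>\<in>aut G. \<forall>g\<in>G. psi b (\<alpha> g) = psi b g) \<or>
    (cyclic_group (pos_real_group\<lparr>carrier := sigma_l ` G\<rparr>) \<and>
     (\<exists>\<alpha>. decreasing_aut {0..b} G \<alpha>) \<and>
     \<not> (\<exists>\<alpha> \<theta>. decreasing_aut {0..b} G \<alpha> \<and> induces {0..b} \<theta> G \<alpha> \<and> diff_at_ends 0 b \<theta>))"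
proof -
  interpret slope_module P A by (rule slope_module.intro) (fact P A)+
  interpret pl_moving_group b G by (rule pl_moving_group_PL_G[OF b(2) G])
  show ?thesis using psi_not_preserved_imp_exceptional by blast
qed

end
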